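(* Let $K\ge 2$ be an integer and consider the $K$-user MISO interference channel with completely outdated (one-slot delayed) local CSIT in which every transmitter is equipped with $K$ antennas (as defined in the context). Define $$\mathcal{O}(K)=\left[1-\frac{1}{K-1}\sum_{l=2}^{K-1}\frac{K-l}{l^2-1}\right]^{-1}$$ (the sum being empty, hence $0$, when $K=2$), and put $\mathcal{O}_1(K)=\lfloor 2\mathcal{O}(K)\rfloor$ and $\mathcal{O}_2(K)=\lceil 2\mathcal{O}(K)\rceil$. Then the sum degrees-of-freedom $$d_s(K)=\max_{i=1,2}\ \frac{\mathcal{O}_i(K)^2}{1+\dfrac{\mathcal{O}_i(K)\,(\mathcal{O}_i(K)-1)}{\mathcal{O}(K)}}$$ is achievable.
   Context: Channel model. There are $K$ transmitter-receiver pairs (Tx$1$,Rx$1$), ..., (Tx$K$,Rx$K$). Each transmitter has $K$ antennas and each receiver has a single antenna. In time slot $t=1,2,\dots$, Tx$j$ sends a vector $\mathbf{s}_j(t)\in\mathbb{C}^{K}$ subject to the power constraint $\mathbb{E}[\|\mathbf{s}_j(t)\|^2]\le P$, and Rx$k$ receives $$y_k(t)=\sum_{j=1}^{K}\mathbf{h}_{kj}(t)^H\mathbf{s}_j(t)+\epsilon_k(t),$$ where $(\cdot)^H$ is the Hermitian transpose, $\epsilon_k(t)$ is additive white Gaussian noise (complex, zero mean, unit variance, independent across time slots and receivers, and independent of the messages and channels), and $\mathbf{h}_{kj}(t)\in\mathbb{C}^{K}$ is the channel vector from Tx$j$ to Rx$k$, with i.i.d. circularly symmetric complex Gaussian entries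 of zero mean and unit variance; the channel vectors are i.i.d. across time slots $t$ and across links $(k,j)$. Messages. The messages intended for the $K$ receivers are independent, and Tx$k$ has access only to the message intended for Rx$k$. Channel knowledge. At time slot $t$, Tx$k$ knows exactly the past local channels $\{\mathbf{h}_{jk}(1),\dots,\mathbf{h}_{jk}(t-1)\}$ for all $j=1,\dots,K$ (and no current channel), so $\mathbf{s}_k(t)$ may depend only on the message for Rx$k$ and on these past local channels. Each receiver knows all channels $\mathbf{h}_{ij}(1),\dots,\mathbf{h}_{ij}(t)$ for all $i,j=1,\dots,K$ perfectly. Achievability. For a given $P$, a rate tuple $(R_1,\dots,R_K)$ is achievable if there are coding schemes over a number of time slots tending to infinity, in which for every $k$ and $t$ the transmitted vector $\mathbf{s}_k(t)$ satisfies $\mathbb{E}[\|\mathbf{s}_k(t)\|^2]\le P$ and depends only on the message for Rx$k$ and on the past local channels $\{\mathbf{h}_{jk}(1),\dots,\mathbf{h}_{jk}(t-1)\}$, $j=1,\dots,K$, and which convey to Rx$k$ its message of rate $R_k$ (in units matching the base of the logarithm $\log P$ used to define the DoF) for every $k$, such that each receiver decodes its desired message with arbitrarily small error probability. A sum degrees-of-freedom (DoF) value $d$ is achievable if for each $P$ there is an achievable rate tuple $(R_1(P),\dots,R_K(P))$ such that $$\lim_{P\to\infty}\frac{\sum_{k=1}^{K}R_k(P)}{\log P}=d.$$ *)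

theory Defs
  imports "HOL-Probability.Probability"
begin

text \<open>
  Users and antennas are indexed by \<open>{1..K}\<close> and the time slots of a code of block length \<open>n\<close>
  by \<open>{1..n}\<close>. A channel realization \<open>H\<close> maps \<open>(t, k, j, a)\<close> to the \<open>a\<close>-th entry of
  the channel vector from Tx \<open>j\<close> to Rx \<open>k\<close> in slot \<open>t\<close>; a noise realization \<open>Z\<close> maps
  \<open>(t, k)\<close> to the noise at Rx \<open>k\<close> in slot \<open>t\<close>.
\<close>

type_synonym channel = "nat \<times> nat \<times> nat \<times> nat \<Rightarrow> complex"
type_synonym noise = "nat \<times> nat \<Rightarrow> complex"

text \<open>
  The circularly symmetric complex Gaussian law with \<open>E|z|\<^sup>2 = 1\<close>, i.e. with
  variance \<open>1/2\<close> for each of the real and imaginary parts.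
\<close>

definition complex_gaussian :: "complex measure" where
  "complex_gaussian = density lborel (\<lambda>z. ennreal (exp (- (cmod z)\<^sup>2) / pi))"

definition channel_index :: "nat \<Rightarrow> nat \<Rightarrow> (nat \<times> nat \<times> nat \<times> nat) set" where
  "channel_index K n = {1..n} \<times> {1..K} \<times> {1..K} \<times> {1..K}"

definition channel_space :: "nat \<Rightarrow> nat \<Rightarrow> channel measure" where
  "channel_space K n = (\<Pi>\<^sub>M i\<in>channel_index K n. complex_gaussian)"

definition noise_space :: "nat \<Rightarrow> nat \<Rightarrow> noise measure" where
  "noise_space K n = (\<Pi>\<^sub>M i\<in>{1..n} \<times> {1..K}. complex_gaussian)"

definition message_space :: "nat \<Rightarrow> (nat \<Rightarrow> nat) \<Rightarrow> (nat \<Rightarrow> nat) measure" where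
  "message_space K M = (\<Pi>\<^sub>M k\<in>{1..K}. uniform_count_measure {..<M k})"

definition past_index :: "nat \<Rightarrow> nat \<Rightarrow> (nat \<times> nat \<times> nat) set" where
  "past_index K t = {1..<t} \<times> {1..K} \<times> {1..K}"

text \<open>
  The delayed local CSIT of Tx \<open>k\<close> at time \<open>t\<close>: its outgoing channels to all receivers
  \<open>j\<close> in the slots \<open>u < t\<close>. Encoders see the channel only through this restriction.
\<close>

definition past_local :: "nat \<Rightarrow> nat \<Rightarrow> nat \<Rightarrow> channel \<Rightarrow> (nat \<times> nat \<times> nat \<Rightarrow> complex)" where
  "past_local K k t H = (\<lambda>(u, j, a)\<in>past_index K t. H (u, j, k, a))"

text \<open>
  \<open>encode C k t w g a\<close> is the symbol on antenna \<open>a\<close> of Tx \<open>k\<close> in slot \<open>t\<close>, given its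
  message \<open>w\<close> and its past local channels \<open>g\<close>; \<open>decode C k (y, H)\<close> is the estimate of Rx \<open>k\<close>
  from its received block \<open>y\<close> and all channels \<open>H\<close>.
\<close>

record ic_code =
  blocklength :: nat
  num_msgs :: "nat \<Rightarrow> nat"
  encode :: "nat \<Rightarrow> nat \<Rightarrow> nat \<Rightarrow> (nat \<times> nat \<times> nat \<Rightarrow> complex) \<Rightarrow> nat \<Rightarrow> complex"
  decode :: "nat \<Rightarrow> (nat \<Rightarrow> complex) \<times> channel \<Rightarrow> nat"

definition code_space ::
  "nat \<Rightarrow> ic_code \<Rightarrow> ((nat \<Rightarrow> nat) \<times> channel \<times> noise) measure" where
  "code_space K C = message_space K (num_msgs C) \<Otimes>\<^sub>M
     (channel_space K (blocklength C) \<Otimes>\<^sub>M noise_space K (blocklength C))"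

definition transmitted ::
  "nat \<Rightarrow> ic_code \<Rightarrow> (nat \<Rightarrow> nat) \<Rightarrow> channel \<Rightarrow> nat \<Rightarrow> nat \<Rightarrow> nat \<Rightarrow> complex" where
  "transmitted K C W H k t = encode C k t (W k) (past_local K k t H)"

definition received ::
  "nat \<Rightarrow> ic_code \<Rightarrow> (nat \<Rightarrow> nat) \<Rightarrow> channel \<Rightarrow> noise \<Rightarrow> nat \<Rightarrow> nat \<Rightarrow> complex" where
  "received K C W H Z k t =
     (\<Sum>j=1..K. \<Sum>a=1..K. cnj (H (t, k, j, a)) * transmitted K C W H j t a) + Z (t, k)"

definition measurable_code :: "nat \<Rightarrow> ic_code \<Rightarrow> bool" where
  "measurable_code K C \<longleftrightarrow>
     (\<forall>k\<in>{1..K}. num_msgs C k \<ge> 1) \<and>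
     (\<forall>k\<in>{1..K}. \<forall>t\<in>{1..blocklength C}. \<forall>w<num_msgs C k. \<forall>a\<in>{1..K}.
        (\<lambda>g. encode C k t w g a) \<in> borel_measurable (\<Pi>\<^sub>M i\<in>past_index K t. borel)) \<and>
     (\<forall>k\<in>{1..K}. decode C k \<in>
        (\<Pi>\<^sub>M t\<in>{1..blocklength C}. borel) \<Otimes>\<^sub>M (\<Pi>\<^sub>M i\<in>channel_index K (blocklength C). borel)
          \<rightarrow>\<^sub>M count_space UNIV)"

definition power_constraint :: "nat \<Rightarrow> real \<Rightarrow> ic_code \<Rightarrow> bool" where
  "power_constraint K P C \<longleftrightarrow>
     (\<forall>k\<in>{1..K}. \<forall>t\<in>{1..blocklength C}.
        (\<integral>\<^sup>+(W, H, Z). ennreal (\<Sum>a=1..K. (cmod (transmitted K C W H k t a))\<^sup>2) \<partial>code_space K C)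
          \<le> ennreal P)"

definition error_event ::
  "nat \<Rightarrow> ic_code \<Rightarrow> nat \<Rightarrow> ((nat \<Rightarrow> nat) \<times> channel \<times> noise) set" where
  "error_event K C k = {(W, H, Z) \<in> space (code_space K C).
     decode C k (\<lambda>t\<in>{1..blocklength C}. received K C W H Z k t, H) \<noteq> W k}"

definition error_prob :: "nat \<Rightarrow> ic_code \<Rightarrow> nat \<Rightarrow> real" where
  "error_prob K C k = measure (code_space K C) (error_event K C k)"

text \<open>Rates are in nats per slot, matching the natural logarithm in \<open>dof_achievable\<close>.\<close>

definition rate_achievable :: "nat \<Rightarrow> real \<Rightarrow> (nat \<Rightarrow> real) \<Rightarrow> bool" where
  "rate_achievable K P R \<longleftrightarrow>
     (\<exists>C :: nat \<Rightarrow> ic_code.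
        (\<forall>i. measurable_code K (C i) \<and> power_constraint K P (C i)) \<and>
        filterlim (\<lambda>i. blocklength (C i)) at_top sequentially \<and>
        (\<forall>k\<in>{1..K}.
           (\<lambda>i. ln (real (num_msgs (C i) k)) / real (blocklength (C i))) \<longlonglongrightarrow> R k \<and>
           (\<lambda>i. error_prob K (C i) k) \<longlonglongrightarrow> 0))"

definition dof_achievable :: "nat \<Rightarrow> real \<Rightarrow> bool" where
  "dof_achievable K d \<longleftrightarrow>
     (\<exists>R :: real \<Rightarrow> nat \<Rightarrow> real.
        (\<forall>P>0. rate_achievable K P (R P)) \<and>
        ((\<lambda>P. (\<Sum>k=1..K. R P k) / ln P) \<longlongrightarrow> d) at_top)"

definition order_param :: "nat \<Rightarrow> real" where
  "order_param K =
     inverse (1 - 1 / (real K - 1) * (\<Sum>l=2..K-1. (real K - real l) / ((real l)\<^sup>2 - 1)))"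

definition sum_dof :: "nat \<Rightarrow> real" where
  "sum_dof K =
     (let f = (\<lambda>m::int. (real_of_int m)\<^sup>2 /
                (1 + real_of_int m * (real_of_int m - 1) / order_param K))
      in max (f \<lfloor>2 * order_param K\<rfloor>) (f \<lceil>2 * order_param K\<rceil>))"

text \<open>
  The following facts show that the measures above are probability measures and that the error
  events of a measurable code are measurable, so that \<open>measure\<close> is not a default value.
\<close>

lemma sets_complex_gaussian [simp, measurable_cong]: "sets complex_gaussian = sets borel"
  by (simp add: complex_gaussian_def)

lemma space_complex_gaussian [simp]: "space complex_gaussian = UNIV"
  by (simp add: complex_gaussian_def)

lemma prob_space_complex_gaussian: "prob_space complex_gaussian"
proof -
  let ?f = "\<lambda>x::real. ennreal (normal_density 0 (1 / sqrt 2) x)"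
  have split: "ennreal (exp (- (cmod z)\<^sup>2) / pi) = ?f (Re z) * ?f (Im z)" for z
    by (simp add: normal_density_def cmod_power2 power_divide mult_exp_exp
      flip: ennreal_mult' power2_eq_square)
  have one: "(\<integral>\<^sup>+x. ?f x \<partial>lborel) = 1"
  proof -
    interpret prob_space "density lborel ?f"
      by (rule prob_space_normal_density) simp
    show ?thesis using emeasure_space_1 by (simp add: emeasure_density)
  qed
  have "emeasure complex_gaussian (space complex_gaussian)
      = (\<integral>\<^sup>+z. (\<Prod>b\<in>Basis. ?f (z \<bullet> b)) \<partial>(lborel :: complex measure))"
    by (simp add: complex_gaussian_def emeasure_density split Basis_complex_def)
  also have "\<dots> = 1"
    by (subst nn_integral_lborel_prod) (simp_all add: one)
  finally show ?thesis by (rule prob_spaceI)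
qed

lemma prob_space_code_space:
  assumes "measurable_code K C"
  shows "prob_space (code_space K C)"
proof -
  have "prob_space (message_space K (num_msgs C))"
    unfolding message_space_def
  proof (rule prob_space_PiM)
    fix k assume "k \<in> {1..K}"
    with assms have "num_msgs C k \<ge> 1" by (auto simp: measurable_code_def)
    then have "{..<num_msgs C k} \<noteq> {}" by (metis lessThan_iff empty_iff less_le_trans zero_less_one)
    then show "prob_space (uniform_count_measure {..<num_msgs C k})"
      by (intro prob_space_uniform_count_measure) auto
  qed
  moreover have "prob_space (channel_space K (blocklength C))" "prob_space (noise_space K (blocklength C))"
    unfolding channel_space_def noise_space_def
    by (auto intro!: prob_space_PiM prob_space_complex_gaussian)
  ultimately show ?thesis
    unfolding code_space_def by (intro prob_space_pair)
qed

lemma measurable_message: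
  assumes "k \<in> {1..K}"
  shows "(\<lambda>W. W k) \<in> message_space K M \<rightarrow>\<^sub>M count_space {..<M k}"
proof -
  have "sets (uniform_count_measure {..<M k}) = sets (count_space {..<M k})"
    by (simp add: sets_uniform_count_measure)
  then have "measurable N (uniform_count_measure {..<M k}) = measurable N (count_space {..<M k})"
    for N :: "(nat \<Rightarrow> nat) measure"
    by (intro measurable_cong_sets refl)
  with measurable_component_singleton[OF assms, of "\<lambda>k. uniform_count_measure {..<M k}"]
  show ?thesis by (simp add: message_space_def)
qed

lemma measurable_transmitted:
  assumes "measurable_code K C" "k \<in> {1..K}" "t \<in> {1..blocklength C}" "a \<in> {1..K}"
  shows "(\<lambda>(W, H, Z). transmitted K C W H k t a) \<in> borel_measurable (code_space K C)"
proof -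
  let ?n = "blocklength C"
  have past: "past_local K k t \<in>
      channel_space K ?n \<rightarrow>\<^sub>M (\<Pi>\<^sub>M i\<in>past_index K t. borel)"
    unfolding past_local_def
  proof (rule measurable_restrict, clarify)
    fix u j b assume "(u, j, b) \<in> past_index K t"
    with assms have "(u, j, k, b) \<in> channel_index K ?n"
      by (auto simp: past_index_def channel_index_def)
    from measurable_component_singleton[OF this, of "\<lambda>_. complex_gaussian"]
    show "(\<lambda>H. H (u, j, k, b)) \<in> borel_measurable (channel_space K ?n)"
      by (simp add: channel_space_def cong: measurable_cong_sets)
  qed
  have W: "(\<lambda>\<omega>. fst \<omega> k) \<in> code_space K C \<rightarrow>\<^sub>M count_space {..<num_msgs C k}"
  proof -
    have "(\<lambda>W. W k) \<in> message_space K (num_msgs C) \<rightarrow>\<^sub>M count_space {..<num_msgs C k}"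
      by (rule measurable_message[OF assms(2)])
    then show ?thesis unfolding code_space_def by measurable
  qed
  have G: "(\<lambda>\<omega>. past_local K k t (fst (snd \<omega>))) \<in>
      code_space K C \<rightarrow>\<^sub>M (\<Pi>\<^sub>M i\<in>past_index K t. borel)"
    unfolding code_space_def using past by measurable
  have "(\<lambda>\<omega>. encode C k t (fst \<omega> k) (past_local K k t (fst (snd \<omega>))) a)
      \<in> borel_measurable (code_space K C)"
  proof (rule measurable_compose_countable'[OF _ W])
    fix w assume "w \<in> {..<num_msgs C k}"
    with assms have "(\<lambda>g. encode C k t w g a) \<in> borel_measurable (\<Pi>\<^sub>M i\<in>past_index K t. borel)"
      by (auto simp: measurable_code_def)
    from measurable_compose[OF G this]
    show "(\<lambda>\<omega>. encode C k t w (past_local K k t (fst (snd \<omega>))) a)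
      \<in> borel_measurable (code_space K C)" .
  qed auto
  then show ?thesis by (simp add: transmitted_def case_prod_beta')
qed

lemma sets_error_event:
  assumes C: "measurable_code K C" and k: "k \<in> {1..K}"
  shows "error_event K C k \<in> sets (code_space K C)"
proof -
  let ?n = "blocklength C" and ?S = "code_space K C"
  have H: "(\<lambda>\<omega>. fst (snd \<omega>) i) \<in> borel_measurable ?S" if "i \<in> channel_index K ?n" for i
  proof -
    have "(\<lambda>H. H i) \<in> borel_measurable (channel_space K ?n)"
      using measurable_component_singleton[OF that, of "\<lambda>_. complex_gaussian"]
      by (simp add: channel_space_def cong: measurable_cong_sets)
    then show ?thesis unfolding code_space_def by measurable
  qed
  have Z: "(\<lambda>\<omega>. snd (snd \<omega>) i) \<in> borel_measurable ?S" if "i \<in> {1..?n} \<times> {1..K}" for i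
  proof -
    have "(\<lambda>Z. Z i) \<in> borel_measurable (noise_space K ?n)"
      using measurable_component_singleton[OF that, of "\<lambda>_. complex_gaussian"]
      by (simp add: noise_space_def cong: measurable_cong_sets)
    then show ?thesis unfolding code_space_def by measurable
  qed
  have W: "(\<lambda>\<omega>. fst \<omega> k) \<in> ?S \<rightarrow>\<^sub>M count_space UNIV"
  proof -
    have "(\<lambda>W. W k) \<in> message_space K (num_msgs C) \<rightarrow>\<^sub>M count_space {..<num_msgs C k}"
      by (rule measurable_message[OF k])
    then have "(\<lambda>\<omega>. fst \<omega> k) \<in> ?S \<rightarrow>\<^sub>M count_space {..<num_msgs C k}"
      unfolding code_space_def by measurable
    then show ?thesis by (rule measurable_compose) simp
  qed
  have X: "(\<lambda>\<omega>. transmitted K C (fst \<omega>) (fst (snd \<omega>)) j t a) \<in> borel_measurable ?S"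
    if "j \<in> {1..K}" "t \<in> {1..?n}" "a \<in> {1..K}" for j t a
    using measurable_transmitted[OF C that] by (simp add: case_prod_beta')
  have "(\<lambda>\<omega>. received K C (fst \<omega>) (fst (snd \<omega>)) (snd (snd \<omega>)) k t) \<in> borel_measurable ?S"
    if "t \<in> {1..?n}" for t
    unfolding received_def using that k
    by (intro borel_measurable_add borel_measurable_sum borel_measurable_times X Z
        measurable_compose[OF H borel_measurable_continuous_onI[of cnj]] continuous_intros)
      (auto simp: channel_index_def)
  then have Y: "(\<lambda>\<omega>. \<lambda>t\<in>{1..?n}. received K C (fst \<omega>) (fst (snd \<omega>)) (snd (snd \<omega>)) k t)
      \<in> ?S \<rightarrow>\<^sub>M (\<Pi>\<^sub>M t\<in>{1..?n}. borel)"
    by (intro measurable_restrict)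
  have H': "(\<lambda>\<omega>. fst (snd \<omega>)) \<in> ?S \<rightarrow>\<^sub>M (\<Pi>\<^sub>M i\<in>channel_index K ?n. borel)"
  proof -
    have "sets (channel_space K ?n) = sets (\<Pi>\<^sub>M i\<in>channel_index K ?n. borel)"
      unfolding channel_space_def by (rule sets_PiM_cong) simp_all
    moreover have "(\<lambda>\<omega>. fst (snd \<omega>)) \<in> ?S \<rightarrow>\<^sub>M channel_space K ?n"
      unfolding code_space_def by measurable
    ultimately show ?thesis by (simp cong: measurable_cong_sets)
  qed
  have dec: "decode C k \<in> (\<Pi>\<^sub>M t\<in>{1..?n}. borel) \<Otimes>\<^sub>M (\<Pi>\<^sub>M i\<in>channel_index K ?n. borel)
      \<rightarrow>\<^sub>M count_space UNIV"
    using C k by (auto simp: measurable_code_def)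
  let ?D = "\<lambda>\<omega>. decode C k (\<lambda>t\<in>{1..?n}. received K C (fst \<omega>) (fst (snd \<omega>)) (snd (snd \<omega>)) k t, fst (snd \<omega>))"
  have D: "?D \<in> ?S \<rightarrow>\<^sub>M count_space UNIV"
    by (rule measurable_compose[OF measurable_Pair[OF Y H'] dec])
  have "error_event K C k = {\<omega> \<in> space ?S. ?D \<omega> \<noteq> fst \<omega> k}"
    by (auto simp: error_event_def)
  also have "\<dots> \<in> sets ?S"
  proof -
    have "(count_space UNIV :: nat measure) \<Otimes>\<^sub>M (count_space UNIV :: nat measure) = count_space UNIV"
      by (subst pair_measure_countable) auto
    with measurable_Pair[OF D W] have "(\<lambda>\<omega>. (?D \<omega>, fst \<omega> k)) \<in> ?S \<rightarrow>\<^sub>M count_space UNIV"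
      by simp
    from measurable_sets[OF this, of "{p. fst p \<noteq> snd p}"] show ?thesis
      by (simp add: vimage_def Int_def conj_commute)
  qed
  finally show ?thesis .
qed

end

theory Submission
  imports Defs "Jordan_Normal_Form.Determinant" "HOL-Real_Asymp.Real_Asymp"
begin

text \<open>
  Call a symbol of Tx \<open>i\<close> of order \<open>m\<close> if the \<open>m\<close> receivers of a set \<open>S\<close> containing \<open>i\<close> want it. The linear
  scheme first lets \<open>q\<close> transmitters send \<open>q\<close> fresh symbols each in a single slot. What Rx \<open>j\<close> hears of
  Tx \<open>i\<close> is interference for Rx \<open>j\<close> and a new equation for Rx \<open>i\<close>, hence a symbol of order 2. To deliver
  symbols of order \<open>m\<close>, Tx \<open>i\<close> alone sends \<open>K - m + 1\<close> of them in one slot; each receiver outside \<open>S\<close>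
  overhears an equation that all of \<open>S\<close> misses. For a set \<open>S'\<close> of size \<open>m + 1\<close>, Tx \<open>i\<close> can compute the \<open>m\<close>
  equations overheard by the \<open>j \<in> S' - {i}\<close> while serving \<open>S' - {j}\<close>. Its \<open>m - 1\<close> consecutive
  differences are symbols of order \<open>m + 1\<close>; they suffice for every \<open>j \<noteq> i\<close>, who knows one of the \<open>m\<close>
  equations, and a single slot in which all of \<open>S'\<close> sends one equation each gives every \<open>i \<in> S'\<close> the
  one that is missing. For \<open>m = K + 1\<close> nothing is left to deliver. Decodability is
  stated as: if all received values vanish, so do the wanted symbols. It needs only that certain
  minors of each transmitter's channel matrix are nonzero, which holds almost surely.

  For the rates, the source symbols are taken from a finite part of a square grid whose spacing does not
  depend on \<open>P\<close> and whose size grows like \<open>sqrt P\<close>. Outside an event of small fixed probability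
  the block can be decoded by zero forcing whatever was sent, so an outer code of large minimum distance
  over the alphabet of grid words (Gilbert--Varshamov) corrects the bad blocks at a relative rate loss
  that vanishes as \<open>P\<close> grows and the tolerated fraction of bad blocks shrinks.
\<close>

section \<open>Nonvanishing channel minors\<close>

unbundle no vec_syntax

text \<open>The square submatrices formed by the rows in \<open>J\<close> and the first \<open>card J\<close> columns are
  nonsingular.\<close>

definition generic_slot :: "nat \<Rightarrow> nat \<Rightarrow> channel \<Rightarrow> bool" where
  "generic_slot K t H \<longleftrightarrow> (\<forall>i\<in>{1..K}. \<forall>J. J \<subseteq> {1..K} \<longrightarrow> (\<forall>x :: nat \<Rightarrow> complex.
     (\<forall>j\<in>J. (\<Sum>a=1..card J. cnj (H (t, j, i, a)) * x a) = 0) \<longrightarrow> (\<forall>a\<in>{1..card J}. x a = 0)))"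

lemma emeasure_complex_gaussian_singleton: "emeasure complex_gaussian {z} = 0"
proof -
  have "{z} \<in> null_sets complex_gaussian"
    unfolding complex_gaussian_def
    by (subst null_sets_density_iff) (auto intro: AE_lborel_singleton)
  then show ?thesis by auto
qed

text \<open>A function that is affine in one Gaussian coordinate with a slope not depending on it
  vanishes, given the other coordinates, in at most one point.\<close>

lemma AE_affine_nonzero:
  fixes f g :: "('i \<Rightarrow> complex) \<Rightarrow> complex"
  assumes "finite I" "x \<in> I"
    and [measurable]: "f \<in> borel_measurable (\<Pi>\<^sub>M i\<in>I. complex_gaussian)"
      "g \<in> borel_measurable (\<Pi>\<^sub>M i\<in>I. complex_gaussian)"
    and f: "\<And>H y. f (H(x := y)) = f H + (cnj y - cnj (H x)) * g H"
    and g: "\<And>H y. g (H(x := y)) = g H"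
    and AE: "AE H in (\<Pi>\<^sub>M i\<in>I. complex_gaussian). g H \<noteq> 0"
  shows "AE H in (\<Pi>\<^sub>M i\<in>I. complex_gaussian). f H \<noteq> 0"
proof -
  let ?M = "\<Pi>\<^sub>M i\<in>I. complex_gaussian"
  interpret G: prob_space complex_gaussian by (rule prob_space_complex_gaussian)
  interpret product_sigma_finite "\<lambda>_::'i. complex_gaussian" ..
  define h where "h = (\<lambda>H. indicator {H \<in> space ?M. f H = 0 \<and> g H \<noteq> 0} H :: ennreal)"
  have [measurable]: "h \<in> borel_measurable ?M" unfolding h_def by measurable
  have I: "I = insert x (I - {x})" using assms(2) by auto
  have "(\<integral>\<^sup>+H. h H \<partial>?M) = (\<integral>\<^sup>+H. (\<integral>\<^sup>+y. h (H(x := y)) \<partial>complex_gaussian) \<partial>(\<Pi>\<^sub>M i\<in>I - {x}. complex_gaussian))"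
    using product_nn_integral_insert[of "I - {x}" x h] assms(1) I by (simp add: insert_absorb)
  also have "\<dots> = (\<integral>\<^sup>+H. 0 \<partial>(\<Pi>\<^sub>M i\<in>I - {x}. complex_gaussian))"
  proof (intro nn_integral_cong)
    fix H :: "'i \<Rightarrow> complex"
    \<comment> \<open>Solving the affine equation for the coordinate gives at most this one zero.
      Where \<open>g H = 0\<close> the quotient is meaningless, but there \<open>h\<close> vanishes
      because updating the coordinate leaves \<open>g\<close> unchanged.\<close>
    define z where "z = cnj (cnj (H x) - f H / g H)"
    have "h (H(x := y)) \<le> indicator {z} y" for y
    proof -
      have "y = z" if "f (H(x := y)) = 0" "g (H(x := y)) \<noteq> 0"
      proof -
        have g0: "g H \<noteq> 0" and "(cnj y - cnj (H x)) * g H = - f H"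
          using that f[of H y] g[of H y] by (auto simp: eq_neg_iff_add_eq_0 add.commute)
        then have "cnj y - cnj (H x) = - f H / g H" by (metis nonzero_mult_div_cancel_right)
        then have "cnj y = cnj z" by (simp add: z_def algebra_simps)
        then show ?thesis by simp
      qed
      then show ?thesis by (auto simp: h_def indicator_def)
    qed
    then have "(\<integral>\<^sup>+y. h (H(x := y)) \<partial>complex_gaussian) \<le> (\<integral>\<^sup>+y. indicator {z} y \<partial>complex_gaussian)"
      by (intro nn_integral_mono)
    also have "\<dots> = 0" by (simp add: emeasure_complex_gaussian_singleton)
    finally show "(\<integral>\<^sup>+y. h (H(x := y)) \<partial>complex_gaussian) = 0" by simp
  qed
  finally have "AE H in ?M. h H = 0" by (simp add: nn_integral_0_iff_AE)
  with AE AE_space show ?thesis by eventually_elim (auto simp: h_def indicator_def split: if_splits)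
qed

text \<open>Listing the rows makes the minors of a fixed list nested: passing from \<open>n\<close>
  to \<open>Suc n\<close> appends the row \<open>js ! n\<close> and the column of antenna
  \<open>Suc n\<close>. Antennas count from 1 and matrix columns from 0.\<close>

definition minor_mat :: "nat \<Rightarrow> nat \<Rightarrow> nat list \<Rightarrow> nat \<Rightarrow> channel \<Rightarrow> complex mat" where
  "minor_mat t i js n H = mat n n (\<lambda>(r, c). cnj (H (t, js ! r, i, Suc c)))"

lemma minor_mat_carrier [simp]: "minor_mat t i js n H \<in> carrier_mat n n"
  by (simp add: minor_mat_def)

lemma borel_measurable_det_minor_mat:
  assumes "t \<in> {1..T}" "i \<in> {1..K}" "set js \<subseteq> {1..K}" "n \<le> length js" "n \<le> K"
  shows "(\<lambda>H. det (minor_mat t i js n H)) \<in> borel_measurable (\<Pi>\<^sub>M i\<in>channel_index K T. complex_gaussian)"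
proof -
  have "(\<lambda>H. cnj (H (t, js ! r, i, Suc c))) \<in> borel_measurable (\<Pi>\<^sub>M i\<in>channel_index K T. complex_gaussian)"
    if "r < n" "c < n" for r c
  proof -
    have "js ! r \<in> set js" using that assms by (intro nth_mem) auto
    then have "js ! r \<in> {1..K}" using assms by auto
    then have "(t, js ! r, i, Suc c) \<in> channel_index K T" using that assms by (auto simp: channel_index_def)
    from measurable_component_singleton[OF this, of "\<lambda>_. complex_gaussian"]
    have "(\<lambda>H. H (t, js ! r, i, Suc c)) \<in> borel_measurable (\<Pi>\<^sub>M i\<in>channel_index K T. complex_gaussian)"
      by (simp cong: measurable_cong_sets)
    then show ?thesis by (rule measurable_compose) (intro borel_measurable_continuous_onI continuous_intros)
  qed
  then show ?thesis
    unfolding det_def minor_mat_def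
    by (auto intro!: borel_measurable_sum borel_measurable_times borel_measurable_prod intro: permutes_nat_less)
qed

text \<open>Laplace expansion along the last column. Because \<open>js\<close> has no repetitions,
  the updated coefficient occurs only in the lower right corner, whose cofactor is the preceding
  minor. Channels enter conjugated, so the dependence is affine in \<open>cnj y\<close>.\<close>

lemma minor_mat_update_cnj:
  assumes "distinct js" "n < length js"
  shows "det (minor_mat t i js (Suc n) (H((t, js ! n, i, Suc n) := y))) =
    det (minor_mat t i js (Suc n) H) + (cnj y - cnj (H (t, js ! n, i, Suc n))) * det (minor_mat t i js n H)"
proof -
  let ?x = "(t, js ! n, i, Suc n)"
  let ?A = "\<lambda>H. minor_mat t i js (Suc n) H"
  have cof: "cofactor (?A (H(?x := y))) r n = cofactor (?A H) r n" if "r < Suc n" for r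
    unfolding cofactor_def minor_mat_def using that
    by (auto intro!: arg_cong[of _ _ det] eq_matI simp: mat_delete_def)
  have last: "cofactor (?A H) n n = det (minor_mat t i js n H)"
    unfolding cofactor_def minor_mat_def
    by (auto intro!: arg_cong[of _ _ det] eq_matI simp: mat_delete_def)
  have ent: "?A (H(?x := y)) $$ (r, n) = ?A H $$ (r, n)" if "r < n" for r
    using that assms by (auto simp: minor_mat_def nth_eq_iff_index_eq)
  have exp: "det (?A H) = (\<Sum>r<n. ?A H $$ (r, n) * cofactor (?A H) r n) + ?A H $$ (n, n) * cofactor (?A H) n n" for H
    by (subst laplace_expansion_column[of _ "Suc n" n]) simp_all
  have "(\<Sum>r<n. ?A (H(?x := y)) $$ (r, n) * cofactor (?A (H(?x := y))) r n) = (\<Sum>r<n. ?A H $$ (r, n) * cofactor (?A H) r n)"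
    by (intro sum.cong) (auto simp: cof ent)
  then show ?thesis
    unfolding exp[of "H(?x := y)"] exp[of H] by (simp add: cof last) (simp add: minor_mat_def algebra_simps)
qed

lemma minor_mat_update_other:
  "det (minor_mat t i js n (H((t, j, i, Suc n) := y))) = det (minor_mat t i js n H)"
  by (auto intro!: arg_cong[of _ _ det] eq_matI simp: minor_mat_def)

text \<open>Induction along the nested minors: given all other coefficients, the minor of size
  \<open>Suc n\<close> is affine in its corner entry, with the minor of size \<open>n\<close> as
  slope. The empty minor is 1.\<close>

lemma AE_det_minor_mat:
  assumes "t \<in> {1..T}" "i \<in> {1..K}" "set js \<subseteq> {1..K}" "distinct js" "n \<le> length js"
  shows "AE H in channel_space K T. det (minor_mat t i js n H) \<noteq> 0"
  using assms(5)
proof (induction n)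
  case 0
  then show ?case by (simp add: minor_mat_def)
next
  case (Suc n)
  have "length js \<le> K" using card_mono[OF _ assms(3)] distinct_card[OF assms(4)] by simp
  moreover have "js ! n \<in> {1..K}" using Suc.prems subsetD[OF assms(3) nth_mem[of n js]] by simp
  ultimately have x: "(t, js ! n, i, Suc n) \<in> channel_index K T" and n: "Suc n \<le> K"
    using assms Suc.prems by (auto simp: channel_index_def)
  have IH: "AE H in \<Pi>\<^sub>M i\<in>channel_index K T. complex_gaussian. det (minor_mat t i js n H) \<noteq> 0"
    using Suc.IH Suc.prems unfolding channel_space_def by auto
  show ?case
    unfolding channel_space_def
  proof (rule AE_affine_nonzero[OF _ x _ _ _ minor_mat_update_other IH])
    show "finite (channel_index K T)" by (simp add: channel_index_def)
    show "det (minor_mat t i js (Suc n) (H((t, js ! n, i, Suc n) := y))) = det (minor_mat t i js (Suc n) H) +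
      (cnj y - cnj (H (t, js ! n, i, Suc n))) * det (minor_mat t i js n H)" for H y
      using assms Suc.prems by (intro minor_mat_update_cnj) auto
  qed (use assms Suc.prems n in \<open>auto intro!: borel_measurable_det_minor_mat\<close>)
qed

text \<open>Finitely many slots, transmitters and receiver sets give a finite intersection of almost
  sure events, and a matrix with nonzero determinant has trivial kernel.\<close>

lemma AE_generic_slot: "AE H in channel_space K T. \<forall>t\<in>{1..T}. generic_slot K t H"
proof -
  have "AE H in channel_space K T. \<forall>t\<in>{1..T}. \<forall>i\<in>{1..K}. \<forall>J\<in>Pow {1..K}.
      det (minor_mat t i (sorted_list_of_set J) (card J) H) \<noteq> 0"
  proof (intro AE_finite_allI AE_det_minor_mat)
    fix J :: "nat set" assume "J \<in> Pow {1..K}"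
    then show "set (sorted_list_of_set J) \<subseteq> {1..K}" using finite_subset[of J] by auto
  qed auto
  then show ?thesis
  proof eventually_elim
    case (elim H)
    show ?case unfolding generic_slot_def
    proof (intro ballI allI impI)
      fix t i J a and x :: "nat \<Rightarrow> complex"
      assume t: "t \<in> {1..T}" "i \<in> {1..K}" and J: "J \<subseteq> {1..K}" and a: "a \<in> {1..card J}"
        and x: "\<forall>j\<in>J. (\<Sum>a=1..card J. cnj (H (t, j, i, a)) * x a) = 0"
      let ?js = "sorted_list_of_set J" and ?n = "card J"
      have fin: "finite J" using J finite_subset by auto
      define v where "v = vec ?n (\<lambda>c. x (Suc c))"
      have v: "v \<in> carrier_vec ?n" by (simp add: v_def)
      have "minor_mat t i ?js ?n H *\<^sub>v v = 0\<^sub>v ?n"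
      proof (rule eq_vecI)
        fix r assume r: "r < dim_vec (0\<^sub>v ?n :: complex vec)"
        then have "?js ! r \<in> J" using fin by (metis index_zero_vec(2) length_sorted_list_of_set nth_mem set_sorted_list_of_set)
        with x have "(\<Sum>a=1..?n. cnj (H (t, ?js ! r, i, a)) * x a) = 0" by auto
        also have "(\<Sum>a=1..?n. cnj (H (t, ?js ! r, i, a)) * x a) = (\<Sum>c=0..<?n. cnj (H (t, ?js ! r, i, Suc c)) * x (Suc c))"
          by (rule sum.reindex_bij_witness[of _ Suc "\<lambda>c. c - 1"]) auto
        finally show "(minor_mat t i ?js ?n H *\<^sub>v v) $ r = 0\<^sub>v ?n $ r"
          using r by (simp add: minor_mat_def v_def scalar_prod_def)
      qed (simp add: minor_mat_def)
      moreover have "det (minor_mat t i ?js ?n H) \<noteq> 0" using elim t J by auto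
      ultimately have "v = 0\<^sub>v ?n"
        using det_0_iff_vec_prod_zero_field[of "minor_mat t i ?js ?n H" ?n] v by auto
      then have "v $ (a - 1) = 0" using a by auto
      moreover have "a - 1 < ?n" "Suc (a - 1) = a" using a by auto
      ultimately show "x a = 0" by (simp add: v_def)
    qed
  qed
qed

section \<open>The linear alignment scheme\<close>

text \<open>A symbol is given by its coefficients in the source symbols of its transmitter.\<close>

type_synonym symbol = "channel \<Rightarrow> nat \<Rightarrow> complex"

section \<open>Symbols computable from delayed local channel knowledge\<close>

definition delayed_local :: "nat \<Rightarrow> nat \<Rightarrow> nat \<Rightarrow> (channel \<Rightarrow> complex) \<Rightarrow> bool" where
  "delayed_local K i t f \<longleftrightarrow>
     (\<exists>F\<in>borel_measurable (\<Pi>\<^sub>M x\<in>past_index K t. borel). \<forall>H. f H = F (past_local K i t H))"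

lemma delayed_local_const: "delayed_local K i t (\<lambda>H. c)"
  unfolding delayed_local_def by (intro bexI[of _ "\<lambda>_. c"]) auto

lemma delayed_local_add:
  assumes "delayed_local K i t f" "delayed_local K i t g"
  shows "delayed_local K i t (\<lambda>H. f H + g H)"
proof -
  from assms obtain F G where "F \<in> borel_measurable (\<Pi>\<^sub>M x\<in>past_index K t. borel)"
    "G \<in> borel_measurable (\<Pi>\<^sub>M x\<in>past_index K t. borel)"
    "\<And>H. f H = F (past_local K i t H)" "\<And>H. g H = G (past_local K i t H)"
    unfolding delayed_local_def by blast
  then show ?thesis unfolding delayed_local_def by (intro bexI[of _ "\<lambda>x. F x + G x"]) auto
qed

lemma delayed_local_mult:
  assumes "delayed_local K i t f" "delayed_local K i t g"
  shows "delayed_local K i t (\<lambda>H. f H * g H)"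
proof -
  from assms obtain F G where "F \<in> borel_measurable (\<Pi>\<^sub>M x\<in>past_index K t. borel)"
    "G \<in> borel_measurable (\<Pi>\<^sub>M x\<in>past_index K t. borel)"
    "\<And>H. f H = F (past_local K i t H)" "\<And>H. g H = G (past_local K i t H)"
    unfolding delayed_local_def by blast
  then show ?thesis unfolding delayed_local_def by (intro bexI[of _ "\<lambda>x. F x * G x"]) auto
qed

lemma delayed_local_diff:
  assumes "delayed_local K i t f" "delayed_local K i t g"
  shows "delayed_local K i t (\<lambda>H. f H - g H)"
  using delayed_local_add[OF assms(1) delayed_local_mult[OF delayed_local_const[of _ _ _ "-1"] assms(2)]] by simp

lemma delayed_local_sum:
  assumes "\<And>a. a \<in> A \<Longrightarrow> delayed_local K i t (f a)"
  shows "delayed_local K i t (\<lambda>H. \<Sum>a\<in>A. f a H)"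
  using assms by (induction A rule: infinite_finite_induct) (auto intro: delayed_local_const delayed_local_add)

lemma delayed_local_cnj_channel:
  assumes "u \<in> {1..<t}" "j \<in> {1..K}" "a \<in> {1..K}"
  shows "delayed_local K i t (\<lambda>H. cnj (H (u, j, i, a)))"
proof -
  have "(u, j, a) \<in> past_index K t" using assms by (auto simp: past_index_def)
  then have "(\<lambda>g. g (u, j, a)) \<in> borel_measurable (\<Pi>\<^sub>M x\<in>past_index K t. borel :: complex measure)"
    by (rule measurable_component_singleton)
  then have "(\<lambda>g. cnj (g (u, j, a))) \<in> borel_measurable (\<Pi>\<^sub>M x\<in>past_index K t. borel :: complex measure)"
    by (rule measurable_compose) (intro borel_measurable_continuous_onI continuous_intros)
  then show ?thesis unfolding delayed_local_def
    by (intro bexI) (use \<open>(u, j, a) \<in> past_index K t\<close> in \<open>auto simp: past_local_def\<close>)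
qed

lemma delayed_local_mono:
  assumes "delayed_local K i t f" "t \<le> t'"
  shows "delayed_local K i t' f"
proof -
  from assms obtain F where F: "F \<in> borel_measurable (\<Pi>\<^sub>M x\<in>past_index K t. borel)"
    "\<And>H. f H = F (past_local K i t H)"
    unfolding delayed_local_def by blast
  have sub: "past_index K t \<subseteq> past_index K t'" using assms(2) by (auto simp: past_index_def)
  then have "past_local K i t H = restrict (past_local K i t' H) (past_index K t)" for H
    by (auto simp: past_local_def fun_eq_iff restrict_def)
  then show ?thesis unfolding delayed_local_def
    by (intro bexI[of _ "\<lambda>g. F (restrict g (past_index K t))"])
      (use F in \<open>auto intro!: measurable_compose[OF measurable_restrict_subset[OF sub]]\<close>)
qed

text \<open>Causality is required of every coefficient separately, since the source symbols depend
  on the message alone.\<close>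

definition causal :: "nat \<Rightarrow> nat \<Rightarrow> nat \<Rightarrow> symbol \<Rightarrow> bool" where
  "causal K i t \<sigma> \<longleftrightarrow> (\<forall>s. delayed_local K i t (\<lambda>H. \<sigma> H s))"

definition symbol_value :: "nat \<Rightarrow> symbol \<Rightarrow> channel \<Rightarrow> (nat \<Rightarrow> complex) \<Rightarrow> complex" where
  "symbol_value N \<sigma> H u = (\<Sum>s<N. \<sigma> H s * u s)"

definition noiseless :: "nat \<Rightarrow> nat \<Rightarrow> (nat \<Rightarrow> nat \<Rightarrow> nat \<Rightarrow> symbol) \<Rightarrow> channel \<Rightarrow>
    (nat \<Rightarrow> nat \<Rightarrow> complex) \<Rightarrow> nat \<Rightarrow> nat \<Rightarrow> complex" where
  "noiseless K N X H u k t =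
     (\<Sum>j=1..K. \<Sum>a=1..K. cnj (H (t, k, j, a)) * symbol_value N (X t j a) H (u j))"

text \<open>The contribution of Tx \<open>i\<close> to what Rx \<open>k\<close> hears, as a linear
  form in the source symbols of Tx \<open>i\<close>. It is itself a symbol, which Tx
  \<open>i\<close> can form from the next slot on and send again.\<close>

definition overheard :: "nat \<Rightarrow> nat \<Rightarrow> nat \<Rightarrow> nat \<Rightarrow> (nat \<Rightarrow> symbol) \<Rightarrow> symbol" where
  "overheard t k i n \<sigma> = (\<lambda>H s. \<Sum>a=1..n. cnj (H (t, k, i, a)) * \<sigma> a H s)"

lemma symbol_value_overheard:
  "symbol_value N (overheard t k i n \<sigma>) H u = (\<Sum>a=1..n. cnj (H (t, k, i, a)) * symbol_value N (\<sigma> a) H u)"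
  unfolding symbol_value_def overheard_def
  by (simp add: sum_distrib_left sum_distrib_right mult.assoc) (rule sum.swap)

lemma symbol_value_diff:
  "symbol_value N (\<lambda>H s. \<sigma> H s - \<sigma>' H s) H u = symbol_value N \<sigma> H u - symbol_value N \<sigma>' H u"
  by (simp add: symbol_value_def sum_subtractf left_diff_distrib)

lemma causal_zero: "causal K i t (\<lambda>H s. 0)"
  by (simp add: causal_def delayed_local_const)

lemma causal_mono: "causal K i t \<sigma> \<Longrightarrow> t \<le> t' \<Longrightarrow> causal K i t' \<sigma>"
  unfolding causal_def using delayed_local_mono by blast

lemma causal_diff: "causal K i t \<sigma> \<Longrightarrow> causal K i t \<sigma>' \<Longrightarrow> causal K i t (\<lambda>H s. \<sigma> H s - \<sigma>' H s)"
  by (simp add: causal_def delayed_local_diff)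

lemma causal_overheard:
  assumes "u \<in> {1..<t}" "k \<in> {1..K}" "n \<le> K" "\<And>a. a \<in> {1..n} \<Longrightarrow> causal K i t (\<sigma> a)"
  shows "causal K i t (overheard u k i n \<sigma>)"
  unfolding causal_def overheard_def
proof
  fix s
  show "delayed_local K i t (\<lambda>H. \<Sum>a = 1..n. cnj (H (u, k, i, a)) * \<sigma> a H s)"
    using assms by (intro delayed_local_sum delayed_local_mult delayed_local_cnj_channel) (auto simp: causal_def)
qed

text \<open>Covers all slot types of the scheme: the transmitters in \<open>A\<close> use their
  first \<open>n\<close> antennas and all others are silent.\<close>

lemma noiseless_active:
  assumes "A \<subseteq> {1..K}" "n \<le> K"
    and "\<And>j a. j \<in> {1..K} \<Longrightarrow> a \<in> {1..K} \<Longrightarrow> X t j a = (if j \<in> A \<and> a \<le> n then \<sigma> j a else (\<lambda>H s. 0))"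
  shows "noiseless K N X H u k t = (\<Sum>j\<in>A. symbol_value N (overheard t k j n (\<sigma> j)) H (u j))"
proof -
  have "(\<Sum>a=1..K. cnj (H (t, k, j, a)) * symbol_value N (X t j a) H (u j)) =
      (if j \<in> A then symbol_value N (overheard t k j n (\<sigma> j)) H (u j) else 0)" if "j \<in> {1..K}" for j
  proof (cases "j \<in> A")
    case True
    have "(\<Sum>a=1..K. cnj (H (t, k, j, a)) * symbol_value N (X t j a) H (u j)) =
       (\<Sum>a=1..n. cnj (H (t, k, j, a)) * symbol_value N (X t j a) H (u j))"
      using assms(2,3) that True by (intro sum.mono_neutral_right) (auto simp: symbol_value_def)
    also have "\<dots> = symbol_value N (overheard t k j n (\<sigma> j)) H (u j)"
      unfolding symbol_value_overheard using assms(2,3) that True by (intro sum.cong) auto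
    finally show ?thesis using True by simp
  next
    case False
    then show ?thesis using assms(3) that by (auto simp: symbol_value_def intro!: sum.neutral)
  qed
  then have "noiseless K N X H u k t = (\<Sum>j=1..K. if j \<in> A then symbol_value N (overheard t k j n (\<sigma> j)) H (u j) else 0)"
    unfolding noiseless_def by (intro sum.cong) auto
  also have "\<dots> = (\<Sum>j\<in>{1..K} \<inter> A. symbol_value N (overheard t k j n (\<sigma> j)) H (u j))"
    by (subst sum.inter_restrict) auto
  also have "{1..K} \<inter> A = A" using assms(1) by auto
  finally show ?thesis .
qed

text \<open>How genericity is used: the equations heard by \<open>n\<close> distinct receivers
  determine the \<open>n\<close> symbols sent on the first \<open>n\<close> antennas.\<close>

lemma generic_slotD:
  assumes "generic_slot K t H" "i \<in> {1..K}" "J \<subseteq> {1..K}" "card J = n"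
    and "\<And>j. j \<in> J \<Longrightarrow> symbol_value N (overheard t j i n \<sigma>) H u = 0" "a \<in> {1..n}"
  shows "symbol_value N (\<sigma> a) H u = 0"
  using assms(1)[unfolded generic_slot_def, rule_format, OF assms(2,3), of "\<lambda>a. symbol_value N (\<sigma> a) H u"] assms(4-)
  by (auto simp: symbol_value_overheard)

section \<open>Recursive delivery of symbols of order at least two\<close>

lemma ex_slot_assignment:
  assumes "finite E"
  obtains \<theta> :: "'a \<Rightarrow> nat" where "bij_betw \<theta> E {t..<t + card E}"
proof -
  from ex_bij_betw_finite_nat[OF assms] obtain h where "bij_betw h E {0..<card E}" by blast
  moreover have "bij_betw (\<lambda>x. x + t) {0..<card E} {t..<t + card E}"
    by (rule bij_betw_byWitness[of _ "\<lambda>x. x - t"]) auto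
  ultimately show ?thesis using that bij_betw_trans by blast
qed

text \<open>Decoding is linear, so success is stated as a trivial kernel. Here \<open>m\<close> is
  the order, \<open>n\<close> the number of symbols for each pair of a set \<open>S\<close> and a
  member \<open>i\<close>, and \<open>t0\<close> the first of the \<open>T\<close> slots; the
  starting time is kept free so that phases can be concatenated.\<close>

definition delivers :: "nat \<Rightarrow> nat \<Rightarrow> nat \<Rightarrow> nat \<Rightarrow> nat \<Rightarrow> (nat \<Rightarrow> nat set \<Rightarrow> nat \<Rightarrow> symbol) \<Rightarrow>
    nat \<Rightarrow> (nat \<Rightarrow> nat \<Rightarrow> nat \<Rightarrow> symbol) \<Rightarrow> bool" where
  "delivers K N m n t0 U T X \<longleftrightarrow>
     (\<forall>t\<in>{t0..<t0 + T}. \<forall>i\<in>{1..K}. \<forall>a. causal K i t (X t i a)) \<and>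
     (\<forall>H u. \<forall>k\<in>{1..K}.
        (\<forall>t\<in>{t0..<t0 + T}. generic_slot K t H \<and> noiseless K N X H u k t = 0) \<longrightarrow>
        (\<forall>S i c. S \<subseteq> {1..K} \<longrightarrow> card S = m \<longrightarrow> k \<in> S \<longrightarrow> i \<in> S \<longrightarrow> c < n \<longrightarrow>
           symbol_value N (U i S c) H (u i) = 0))"

text \<open>The number of slots spent per copy of every pair of an order-\<open>K + 1 - d\<close> set and one of
  its members.\<close>

fun delivery_time :: "nat \<Rightarrow> nat \<Rightarrow> real" where
  "delivery_time K 0 = 0"
| "delivery_time K (Suc d) =
     (real ((K - d) * (K choose (K - d))) + real (K choose Suc (K - d))
       + real (K - d - 1) * delivery_time K d) / real (Suc d)"

text \<open>Induction on \<open>d\<close>, where \<open>K + 1 - d\<close> is the order; at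
  \<open>d = 0\<close> no set is large enough. The factorial keeps all counts integral: in the step,
  symbols of order \<open>m\<close> come in groups of \<open>q = K - m + 1 = Suc d\<close>, and the
  factor \<open>fact d\<close> that remains after grouping serves the induction hypothesis.\<close>

lemma ex_delivers:
  assumes "d < K" "1 \<le> t0"
    and "\<And>i S c. S \<subseteq> {1..K} \<Longrightarrow> card S = K + 1 - d \<Longrightarrow> i \<in> S \<Longrightarrow> c < n * fact d \<Longrightarrow> causal K i t0 (U i S c)"
  shows "\<exists>T X. real T = real (n * fact d) * delivery_time K d \<and>
    delivers K N (K + 1 - d) (n * fact d) t0 U T X"
  using assms
proof (induction d arbitrary: n t0 U)
  case 0
  have "delivers K N (K + 1) n t0 U 0 (\<lambda>_ _ _ _ _. 0)"
  proof -
    have "card S \<noteq> K + 1" if "S \<subseteq> {1..K}" for S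
      using card_mono[OF _ that] by simp
    then show ?thesis unfolding delivers_def by auto
  qed
  then show ?case by (intro exI[of _ 0]) auto
next
  case (Suc d)
  define m where "m = K - d"
  define q where "q = Suc d"
  define N' where "N' = n * fact d"
  have m: "2 \<le> m" "K + 1 - Suc d = m" "K + 1 - d = Suc m" "q \<le> K" "1 \<le> q" "q = K - m + 1" "m \<le> K"
    using Suc.prems(1) by (auto simp: m_def q_def)
  have nN: "n * fact (Suc d) = N' * q" by (simp add: N'_def q_def algebra_simps)
  have U: "causal K i t0 (U i S c)" if "S \<subseteq> {1..K}" "card S = m" "i \<in> S" "c < N' * q" for i S c
    using Suc.prems(3) that m nN by simp
  \<comment> \<open>\<open>E1\<close> indexes the slots in which a single \<open>i\<close> serves
    \<open>S\<close>, \<open>E2\<close> the slots in which a whole set of size \<open>Suc m\<close>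
    transmits. The index \<open>c\<close> runs over the \<open>N'\<close> groups of \<open>q\<close>
    symbols.\<close>
  define E1 where "E1 = (SIGMA S:{S. S \<subseteq> {1..K} \<and> card S = m}. S \<times> {..<N'})"
  define E2 where "E2 = {S. S \<subseteq> {1..K} \<and> card S = Suc m} \<times> {..<N'}"
  have fin: "finite E1" "finite E2"
  proof -
    have *: "finite {S. S \<subseteq> {1..K} \<and> P S}" for P :: "nat set \<Rightarrow> bool"
      by (rule finite_subset[of _ "Pow {1..K}"]) auto
    show "finite E1" "finite E2"
      unfolding E1_def E2_def
      by (intro finite_SigmaI finite_cartesian_product finite_lessThan *; auto intro: finite_subset)+
  qed
  have card1: "card E1 = (K choose m) * (m * N')"
  proof -
    have "card E1 = (\<Sum>S\<in>{S. S \<subseteq> {1..K} \<and> card S = m}. card (S \<times> {..<N'}))"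
      unfolding E1_def by (rule card_SigmaI) (auto intro: finite_subset simp: finite_subset[of _ "Pow {1..K}"])
    also have "\<dots> = (\<Sum>S\<in>{S. S \<subseteq> {1..K} \<and> card S = m}. m * N')"
      by (intro sum.cong) (auto simp: card_cartesian_product)
    finally show ?thesis by (simp add: n_subsets)
  qed
  have card2: "card E2 = (K choose Suc m) * N'"
    unfolding E2_def by (simp add: card_cartesian_product n_subsets)
  obtain \<theta>1 where \<theta>1: "bij_betw \<theta>1 E1 {t0..<t0 + card E1}" using ex_slot_assignment[OF fin(1)] .
  define t1 where "t1 = t0 + card E1"
  obtain \<theta>2 where \<theta>2: "bij_betw \<theta>2 E2 {t1..<t1 + card E2}" using ex_slot_assignment[OF fin(2)] .
  define t2 where "t2 = t1 + card E2"
  define e1 where "e1 = inv_into E1 \<theta>1"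
  define e2 where "e2 = inv_into E2 \<theta>2"
  have e1: "e1 (\<theta>1 e) = e" "\<theta>1 e \<in> {t0..<t1}" if "e \<in> E1" for e
    using bij_betw_inv_into_left[OF \<theta>1 that] bij_betwE[OF \<theta>1] that by (auto simp: e1_def t1_def)
  have e2: "e2 (\<theta>2 e) = e" "\<theta>2 e \<in> {t1..<t2}" if "e \<in> E2" for e
    using bij_betw_inv_into_left[OF \<theta>2 that] bij_betwE[OF \<theta>2] that by (auto simp: e2_def t2_def)
  have e1': "e1 t \<in> E1" if "t \<in> {t0..<t1}" for t
    using bij_betwE[OF bij_betw_inv_into[OF \<theta>1]] that by (auto simp: e1_def t1_def)
  have e2': "e2 t \<in> E2" if "t \<in> {t1..<t2}" for t
    using bij_betwE[OF bij_betw_inv_into[OF \<theta>2]] that by (auto simp: e2_def t2_def)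
  \<comment> \<open>\<open>V i S c a\<close> is sent on antenna \<open>a\<close> in slot \<open>\<theta>1 (S, i, c)\<close>; \<open>W i j S\<close> is what \<open>j\<close>
    overhears of Tx \<open>i\<close> in the slots that serve \<open>S - {j}\<close>.\<close>
  define V where "V = (\<lambda>i S c a. U i S (c * q + (a - 1)))"
  define W where "W = (\<lambda>i j S c. overheard (\<theta>1 (S - {j}, i, c)) j i q (V i (S - {j}) c))"
  \<comment> \<open>An index \<open>c\<close> of the next order splits into the group
    \<open>c div (m - 1)\<close> and the position \<open>c mod (m - 1)\<close> of a difference
    between neighbours in the sorted list of overhearing receivers.\<close>
  define U' where "U' = (\<lambda>i S c. let l = sorted_list_of_set (S - {i}); r = c mod (m - 1) in
    (\<lambda>H s. W i (l ! Suc r) S (c div (m - 1)) H s - W i (l ! r) S (c div (m - 1)) H s))"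
  have V: "causal K i t0 (V i S c a)" if "(S, i, c) \<in> E1" "a \<le> q" for S i c a
  proof -
    have "c * q + (a - 1) < Suc c * q" using that(2) m(5) by auto
    also have "\<dots> \<le> N' * q" using that(1) by (intro mult_right_mono) (auto simp: E1_def)
    finally show ?thesis unfolding V_def using that(1) by (intro U) (auto simp: E1_def)
  qed
  have E1I: "(S - {j}, i, c) \<in> E1" if "(S, c) \<in> E2" "i \<in> S" "j \<in> S" "i \<noteq> j" for S i j c
    using that by (auto simp: E1_def E2_def card_Diff_singleton)
  have W: "causal K i t1 (W i j S c)" if "(S, c) \<in> E2" "i \<in> S" "j \<in> S" "i \<noteq> j" for S i j c
    unfolding W_def
  proof (rule causal_overheard)
    show "\<theta>1 (S - {j}, i, c) \<in> {1..<t1}" using e1(2)[OF E1I[OF that]] Suc.prems(2) by auto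
    show "j \<in> {1..K}" using that by (auto simp: E2_def)
    show "causal K i t1 (V i (S - {j}) c a)" if "a \<in> {1..q}" for a
      using causal_mono[OF V[OF E1I[OF \<open>(S, c) \<in> E2\<close> \<open>i \<in> S\<close> \<open>j \<in> S\<close> \<open>i \<noteq> j\<close>]]] that by (simp add: t1_def)
  qed (use m in simp)
  have list: "set (sorted_list_of_set (S - {i})) = S - {i}" "length (sorted_list_of_set (S - {i})) = m"
    if "(S, c) \<in> E2" "i \<in> S" for S c i
  proof -
    have "finite S" using that by (auto simp: E2_def intro: finite_subset)
    then show "set (sorted_list_of_set (S - {i})) = S - {i}" "length (sorted_list_of_set (S - {i})) = m"
      using that by (auto simp: E2_def card_Diff_singleton)
  qed
  have nth: "sorted_list_of_set (S - {i}) ! r \<in> S - {i}" if "(S, c) \<in> E2" "i \<in> S" "r < m" for S c i r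
    using list[OF that(1,2)] that(3) nth_mem by metis
  have U': "causal K i t2 (U' i S c)"
    if S: "S \<subseteq> {1..K}" "card S = Suc m" "i \<in> S" "c < (m - 1) * n * fact d" for S i c
  proof -
    have "c div (m - 1) < N'" using S(4) m(1) by (simp add: less_mult_imp_div_less N'_def mult_ac)
    then have E: "(S, c div (m - 1)) \<in> E2" using S by (simp add: E2_def)
    have r: "c mod (m - 1) < m" "Suc (c mod (m - 1)) < m"
      using m(1) mod_less_divisor[of "m - 1" c] by linarith+
    show ?thesis unfolding U'_def Let_def
      by (intro causal_diff causal_mono[OF W[OF E]])
        (use S nth[OF E S(3) r(1)] nth[OF E S(3) r(2)] in \<open>auto simp: t2_def\<close>)
  qed
  have "\<exists>T X. real T = real ((m - 1) * n * fact d) * delivery_time K d \<and>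
      delivers K N (K + 1 - d) ((m - 1) * n * fact d) t2 U' T X"
    using Suc.prems U' m by (intro Suc.IH) (auto simp: t2_def t1_def)
  then obtain T' X' where T': "real T' = real ((m - 1) * n * fact d) * delivery_time K d"
    and X': "delivers K N (Suc m) ((m - 1) * n * fact d) t2 U' T' X'" using m by auto
  \<comment> \<open>First the slots of \<open>E1\<close>, then those of \<open>E2\<close>, then the
    scheme of the induction hypothesis from \<open>t2\<close> on; \<open>e1\<close> and
    \<open>e2\<close> recover what a slot is for.\<close>
  define X where "X = (\<lambda>t i a.
    if t < t1 then (case e1 t of (S, i', c) \<Rightarrow> if i \<in> {i'} \<and> a \<le> q then V i S c a else (\<lambda>H s. 0))
    else if t < t2 then (case e2 t of (S, c) \<Rightarrow>
      if i \<in> S \<and> a \<le> 1 then W i (sorted_list_of_set (S - {i}) ! 0) S c else (\<lambda>H s. 0))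
    else X' t i a)"
  define T where "T = card E1 + card E2 + T'"
  have T_eq: "t0 + T = t2 + T'" by (simp add: T_def t2_def t1_def)
  have "real T = real (n * fact (Suc d)) * delivery_time K (Suc d)"
  proof -
    have "real T = real N' * (real (m * (K choose m)) + real (K choose Suc m) + real (m - 1) * delivery_time K d)"
      unfolding T_def of_nat_add T' card1 card2 N'_def of_nat_mult by (simp add: algebra_simps)
    also have "real N' = real (n * fact (Suc d)) / real (Suc d)"
      by (simp add: N'_def field_simps)
    finally show ?thesis by (simp add: m_def)
  qed
  moreover have "delivers K N m (N' * q) t0 U T X"
    unfolding delivers_def
  proof (intro conjI ballI allI impI)
    fix t i a assume t: "t \<in> {t0..<t0 + T}" and i: "i \<in> {1..K}"
    consider "t < t1" | "t1 \<le> t" "t < t2" | "t2 \<le> t" by linarith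
    then show "causal K i t (X t i a)"
    proof cases
      case 1
      obtain S i' c where e: "e1 t = (S, i', c)" by (cases "e1 t")
      have E: "(S, i', c) \<in> E1" using e1'[of t] 1 t e by auto
      show ?thesis unfolding X_def using 1 e V[OF E] t
        by (auto intro: causal_zero causal_mono)
    next
      case 2
      obtain S c where e: "e2 t = (S, c)" by (cases "e2 t")
      have E: "(S, c) \<in> E2" using e2'[of t] 2 e by auto
      have "causal K i t (W i (sorted_list_of_set (S - {i}) ! 0) S c)" if "i \<in> S"
        using nth[OF E that, of 0] m(1) 2(1) that by (intro causal_mono[OF W[OF E]]) auto
      then show ?thesis unfolding X_def using 2 e by (auto intro: causal_zero)
    next
      case 3
      then have "\<not> t < t1" "\<not> t < t2" by (auto simp: t2_def)
      then show ?thesis using X' 3 t T_eq i by (auto simp: X_def delivers_def)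
    qed
  next
    fix H u k S i c
    assume k: "k \<in> {1..K}" and all: "\<forall>t\<in>{t0..<t0 + T}. generic_slot K t H \<and> noiseless K N X H u k t = 0"
      and S: "S \<subseteq> {1..K}" "card S = m" "k \<in> S" "i \<in> S" and c: "c < N' * q"
    have le: "t0 \<le> t1" "t1 \<le> t2" "t2 \<le> t0 + T" by (auto simp: t1_def t2_def T_def)
    define w where "w = (\<lambda>i j S c. symbol_value N (W i j S c) H (u i))"
    have rx1: "symbol_value N (overheard (\<theta>1 (S, i, c)) k i q (V i S c)) H (u i) = 0"
      if E: "(S, i, c) \<in> E1" for S i c
    proof -
      let ?t = "\<theta>1 (S, i, c)"
      have "noiseless K N X H u k ?t = (\<Sum>j\<in>{i}. symbol_value N (overheard ?t k j q (V j S c)) H (u j))"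
        using e1[OF E] E m by (intro noiseless_active) (auto simp: X_def E1_def)
      then show ?thesis using all e1(2)[OF E] le by auto
    qed
    have rx2: "(\<Sum>i\<in>S. symbol_value N (overheard (\<theta>2 (S, c)) k i 1 (\<lambda>_. W i (sorted_list_of_set (S - {i}) ! 0) S c)) H (u i)) = 0"
      if E: "(S, c) \<in> E2" for S c
    proof -
      let ?t = "\<theta>2 (S, c)"
      have "noiseless K N X H u k ?t = (\<Sum>i\<in>S. symbol_value N (overheard ?t k i 1 (\<lambda>_. W i (sorted_list_of_set (S - {i}) ! 0) S c)) H (u i))"
        using e2[OF E] E m by (intro noiseless_active) (auto simp: X_def E2_def)
      then show ?thesis using all e2(2)[OF E] le by auto
    qed
    have rx3: "symbol_value N (U' i S c) H (u i) = 0"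
      if "S \<subseteq> {1..K}" "card S = Suc m" "k \<in> S" "i \<in> S" "c < (m - 1) * n * fact d" for S i c
    proof -
      have "noiseless K N X' H u k t = noiseless K N X H u k t" if "t2 \<le> t" for t
        using that le by (auto simp: noiseless_def X_def)
      then have "\<forall>t\<in>{t2..<t2 + T'}. generic_slot K t H \<and> noiseless K N X' H u k t = 0"
        using all le T_eq by auto
      with X' k that show ?thesis unfolding delivers_def by blast
    qed
    \<comment> \<open>The differences delivered at order \<open>Suc m\<close> vanish, so the
      \<open>m\<close> overheard equations have equal values.\<close>
    have w_eq: "w i j S c = w i j' S c" if "(S, c) \<in> E2" "k \<in> S" "i \<in> S" "j \<in> S - {i}" "j' \<in> S - {i}" for i j j' S c
    proof -
      let ?l = "sorted_list_of_set (S - {i})"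
      have step: "w i (?l ! Suc r) S c = w i (?l ! r) S c" if "Suc r < m" for r
      proof -
        have "r < m - 1" using that by simp
        then have cr: "(c * (m - 1) + r) div (m - 1) = c" "(c * (m - 1) + r) mod (m - 1) = r" by auto
        have "c * (m - 1) + r < Suc c * (m - 1)" using that by simp
        also have "\<dots> \<le> N' * (m - 1)" using \<open>(S, c) \<in> E2\<close> by (intro mult_right_mono) (auto simp: E2_def)
        finally have "c * (m - 1) + r < (m - 1) * n * fact d" by (simp add: N'_def mult_ac)
        then have "symbol_value N (U' i S (c * (m - 1) + r)) H (u i) = 0"
          using \<open>(S, c) \<in> E2\<close> \<open>k \<in> S\<close> \<open>i \<in> S\<close> by (intro rx3) (auto simp: E2_def)
        then show ?thesis unfolding U'_def Let_def cr symbol_value_diff w_def by simp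
      qed
      have const: "w i (?l ! r) S c = w i (?l ! 0) S c" if "r < m" for r
        using that by (induction r) (auto simp: step)
      have "w i j S c = w i (?l ! 0) S c" if "j \<in> S - {i}" for j
        using const that list[OF \<open>(S, c) \<in> E2\<close> \<open>i \<in> S\<close>] by (metis in_set_conv_nth)
      then show ?thesis using that by metis
    qed
    \<comment> \<open>One of the equations of a foreign Tx \<open>i\<close> was received by Rx
      \<open>k\<close> itself, in the slot serving \<open>S - {k}\<close>.\<close>
    have w0_other: "w i j S c = 0" if "(S, c) \<in> E2" "k \<in> S" "i \<in> S" "j \<in> S - {i}" "i \<noteq> k" for i j S c
    proof -
      have "w i k S c = 0" unfolding w_def W_def using that by (intro rx1 E1I) auto
      then show ?thesis using w_eq[of S c i j k] that by auto
    qed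
    \<comment> \<open>In the joint slot all foreign contributions are now 0, so only the equation of
      Tx \<open>k\<close> remains, multiplied by a coefficient that is nonzero by genericity for the
      one-element set \<open>{k}\<close>.\<close>
    have w0_own: "w k j S c = 0" if E: "(S, c) \<in> E2" and "k \<in> S" "j \<in> S - {k}" for j S c
    proof -
      let ?f = "\<lambda>i. sorted_list_of_set (S - {i}) ! 0"
      have f: "?f i \<in> S - {i}" if "i \<in> S" for i using nth[OF E that, of 0] m(1) by simp
      have "finite S" using E by (auto simp: E2_def intro: finite_subset)
      have gen: "generic_slot K (\<theta>2 (S, c)) H" using all e2(2)[OF E] le by auto
      have "(\<Sum>i\<in>S. cnj (H (\<theta>2 (S, c), k, i, 1)) * w i (?f i) S c) = 0"
        using rx2[OF E] by (simp add: symbol_value_overheard w_def)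
      also have "(\<Sum>i\<in>S. cnj (H (\<theta>2 (S, c), k, i, 1)) * w i (?f i) S c) =
          (\<Sum>i\<in>{k}. cnj (H (\<theta>2 (S, c), k, i, 1)) * w i (?f i) S c)"
        using w0_other[OF E \<open>k \<in> S\<close>] f \<open>finite S\<close> \<open>k \<in> S\<close> by (intro sum.mono_neutral_right) auto
      finally have "symbol_value N (overheard (\<theta>2 (S, c)) k k 1 (\<lambda>_. W k (?f k) S c)) H (u k) = 0"
        by (simp add: symbol_value_overheard w_def)
      then have "w k (?f k) S c = 0" unfolding w_def
        using generic_slotD[OF gen k, of "{k}" 1 N "\<lambda>_. W k (?f k) S c" "u k" 1] k by auto
      then show ?thesis using w_eq[OF E \<open>k \<in> S\<close> \<open>k \<in> S\<close> _ f[OF \<open>k \<in> S\<close>], of j] that by simp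
    qed
    have w0: "w i j S c = 0" if "(S, c) \<in> E2" "k \<in> S" "i \<in> S" "j \<in> S - {i}" for i j S c
      using w0_other[OF that] w0_own[OF that(1,2)] that by (cases "i = k") auto
    define c' a where "c' = c div q" and "a = Suc (c mod q)"
    have E: "(S, i, c') \<in> E1" using S c by (auto simp: E1_def c'_def less_mult_imp_div_less mult_ac)
    let ?t = "\<theta>1 (S, i, c')"
    have gen: "generic_slot K ?t H" using all e1(2)[OF E] le by auto
    have "symbol_value N (V i S c' a) H (u i) = 0"
    \<comment> \<open>The equation received by Rx \<open>k\<close> and the \<open>K - m\<close>
      equations overheard outside \<open>S\<close> are \<open>q\<close> equations in the
      \<open>q\<close> symbols of the group.\<close>
    proof (rule generic_slotD[OF gen, where J = "insert k ({1..K} - S)"])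
      show "i \<in> {1..K}" "insert k ({1..K} - S) \<subseteq> {1..K}" using S k by auto
      show "card (insert k ({1..K} - S)) = q" using S m by (simp add: card_Diff_subset finite_subset)
      show "a \<in> {1..q}" using m by (simp add: a_def Suc_le_eq)
      fix j assume j: "j \<in> insert k ({1..K} - S)"
      show "symbol_value N (overheard ?t j i q (V i S c')) H (u i) = 0"
      proof (cases "j = k")
        case True
        then show ?thesis using rx1[OF E] by simp
      next
        case False
        then have jS: "j \<notin> S" "j \<in> {1..K}" using j by auto
        have "w i j (insert j S) c' = 0"
          using S jS E by (intro w0) (auto simp: E2_def E1_def card_insert_if finite_subset)
        moreover have "insert j S - {j} = S" using jS by auto
        ultimately show ?thesis by (simp add: w_def W_def)
      qed
    qed
    then show "symbol_value N (U i S c) H (u i) = 0"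
      by (simp add: V_def c'_def a_def)
  qed
  ultimately have "real T = real (n * fact (Suc d)) * delivery_time K (Suc d) \<and>
    delivers K N (K + 1 - Suc d) (n * fact (Suc d)) t0 U T X"
    by (simp only: m(2) nN)
  then show ?case by blast
qed

section \<open>The first phase, slot counts and the sum rate of the linear scheme\<close>

lemma card_supersets:
  assumes "finite B" "S \<subseteq> B" "card S \<le> q"
  shows "card {A. S \<subseteq> A \<and> A \<subseteq> B \<and> card A = q} = (card B - card S) choose (q - card S)"
proof -
  have "finite S" using assms finite_subset by blast
  have "bij_betw (\<lambda>A. A - S) {A. S \<subseteq> A \<and> A \<subseteq> B \<and> card A = q} {A. A \<subseteq> B - S \<and> card A = q - card S}"
  proof (rule bij_betw_byWitness[of _ "\<lambda>A. A \<union> S"])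
    have "card (A \<union> S) = q" if "A \<subseteq> B - S" "card A = q - card S" for A
      using that assms \<open>finite S\<close> by (subst card_Un_disjoint) (auto intro: finite_subset)
    then show "(\<lambda>A. A \<union> S) ` {A. A \<subseteq> B - S \<and> card A = q - card S} \<subseteq> {A. S \<subseteq> A \<and> A \<subseteq> B \<and> card A = q}"
      using assms by auto
  qed (use \<open>finite S\<close> in \<open>auto simp: card_Diff_subset\<close>)
  then have "card {A. S \<subseteq> A \<and> A \<subseteq> B \<and> card A = q} = card {A. A \<subseteq> B - S \<and> card A = q - card S}"
    by (rule bij_betw_same_card)
  also have "\<dots> = (card B - card S) choose (q - card S)"
    using assms \<open>finite S\<close> by (subst n_subsets) (auto simp: card_Diff_subset)
  finally show ?thesis .
qed

text \<open>Solves the recursion by induction, with \<open>m = K - d\<close> falling. The summand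
  that appears at \<open>l = m\<close> satisfies \<open>(m - 1) * g m = d / (m + 1)\<close>, which
  is the ratio of \<open>K choose Suc m\<close> to \<open>K choose m\<close>. The assumption
  \<open>d < K\<close> keeps \<open>m\<close> at least 2 in the step, away from the pole at
  \<open>l = 1\<close>.\<close>

lemma delivery_time_closed_form:
  assumes "d < K"
  shows "delivery_time K d = real (K choose (K - d)) *
    (real d - real (K - d) * (\<Sum>l=K-d+1..K-1. (real K - real l) / ((real l)\<^sup>2 - 1)))"
  using assms
proof (induction d)
  case 0
  then show ?case by simp
next
  case (Suc d)
  define m where "m = K - d"
  have m: "2 \<le> m" "K = m + d" "K - Suc d = m - 1" using Suc.prems by (auto simp: m_def)
  define C where "C = real (K choose m)"
  define s where "s = (\<Sum>l=m+1..K-1. (real K - real l) / ((real l)\<^sup>2 - 1))"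
  define g where "g = (\<lambda>l. (real K - real l) / ((real l)\<^sup>2 - 1))"
  have absorb: "real (Suc l) * real (K choose Suc l) = real (K - l) * real (K choose l)" for l
    using binomial_absorb_comp[of K l] binomial_absorption[of l K] by (metis of_nat_mult)
  have up: "real (K choose Suc m) = C * real d / (real m + 1)"
    using absorb[of m] m by (simp add: C_def field_simps)
  have down: "real (K choose (m - 1)) = C * real m / (real d + 1)"
    using absorb[of "m - 1"] m by (simp add: C_def field_simps)
  have sum: "(\<Sum>l=m..K-1. g l) = g m + s"
  proof (cases "d = 0")
    case True
    then show ?thesis using m by (simp add: g_def s_def)
  next
    case False
    then show ?thesis unfolding s_def g_def using m by (subst sum.atLeast_Suc_atMost) auto
  qed
  have "(real m)\<^sup>2 - 1 = (real m + 1) * (real m - 1)" by (simp add: power2_eq_square algebra_simps)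
  moreover have "real m - 1 > 0" using m by simp
  ultimately have "g m = real d / ((real m + 1) * (real m - 1))" "real m - 1 \<noteq> 0" using m by (auto simp: g_def)
  then have gm: "(real m - 1) * g m = real d / (real m + 1)" by simp
  have IH: "delivery_time K d = C * (real d - real m * s)"
    using Suc by (simp add: m_def C_def s_def)
  have "(real d + 1) * delivery_time K (Suc d) = real (m * (K choose m)) + real (K choose Suc m) + real (m - 1) * delivery_time K d"
  proof -
    have "real d + 1 = real (Suc d)" by simp
    then show ?thesis unfolding \<open>real d + 1 = real (Suc d)\<close> delivery_time.simps m_def by (simp del: of_nat_Suc)
  qed
  also have "\<dots> = real m * C + C * real d / (real m + 1) + (real m - 1) * C * (real d - real m * s)"
    unfolding IH up using m(1) by (simp add: C_def of_nat_diff)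
  also have "\<dots> = C * real m * (real d + 1 - ((real m - 1) * g m + (real m - 1) * s))"
    unfolding gm by (simp add: field_simps)
  also have "\<dots> = (real d + 1) * (real (K choose (m - 1)) * (real d + 1 - (real m - 1) * (g m + s)))"
    unfolding down by (simp add: distrib_left)
  finally have "delivery_time K (Suc d) = real (K choose (m - 1)) * (real d + 1 - (real m - 1) * (g m + s))"
    by (simp add: add_nonneg_eq_0_iff del: delivery_time.simps)
  moreover have "(\<Sum>l=K - Suc d + 1..K-1. (real K - real l) / ((real l)\<^sup>2 - 1)) = g m + s"
    using sum m unfolding g_def by simp
  ultimately show ?case using m by (simp add: of_nat_diff add.commute del: delivery_time.simps)
qed

definition resolving_scheme :: "nat \<Rightarrow> nat \<Rightarrow> nat \<Rightarrow> (nat \<Rightarrow> nat \<Rightarrow> nat \<Rightarrow> symbol) \<Rightarrow> bool" where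
  "resolving_scheme K N T X \<longleftrightarrow>
     (\<forall>t\<in>{1..T}. \<forall>i\<in>{1..K}. \<forall>a. causal K i t (X t i a)) \<and>
     (\<forall>H u. \<forall>k\<in>{1..K}. (\<forall>t\<in>{1..T}. generic_slot K t H \<and> noiseless K N X H u k t = 0) \<longrightarrow>
        (\<forall>s<N. u k s = 0))"

text \<open>Each set of \<open>q\<close> transmitters gets \<open>fact (K - 1)\<close> slots with
  \<open>q\<close> fresh symbols per member. A transmitter lies in
  \<open>K - 1 choose (q - 1)\<close> such sets, which gives \<open>N\<close>; a pair lies in
  \<open>K - 2 choose (q - 2)\<close> of them, which counts the symbols of order 2 handed to
  \<open>ex_delivers\<close> with \<open>d = K - 1\<close>. The factorial is the one demanded
  there.\<close>

lemma ex_resolving_scheme: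
  assumes "2 \<le> q" "q \<le> K"
  shows "\<exists>N T X. resolving_scheme K N T X \<and>
    real N = real ((K - 1 choose (q - 1)) * q * fact (K - 1)) \<and>
    real T = real ((K choose q) * fact (K - 1)) + real ((K - 2 choose (q - 2)) * fact (K - 1)) * delivery_time K (K - 1)"
proof -
  define n where "n = (fact (K - 1) :: nat)"
  define N where "N = (K - 1 choose (q - 1)) * q * n"
  define n2 where "n2 = K - 2 choose (q - 2)"
  define E0 where "E0 = {A. A \<subseteq> {1..K} \<and> card A = q} \<times> {..<n}"
  define E where "E = (\<lambda>S. {A. S \<subseteq> A \<and> A \<subseteq> {1..K} \<and> card A = q} \<times> {..<n})"
  \<comment> \<open>The source symbols of Tx \<open>k\<close> are labelled by a first-phase slot in
    which it is active and an antenna; \<open>\<phi> k\<close> numbers these labels below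
    \<open>N\<close>.\<close>
  define D where "D = (\<lambda>k. E {k} \<times> {1..q})"
  have fin: "finite {A. P A \<and> A \<subseteq> {1..K} \<and> card A = q}" for P
    by (rule finite_subset[of _ "Pow {1..K}"]) auto
  have fin0: "finite E0" unfolding E0_def using fin[of "\<lambda>_. True"] by simp
  have finE: "finite (E S)" for S unfolding E_def using fin by simp
  have card0: "card E0 = (K choose q) * n"
    unfolding E0_def by (simp add: card_cartesian_product n_subsets)
  have cardE: "card (E S) = (K - card S choose (q - card S)) * n" if "S \<subseteq> {1..K}" "card S \<le> q" for S
    unfolding E_def using card_supersets[OF _ that] by (simp add: card_cartesian_product)
  have cardD: "card (D k) = N" if "k \<in> {1..K}" for k
    unfolding D_def N_def using that assms cardE[of "{k}"] by (simp add: card_cartesian_product)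
  obtain \<theta> where \<theta>: "bij_betw \<theta> E0 {1..<1 + card E0}" using ex_slot_assignment[OF fin0] .
  have "\<forall>S. \<exists>f. bij_betw f {..<card (E S)} (E S)"
    using ex_bij_betw_nat_finite[OF finE] unfolding atLeast0LessThan by blast
  from choice[OF this] obtain \<psi> where \<psi>: "\<And>S. bij_betw (\<psi> S) {..<card (E S)} (E S)" by blast
  have "\<forall>k. \<exists>f. bij_betw f (D k) {..<card (D k)}"
  proof
    fix k
    have "finite (D k)" using finE by (simp add: D_def)
    then show "\<exists>f. bij_betw f (D k) {..<card (D k)}"
      using ex_bij_betw_finite_nat unfolding atLeast0LessThan by blast
  qed
  from choice[OF this] obtain \<phi> where \<phi>: "\<And>k. bij_betw (\<phi> k) (D k) {..<card (D k)}" by blast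
  define e0 where "e0 = inv_into E0 \<theta>"
  define t1 where "t1 = 1 + card E0"
  have e0: "e0 (\<theta> e) = e" "\<theta> e \<in> {1..<t1}" if "e \<in> E0" for e
    using bij_betw_inv_into_left[OF \<theta> that] bij_betwE[OF \<theta>] that by (auto simp: e0_def t1_def)
  define unit where "unit = (\<lambda>i e (H :: channel) s. if s = \<phi> i e then 1 else 0 :: complex)"
  have unit_causal: "causal K i t (unit i e)" for i t e
    by (simp add: causal_def unit_def delayed_local_const)
  have unit_value: "symbol_value N (unit i e) H u = u (\<phi> i e)" if "i \<in> {1..K}" "e \<in> D i" for i e H u
  proof -
    have "\<phi> i e < N" using bij_betwE[OF \<phi>[of i]] that cardD[OF that(1)] by auto
    have "symbol_value N (unit i e) H u = (\<Sum>s<N. if s = \<phi> i e then u s else 0)"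
      unfolding symbol_value_def unit_def by (intro sum.cong) auto
    then show ?thesis using \<open>\<phi> i e < N\<close> by simp
  qed
  \<comment> \<open>For a pair \<open>S\<close> the element of \<open>S - {i}\<close> is the other
    receiver, and the symbol is what that receiver overhears of Tx \<open>i\<close>.\<close>
  define U where "U = (\<lambda>i S e. overheard (\<theta> (\<psi> S e)) (the_elem (S - {i})) i q (\<lambda>a. unit i (\<psi> S e, a)))"
  have \<psi>E: "\<psi> S e \<in> E S" if "S \<subseteq> {1..K}" "card S = 2" "e < n2 * n" for S e
    using that assms bij_betwE[OF \<psi>[of S]] cardE[of S] by (auto simp: n2_def)
  have E_E0: "E S \<subseteq> E0" for S by (auto simp: E_def E0_def)
  have pair: "the_elem (S - {i}) = j" if "S = {i, j}" "i \<noteq> j" for S and i j :: nat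
  proof -
    have "S - {i} = {j}" using that by auto
    then show ?thesis by simp
  qed
  have "\<exists>T X. real T = real (n2 * fact (K - 1)) * delivery_time K (K - 1) \<and>
      delivers K N (K + 1 - (K - 1)) (n2 * fact (K - 1)) t1 U T X"
  proof (rule ex_delivers)
    fix i S c
    assume *: "S \<subseteq> {1..K}" "card S = K + 1 - (K - 1)" "i \<in> S" "c < n2 * fact (K - 1)"
    then have "card S = 2" using assms by simp
    then obtain j where j: "S = {i, j}" "i \<noteq> j" using \<open>i \<in> S\<close> by (auto simp: card_2_iff)
    have "\<psi> S c \<in> E0" using \<psi>E[of S c] E_E0 * \<open>card S = 2\<close> by (auto simp: n_def)
    then show "causal K i t1 (U i S c)"
      unfolding U_def pair[OF j] using e0(2) j(1) *(1) assms
      by (intro causal_overheard unit_causal) auto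
  qed (use assms in \<open>auto simp: t1_def\<close>)
  moreover have "K + 1 - (K - 1) = 2" using assms by simp
  ultimately obtain T' X' where T': "real T' = real (n2 * n) * delivery_time K (K - 1)"
    and X': "delivers K N 2 (n2 * n) t1 U T' X'" by (auto simp: n_def)
  define X where "X = (\<lambda>t i a. if t < t1 then (if i \<in> fst (e0 t) \<and> a \<le> q then unit i (e0 t, a) else (\<lambda>H s. 0)) else X' t i a)"
  define T where "T = card E0 + T'"
  have "resolving_scheme K N T X"
    unfolding resolving_scheme_def
  proof (intro conjI ballI allI impI)
    fix t i a assume "t \<in> {1..T}" "i \<in> {1..K}"
    then show "causal K i t (X t i a)"
      using X' by (cases "t < t1") (auto simp: X_def T_def t1_def delivers_def unit_causal causal_zero)
  next
    fix H u k s
    assume k: "k \<in> {1..K}" and all: "\<forall>t\<in>{1..T}. generic_slot K t H \<and> noiseless K N X H u k t = 0"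
      and s: "s < N"
    have "noiseless K N X' H u k t = noiseless K N X H u k t" if "t1 \<le> t" for t
      using that by (auto simp: noiseless_def X_def)
    then have "\<forall>t\<in>{t1..<t1 + T'}. generic_slot K t H \<and> noiseless K N X' H u k t = 0"
      using all by (auto simp: t1_def T_def)
    then have dec: "symbol_value N (U i S c) H (u i) = 0"
      if "S \<subseteq> {1..K}" "card S = 2" "k \<in> S" "i \<in> S" "c < n2 * n" for S i c
      using X' k that unfolding delivers_def by blast
    have "s \<in> \<phi> k ` D k" using \<phi>[of k] cardD[OF k] s by (simp add: bij_betw_def)
    then obtain A c a where s_eq: "s = \<phi> k ((A, c), a)" and Dk: "((A, c), a) \<in> D k" by auto
    then have A: "A \<subseteq> {1..K}" "card A = q" "k \<in> A" "c < n" "a \<in> {1..q}" "(A, c) \<in> E0"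
      by (auto simp: D_def E_def E0_def)
    let ?t = "\<theta> (A, c)" and ?v = "\<lambda>i a. unit i ((A, c), a)"
    have t: "?t \<in> {1..T}" "?t < t1" using e0[OF A(6)] by (auto simp: t1_def T_def)
    \<comment> \<open>The symbols of order 2 that Rx \<open>k\<close> obtains: interference to be
      removed when \<open>j = k\<close>, further equations for its own symbols when
      \<open>i = k\<close>.\<close>
    have over: "symbol_value N (overheard ?t j i q (?v i)) H (u i) = 0"
      if "i \<in> A" "j \<in> A" "i \<noteq> j" "k \<in> {i, j}" for i j
    proof -
      have S: "{i, j} \<subseteq> {1..K}" "card {i, j} = 2" using that A by auto
      have "(A, c) \<in> E {i, j}" using that A by (auto simp: E_def)
      then have "(A, c) \<in> \<psi> {i, j} ` {..<card (E {i, j})}" using \<psi>[of "{i, j}"] by (simp add: bij_betw_def)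
      then obtain e where e: "e < card (E {i, j})" "\<psi> {i, j} e = (A, c)" by auto
      then have "e < n2 * n" using cardE[OF S(1)] S(2) assms by (simp add: n2_def)
      then have "symbol_value N (U i {i, j} e) H (u i) = 0" using S that by (intro dec) auto
      then show ?thesis unfolding U_def pair[OF refl that(3)] e(2) .
    qed
    have finA: "finite A" using A finite_subset by auto
    have "0 = noiseless K N X H u k ?t" using all t by auto
    also have "\<dots> = (\<Sum>j\<in>A. symbol_value N (overheard ?t k j q (?v j)) H (u j))"
      using A t e0[OF A(6)] assms by (intro noiseless_active) (auto simp: X_def)
    also have "\<dots> = (\<Sum>j\<in>{k}. symbol_value N (overheard ?t k j q (?v j)) H (u j))"
      using over A finA by (intro sum.mono_neutral_right) auto
    finally have own: "symbol_value N (overheard ?t k k q (?v k)) H (u k) = 0" by simp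
    have "symbol_value N (?v k a) H (u k) = 0"
    proof (rule generic_slotD[of K ?t H k A])
      fix j assume "j \<in> A"
      then show "symbol_value N (overheard ?t j k q (?v k)) H (u k) = 0"
        using own over[of k j] A(3) by (cases "j = k") auto
    qed (use all t k A in auto)
    then show "u k s = 0" using unit_value[OF k Dk] s_eq by simp
  qed
  then show ?thesis
    by (intro exI[of _ N] exI[of _ T] exI[of _ X]) (simp add: T_def T' card0 N_def n_def n2_def)
qed

lemma inverse_order_param:
  "inverse (order_param K) = 1 - (\<Sum>l=2..K-1. (real K - real l) / ((real l)\<^sup>2 - 1)) / (real K - 1)"
  by (simp add: order_param_def)

text \<open>Both counts share the factor \<open>(K choose q) * fact (K - 1)\<close>: by absorption
  of binomial coefficients, \<open>K * N\<close> is that factor times \<open>q^2\<close>, and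
  \<open>T\<close> is that factor times \<open>1 + q * (q - 1) / order_param K\<close>.\<close>

lemma ex_resolving_scheme_rate:
  assumes "2 \<le> q" "q \<le> K"
  shows "\<exists>N T X. resolving_scheme K N T X \<and> 0 < T \<and>
    real K * real N / real T = (real q)\<^sup>2 / (1 + real q * (real q - 1) / order_param K)"
proof -
  obtain N T X where X: "resolving_scheme K N T X"
    and N: "real N = real ((K - 1 choose (q - 1)) * q * fact (K - 1))"
    and T: "real T = real ((K choose q) * fact (K - 1)) + real ((K - 2 choose (q - 2)) * fact (K - 1)) * delivery_time K (K - 1)"
    using ex_resolving_scheme[OF assms] by blast
  define F where "F = real (fact (K - 1))"
  define C where "C = real (K choose q)"
  have pos: "F > 0" "C > 0" using assms by (auto simp: F_def C_def)
  have absorb: "real (Suc l) * real (Suc n choose Suc l) = real (Suc n) * real (n choose l)" for l n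
    using binomial_absorption[of l "Suc n"] by (metis diff_Suc_1 of_nat_mult)
  have C1: "real K * real (K - 1 choose (q - 1)) = real q * C"
    using absorb[of "q - 1" "K - 1"] assms by (simp add: C_def)
  have "Suc (q - 2) = q - 1" "Suc (K - 2) = K - 1" "real (q - 1) = real q - 1" "real (K - 1) = real K - 1"
    using assms by auto
  then have C2: "(real K - 1) * real (K - 2 choose (q - 2)) = (real q - 1) * real (K - 1 choose (q - 1))"
    using absorb[of "q - 2" "K - 2"] by metis
  define s where "s = (\<Sum>l=2..K-1. (real K - real l) / ((real l)\<^sup>2 - 1))"
  have "delivery_time K (K - 1) = real K * (real K - 1 - s)"
    using delivery_time_closed_form[of "K - 1" K] assms
    by (simp add: s_def of_nat_diff numeral_2_eq_2)
  also have "\<dots> = real K * (real K - 1) * inverse (order_param K)"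
    unfolding inverse_order_param s_def[symmetric] using assms by (simp add: field_simps)
  finally have time: "delivery_time K (K - 1) = real K * (real K - 1) * inverse (order_param K)" .
  have "real T = C * F + real (K - 2 choose (q - 2)) * F * delivery_time K (K - 1)"
    unfolding T by (simp add: C_def F_def)
  also have "real (K - 2 choose (q - 2)) * F * delivery_time K (K - 1) =
      real K * ((real K - 1) * real (K - 2 choose (q - 2))) * F * inverse (order_param K)"
    unfolding time by simp
  also have "\<dots> = (real q - 1) * (real K * real (K - 1 choose (q - 1))) * F * inverse (order_param K)"
    unfolding C2 by simp
  also have "\<dots> = C * F * (real q * (real q - 1) / order_param K)"
    unfolding C1 by (simp add: divide_inverse)
  finally have T': "real T = C * F * (1 + real q * (real q - 1) / order_param K)"
    by (simp add: distrib_left)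
  have "real K * real N = (real K * real (K - 1 choose (q - 1))) * real q * F"
    unfolding N by (simp add: F_def)
  then have N': "real K * real N = C * F * (real q)\<^sup>2"
    unfolding C1 by (simp add: power2_eq_square)
  have dt: "delivery_time K d \<ge> 0" for d
    by (induction d) simp_all
  have "real T > 0"
    unfolding T using dt assms by (intro add_pos_nonneg mult_nonneg_nonneg) simp_all
  then have "0 < T" by simp
  moreover have "real K * real N / real T = (real q)\<^sup>2 / (1 + real q * (real q - 1) / order_param K)"
    unfolding T' N' using pos by simp
  ultimately show ?thesis using X by blast
qed

text \<open>Ensures that floor and ceiling of \<open>2 * order_param K\<close> are group sizes
  between 2 and \<open>K\<close>. Bounding \<open>(K - l) / (K - 1)\<close> by 1 leaves a
  telescoping sum of at most 3/4, so the order parameter is at most 4, enough for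
  \<open>K \<ge> 8\<close>; the smaller values of \<open>K\<close> are evaluated one by one.\<close>

lemma order_param_bounds:
  assumes "2 \<le> K"
  shows "1 \<le> order_param K" "2 * order_param K \<le> real K \<or> 2 * order_param K \<le> 8 \<and> 8 \<le> K"
proof -
  define s where "s = (\<Sum>l=2..K-1. (real K - real l) / ((real l)\<^sup>2 - 1)) / (real K - 1)"
  have inv: "inverse (order_param K) = 1 - s" by (simp add: inverse_order_param s_def)
  have sq: "(real l)\<^sup>2 - 1 > 0" if "2 \<le> l" for l
    using power_strict_mono[of 1 "real l" 2] that by simp
  have "s \<ge> 0"
    unfolding s_def using assms by (intro divide_nonneg_nonneg sum_nonneg) (auto intro: less_imp_le sq)
  have tel: "(\<Sum>l=2..n. 1 / ((real l)\<^sup>2 - 1)) = 3 / 4 - 1 / (2 * real n) - 1 / (2 * (real n + 1))" if "1 \<le> n" for n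
    using that
  proof (induction n rule: dec_induct)
    case base
    then show ?case by simp
  next
    case (step n)
    have "(real (Suc n))\<^sup>2 - 1 = real n * (real n + 2)" by (simp add: power2_eq_square algebra_simps)
    moreover have "(\<Sum>l=2..Suc n. 1 / ((real l)\<^sup>2 - 1)) = (\<Sum>l=2..n. 1 / ((real l)\<^sup>2 - 1)) + 1 / ((real (Suc n))\<^sup>2 - 1)"
      using step(1) by (subst sum.nat_ivl_Suc') auto
    moreover have "1 / (real n * (real n + 2)) = 1 / (2 * real n) - 1 / (2 * (real (Suc n) + 1))"
      using step(1) by (simp add: divide_simps)
    ultimately show ?case using step.IH by simp
  qed
  have "s = (\<Sum>l=2..K-1. (real K - real l) / (real K - 1) * (1 / ((real l)\<^sup>2 - 1)))"
    unfolding s_def sum_divide_distrib by (intro sum.cong) (auto simp: field_simps)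
  also have "\<dots> \<le> (\<Sum>l=2..K-1. 1 * (1 / ((real l)\<^sup>2 - 1)))"
  proof (intro sum_mono mult_right_mono)
    fix l assume "l \<in> {2..K - 1}"
    then show "(real K - real l) / (real K - 1) \<le> 1" "0 \<le> 1 / ((real l)\<^sup>2 - 1)"
      using sq[of l] by (auto simp: divide_le_eq intro: less_imp_le)
  qed
  also have "\<dots> = 3 / 4 - 1 / (2 * real (K - 1)) - 1 / (2 * (real (K - 1) + 1))"
    using tel[of "K - 1"] assms by simp
  also have "\<dots> \<le> 3 / 4"
  proof -
    have "0 \<le> 1 / (2 * real (K - 1))" "0 \<le> 1 / (2 * (real (K - 1) + 1))" by simp_all
    moreover have "x - a - b \<le> x" if "0 \<le> a" "0 \<le> b" for x a b :: real using that by simp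
    ultimately show ?thesis by blast
  qed
  finally have "s \<le> 3 / 4" .
  have ord: "order_param K = 1 / (1 - s)" using inv by (metis inverse_eq_divide inverse_inverse_eq)
  show "1 \<le> order_param K" using \<open>0 \<le> s\<close> \<open>s \<le> 3 / 4\<close> by (simp add: ord field_simps)
  have 8: "2 * order_param K \<le> 8" using \<open>s \<le> 3 / 4\<close> by (simp add: ord field_simps)
  show "2 * order_param K \<le> real K \<or> 2 * order_param K \<le> 8 \<and> 8 \<le> K"
  proof (cases "8 \<le> K")
    case False
    then have "K = 2 \<or> K = 3 \<or> K = 4 \<or> K = 5 \<or> K = 6 \<or> K = 7" using assms by auto
    then have "1 - s \<ge> 2 / real K"
      by (elim disjE) (simp_all add: s_def sum.atLeast_Suc_atMost)
    then have "2 * order_param K \<le> real K" using \<open>s \<le> 3 / 4\<close> assms by (simp add: ord field_simps)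
    then show ?thesis ..
  qed (use 8 in simp)
qed

section \<open>Block codes\<close>

lemma linear_functional_bound:
  fixes y :: "'t \<Rightarrow> (nat \<Rightarrow> nat \<Rightarrow> complex) \<Rightarrow> complex"
  assumes "finite I"
    and y: "\<And>t u v c. t \<in> I \<Longrightarrow> y t (\<lambda>k s. u k s + c * v k s) = y t u + c * y t v"
    and \<phi>: "\<And>u v c. \<phi> (\<lambda>k s. u k s + c * v k s) = \<phi> u + c * \<phi> v"
    and ker: "\<And>u. (\<And>t. t \<in> I \<Longrightarrow> y t u = 0) \<Longrightarrow> \<phi> u = 0"
  shows "\<exists>C\<ge>0. \<forall>u. cmod (\<phi> u) \<le> C * (\<Sum>t\<in>I. cmod (y t u))"
  using assms
proof (induction I arbitrary: \<phi> rule: finite_induct)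
  case empty
  then show ?case by (intro exI[of _ 0]) auto
next
  case (insert j I)
  show ?case
  proof (cases "\<exists>w. (\<forall>t\<in>I. y t w = 0) \<and> y j w \<noteq> 0")
    case False
    have "\<phi> u = 0" if "\<And>t. t \<in> I \<Longrightarrow> y t u = 0" for u
    proof (rule insert.prems(3))
      fix t assume "t \<in> insert j I"
      then show "y t u = 0" using that False by auto
    qed
    then have "\<exists>C\<ge>0. \<forall>u. cmod (\<phi> u) \<le> C * (\<Sum>t\<in>I. cmod (y t u))"
      using insert.prems(1,2) by (intro insert.IH) auto
    then obtain C where C: "C \<ge> 0" "\<And>u. cmod (\<phi> u) \<le> C * (\<Sum>t\<in>I. cmod (y t u))" by blast
    have "cmod (\<phi> u) \<le> C * (\<Sum>t\<in>insert j I. cmod (y t u))" for u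
      using insert.hyps by (intro order_trans[OF C(2)] mult_left_mono C(1)) auto
    then show ?thesis using C(1) by blast
  next
    case True
    then obtain w where w: "\<And>t. t \<in> I \<Longrightarrow> y t w = 0" "y j w \<noteq> 0" by blast
    define a where "a = \<phi> w / y j w"
    have lin: "\<phi> (\<lambda>k s. u k s + c * v k s) - a * y j (\<lambda>k s. u k s + c * v k s) = (\<phi> u - a * y j u) + c * (\<phi> v - a * y j v)" for u v c
      using insert.prems(1)[of j u c v] by (simp add: insert.prems(2) algebra_simps)
    have "\<phi> u - a * y j u = 0" if u: "\<And>t. t \<in> I \<Longrightarrow> y t u = 0" for u
    proof -
      define c where "c = - (y j u / y j w)"
      have "y t (\<lambda>k s. u k s + c * w k s) = 0" if "t \<in> insert j I" for t
        using insert.prems(1)[OF that, of u c w] that u w by (auto simp: c_def)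
      then have "\<phi> (\<lambda>k s. u k s + c * w k s) = 0" by (rule insert.prems(3))
      then show ?thesis using insert.prems(2)[of u c w] by (simp add: a_def c_def)
    qed
    then have "\<exists>C\<ge>0. \<forall>u. cmod (\<phi> u - a * y j u) \<le> C * (\<Sum>t\<in>I. cmod (y t u))"
      using insert.prems(1) lin by (intro insert.IH) auto
    then obtain C where C: "C \<ge> 0" "\<And>u. cmod (\<phi> u - a * y j u) \<le> C * (\<Sum>t\<in>I. cmod (y t u))" by blast
    have "cmod (\<phi> u) \<le> (C + cmod a) * (\<Sum>t\<in>insert j I. cmod (y t u))" for u
    proof -
      let ?S = "\<Sum>t\<in>I. cmod (y t u)"
      have "cmod (\<phi> u) \<le> cmod (\<phi> u - a * y j u) + cmod (a * y j u)"
        using norm_triangle_ineq[of "\<phi> u - a * y j u" "a * y j u"] by simp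
      also have "\<dots> \<le> C * ?S + cmod a * cmod (y j u)"
        using C(2)[of u] by (simp add: norm_mult)
      also have "\<dots> \<le> (C + cmod a) * (cmod (y j u) + ?S)"
        using C(1) by (simp add: algebra_simps add_increasing add_increasing2 sum_nonneg)
      finally show ?thesis using insert.hyps by simp
    qed
    then show ?thesis using C(1) by (intro exI[of _ "C + cmod a"]) auto
  qed
qed

section \<open>Codes of large minimum distance over a finite alphabet\<close>

lemma card_agree_off:
  fixes x :: "nat \<Rightarrow> 'a" and B :: nat
  assumes "finite S" "R \<subseteq> {..<B}"
  shows "card {y \<in> PiE {..<B} (\<lambda>_. S). \<forall>b\<in>{..<B} - R. y b = x b} \<le> card S ^ card R"
proof -
  let ?Y = "{y \<in> PiE {..<B} (\<lambda>_. S). \<forall>b\<in>{..<B} - R. y b = x b}"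
  have "finite R" by (rule finite_subset[OF assms(2)]) simp
  have "inj_on (\<lambda>y. restrict y R) ?Y"
  proof (rule inj_onI)
    fix y z assume yz: "y \<in> ?Y" "z \<in> ?Y" "restrict y R = restrict z R"
    then have W: "y \<in> PiE {..<B} (\<lambda>_. S)" "z \<in> PiE {..<B} (\<lambda>_. S)"
      and agree: "\<forall>b\<in>{..<B} - R. y b = x b" "\<forall>b\<in>{..<B} - R. z b = x b"
      unfolding mem_Collect_eq by simp_all
    have ext: "y b = z b" if "b \<in> {..<B}" for b
    proof (cases "b \<in> R")
      case True
      then show ?thesis using fun_cong[OF yz(3), of b] by (simp only: restrict_apply')
    next
      case False
      then have "b \<in> {..<B} - R" using that by blast
      then have "y b = x b" "z b = x b" using agree by (simp_all only:)
      then show ?thesis by (simp only:)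
    qed
    show "y = z" by (rule PiE_ext[OF W ext])
  qed
  moreover have "(\<lambda>y. restrict y R) ` ?Y \<subseteq> PiE R (\<lambda>_. S)"
  proof (intro image_subsetI)
    fix y assume "y \<in> ?Y"
    then have y: "y \<in> PiE {..<B} (\<lambda>_. S)" unfolding mem_Collect_eq by (rule conjunct1)
    show "restrict y R \<in> PiE R (\<lambda>_. S)"
      using PiE_mem[OF y] assms(2) by (intro restrict_PiE_iff[THEN iffD2]) blast
  qed
  ultimately have "card ?Y \<le> card (PiE R (\<lambda>_. S))"
    by (rule card_inj_on_le) (intro finite_PiE \<open>finite R\<close> assms(1))
  then show ?thesis using \<open>finite R\<close> by (simp add: card_PiE)
qed

text \<open>Gilbert--Varshamov: the balls of radius \<open>r\<close> around the words of a maximal code cover.\<close>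

lemma ex_large_distance_code:
  fixes B :: nat
  assumes "finite S" "S \<noteq> {}"
  obtains C where "C \<subseteq> PiE {..<B} (\<lambda>_. S)" "finite C"
    "\<forall>x\<in>C. \<forall>y\<in>C. x \<noteq> y \<longrightarrow> r < card {b \<in> {..<B}. x b \<noteq> y b}"
    "card S ^ B \<le> card C * (2 ^ B * card S ^ r)"
proof -
  let ?W = "PiE {..<B} (\<lambda>_. S)"
  let ?codes = "{C. C \<subseteq> ?W \<and> (\<forall>x\<in>C. \<forall>y\<in>C. x \<noteq> y \<longrightarrow> r < card {b \<in> {..<B}. x b \<noteq> y b})}"
  have finW: "finite ?W" using assms(1) by (intro finite_PiE) auto
  have "?codes \<subseteq> Pow ?W" by (rule subsetI) (simp only: mem_Collect_eq Pow_iff)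
  then have "finite ?codes" by (rule finite_subset) (simp only: finite_Pow_iff finW)
  moreover have "?codes \<noteq> {}"
  proof -
    have "{} \<in> ?codes" by simp
    then show ?thesis by (intro notI) (simp only: empty_iff)
  qed
  ultimately have "\<exists>C\<in>?codes. \<forall>D\<in>?codes. C \<subseteq> D \<longrightarrow> C = D" by (rule finite_has_maximal)
  then obtain C where C: "C \<in> ?codes" and max: "\<forall>D\<in>?codes. C \<subseteq> D \<longrightarrow> C = D" by (rule bexE)
  have sym: "card {b \<in> {..<B}. x b \<noteq> y b} = card {b \<in> {..<B}. y b \<noteq> x b}" for x y :: "nat \<Rightarrow> 'a"
    by (rule arg_cong[of _ _ card], rule Collect_cong, rule conj_cong, rule refl, rule iffI; erule not_sym)
  have "C \<subseteq> ?W" using C unfolding mem_Collect_eq by (rule conjunct1)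
  have dist: "r < card {b \<in> {..<B}. x b \<noteq> y b}" if "x \<in> C" "y \<in> C" "x \<noteq> y" for x y
    using conjunct2[OF C[unfolded mem_Collect_eq], rule_format, OF that] .
  from \<open>C \<subseteq> ?W\<close> have finC: "finite C" using finW by (rule finite_subset)
  \<comment> \<open>The ball is written as a union over the possible sets \<open>R\<close> of
    differing positions; bounding their number by \<open>2 ^ B\<close> is precise enough.\<close>
  define ball where "ball = (\<lambda>x. \<Union>R\<in>{R. R \<subseteq> {..<B} \<and> card R \<le> r}. {y \<in> ?W. \<forall>b\<in>{..<B} - R. y b = x b})"
  have sub: "?W \<subseteq> (\<Union>x\<in>C. ball x)"
  proof
    fix y assume y: "y \<in> ?W"
    show "y \<in> (\<Union>x\<in>C. ball x)"
    proof (cases "\<exists>x\<in>C. card {b \<in> {..<B}. x b \<noteq> y b} \<le> r")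
      case True
      then obtain x where "x \<in> C" and "card {b \<in> {..<B}. x b \<noteq> y b} \<le> r" by (rule bexE)
      moreover have "{b \<in> {..<B}. x b \<noteq> y b} \<subseteq> {..<B}" by (rule Collect_restrict)
      moreover have "\<forall>b\<in>{..<B} - {b \<in> {..<B}. x b \<noteq> y b}. y b = x b" by simp
      ultimately have "y \<in> ball x" unfolding ball_def using y
        by (intro UN_I[of "{b \<in> {..<B}. x b \<noteq> y b}"] CollectI conjI)
      then show ?thesis using \<open>x \<in> C\<close> by blast
    next
      case False
      then have far: "r < card {b \<in> {..<B}. x b \<noteq> y b}" if "x \<in> C" for x
        using that by (simp add: not_le)
      have far': "r < card {b \<in> {..<B}. y b \<noteq> x b}" if "x \<in> C" for x
        by (subst sym) (rule far[OF that])
      have "r < card {b \<in> {..<B}. v b \<noteq> w b}" if "v \<in> insert y C" "w \<in> insert y C" "v \<noteq> w" for v w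
      proof (cases "v = y")
        case True
        then show ?thesis using that far'[of w] by simp
      next
        case False
        then show ?thesis using that far[of v] dist[of v w] by (cases "w = y") simp_all
      qed
      moreover have "insert y C \<subseteq> ?W" using y \<open>C \<subseteq> ?W\<close> by simp
      ultimately have "insert y C \<in> ?codes" unfolding mem_Collect_eq by (intro conjI ballI impI)
      from bspec[OF max this] have "C = insert y C" by (simp add: subset_insertI)
      then have "y \<in> C" by (metis insertI1)
      then show ?thesis using far[of y] by simp
    qed
  qed
  have le: "card (ball x) \<le> 2 ^ B * card S ^ r" for x
  proof -
    let ?Rs = "{R. R \<subseteq> {..<B} \<and> card R \<le> r}"
    have finR: "finite ?Rs" by (rule finite_subset[of _ "Pow {..<B}"]) auto
    have Q: "card S \<ge> 1" using assms by (simp add: Suc_le_eq card_gt_0_iff)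
    have "card (ball x) \<le> (\<Sum>R\<in>?Rs. card {y \<in> ?W. \<forall>b\<in>{..<B} - R. y b = x b})"
      unfolding ball_def by (rule card_UN_le[OF finR])
    also have "\<dots> \<le> (\<Sum>R\<in>?Rs. card S ^ r)"
    proof (rule sum_mono)
      fix R assume R: "R \<in> ?Rs"
      then have "card {y \<in> ?W. \<forall>b\<in>{..<B} - R. y b = x b} \<le> card S ^ card R"
        by (intro card_agree_off[OF assms(1)]) simp
      also have "\<dots> \<le> card S ^ r" using R Q by (intro power_increasing) auto
      finally show "card {y \<in> ?W. \<forall>b\<in>{..<B} - R. y b = x b} \<le> card S ^ r" .
    qed
    also have "\<dots> = card ?Rs * card S ^ r" by simp
    also have "card ?Rs \<le> card (Pow {..<B})" by (rule card_mono) auto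
    then have "card ?Rs * card S ^ r \<le> 2 ^ B * card S ^ r" by (simp add: card_Pow)
    finally show ?thesis .
  qed
  have fin: "finite (ball x)" for x
  proof (rule finite_subset[OF _ finW])
    show "ball x \<subseteq> ?W" unfolding ball_def by (rule UN_least) simp
  qed
  have "card ?W \<le> (\<Sum>x\<in>C. 2 ^ B * card S ^ r)"
  proof -
    have "card ?W \<le> card (\<Union>x\<in>C. ball x)" using sub fin finC by (intro card_mono finite_UN_I)
    also have "\<dots> \<le> (\<Sum>x\<in>C. card (ball x))" by (rule card_UN_le[OF finC])
    also have "\<dots> \<le> (\<Sum>x\<in>C. 2 ^ B * card S ^ r)" by (rule sum_mono) (rule le)
    finally show ?thesis .
  qed
  then have "card S ^ B \<le> card C * (2 ^ B * card S ^ r)" using assms(1) by (simp add: card_PiE)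
  moreover have "\<forall>x\<in>C. \<forall>y\<in>C. x \<noteq> y \<longrightarrow> r < card {b \<in> {..<B}. x b \<noteq> y b}"
    using dist by (intro ballI impI)
  ultimately show ?thesis by (rule that[OF \<open>C \<subseteq> ?W\<close> finC, rotated])
qed

text \<open>The maps \<open>\<iota> b\<close> embed the index set \<open>I\<close> disjointly into
  \<open>I'\<close>, so the blocks are independent copies of the small product space and
  probabilities multiply over \<open>S\<close>.\<close>

lemma measure_blocks:
  fixes \<iota> :: "nat \<Rightarrow> 'x \<Rightarrow> 'y" and \<mu> :: "'c measure"
  assumes \<mu>: "prob_space \<mu>"
    and inj: "inj_on (\<lambda>(b, x). \<iota> b x) ({..<B} \<times> I)"
    and I': "\<And>b x. b < B \<Longrightarrow> x \<in> I \<Longrightarrow> \<iota> b x \<in> I'"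
    and E: "E \<in> sets (PiM I (\<lambda>_. \<mu>))"
    and S: "S \<subseteq> {..<B}" and ne: "I \<noteq> {}"
  shows "measure (PiM I' (\<lambda>_. \<mu>)) {\<omega> \<in> space (PiM I' (\<lambda>_. \<mu>)). \<forall>b\<in>S. (\<lambda>x\<in>I. \<omega> (\<iota> b x)) \<in> E}
    = measure (PiM I (\<lambda>_. \<mu>)) E ^ card S"
proof (cases "S = {}")
  let ?M' = "PiM I' (\<lambda>_. \<mu>)" and ?M = "PiM I (\<lambda>_. \<mu>)"
  interpret prob_space ?M' by (intro prob_space_PiM \<mu>)
  case True
  then show ?thesis using prob_space by simp
next
  let ?M' = "PiM I' (\<lambda>_. \<mu>)" and ?M = "PiM I (\<lambda>_. \<mu>)"
  let ?blk = "\<lambda>b \<omega>. \<lambda>x\<in>I. \<omega> (\<iota> b x)"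
  interpret prob_space ?M' by (intro prob_space_PiM \<mu>)
  case False
  obtain b x where "b \<in> S" "x \<in> I" using False ne by auto
  then have I'_ne: "I' \<noteq> {}" using I'[of b x] S by auto
  show ?thesis
  proof -
    \<comment> \<open>Independence of the coordinates: their joint law is the product measure
      itself, hence the product of the marginals.\<close>
    have "distr ?M' ?M' (\<lambda>x. \<lambda>i\<in>I'. x i) = distr ?M' ?M' (\<lambda>x. x)"
      by (intro distr_cong) (auto simp: space_PiM PiE_def extensional_restrict)
    also have "\<dots> = ?M'" by (simp add: distr_id2)
    also have "?M' = (\<Pi>\<^sub>M i\<in>I'. distr ?M' \<mu> (\<lambda>\<omega>. \<omega> i))"
      by (intro PiM_cong refl distr_PiM_component[symmetric] \<mu>)
    finally have ind: "indep_vars (\<lambda>_. \<mu>) (\<lambda>i \<omega>. \<omega> i) I'"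
      using I'_ne by (subst indep_vars_iff_distr_eq_PiM') auto
    have "indep_vars (\<lambda>b. PiM (\<iota> b ` I) (\<lambda>_. \<mu>)) (\<lambda>b \<omega>. restrict (\<lambda>i. \<omega> i) (\<iota> b ` I)) {..<B}"
    proof (rule indep_vars_restrict[OF ind])
      show "disjoint_family_on (\<lambda>b. \<iota> b ` I) {..<B}"
        unfolding disjoint_family_on_def
      proof (intro ballI impI equals0I)
        fix b b' z assume b: "b \<in> {..<B}" "b' \<in> {..<B}" "b \<noteq> b'" "z \<in> \<iota> b ` I \<inter> \<iota> b' ` I"
        then obtain x x' where "x \<in> I" "x' \<in> I" "\<iota> b x = \<iota> b' x'" by auto
        then show False using inj_onD[OF inj, of "(b, x)" "(b', x')"] b by auto
      qed
    qed (use I' in auto)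
    then have "indep_vars (\<lambda>b. ?M) (\<lambda>b \<omega>. ?blk b (restrict (\<lambda>i. \<omega> i) (\<iota> b ` I))) {..<B}"
      by (rule indep_vars_compose2) (intro measurable_restrict measurable_component_singleton imageI)
    moreover have "?blk b (restrict (\<lambda>i. \<omega> i) (\<iota> b ` I)) = ?blk b \<omega>" for b and \<omega> :: "'y \<Rightarrow> 'c"
      by (auto simp: restrict_def)
    ultimately have ind: "indep_vars (\<lambda>b. ?M) ?blk {..<B}" by simp
    have "measure ?M' (\<Inter>b\<in>S. ?blk b -` E \<inter> space ?M') = (\<Prod>b\<in>S. measure ?M' (?blk b -` E \<inter> space ?M'))"
      using S False E finite_subset[OF S] by (intro indep_varsD[OF ind]) auto
    also have "\<dots> = (\<Prod>b\<in>S. measure ?M E)"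
    proof (rule prod.cong[OF refl])
      fix b assume "b \<in> S"
      then have b: "b < B" using S by auto
      have "inj_on (\<iota> b) I" using inj b by (auto simp: inj_on_def)
      then have "?M = distr ?M' ?M (?blk b)"
        using distr_PiM_reindex[of I' "\<lambda>_. \<mu>" "\<iota> b" I] \<mu> I'[OF b] by auto
      moreover have "?blk b \<in> ?M' \<rightarrow>\<^sub>M ?M"
        by (intro measurable_restrict measurable_component_singleton I'[OF b])
      ultimately show "measure ?M' (?blk b -` E \<inter> space ?M') = measure ?M E"
        using measure_distr[of "?blk b" ?M' ?M E] E by simp
    qed
    also have "(\<Inter>b\<in>S. ?blk b -` E \<inter> space ?M') = {\<omega> \<in> space ?M'. \<forall>b\<in>S. ?blk b \<omega> \<in> E}"
      using False by auto
    finally show ?thesis by simp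
  qed
qed

section \<open>Events under which a single block can be decoded\<close>

lemma measurable_channel_component:
  assumes "x \<in> channel_index K n"
  shows "(\<lambda>H. H x) \<in> borel_measurable (channel_space K n)"
  using measurable_component_singleton[OF assms, of "\<lambda>_. complex_gaussian"]
  by (simp add: channel_space_def cong: measurable_cong_sets)

lemma measurable_past_local:
  assumes "k \<in> {1..K}" "t \<le> n + 1"
  shows "past_local K k t \<in> channel_space K n \<rightarrow>\<^sub>M (\<Pi>\<^sub>M i\<in>past_index K t. borel)"
  unfolding past_local_def
proof (rule measurable_restrict, clarify)
  fix u j b assume "(u, j, b) \<in> past_index K t"
  with assms have "(u, j, k, b) \<in> channel_index K n"
    by (auto simp: past_index_def channel_index_def)
  then show "(\<lambda>H. H (u, j, k, b)) \<in> borel_measurable (channel_space K n)"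
    by (rule measurable_channel_component)
qed

lemma borel_measurable_causal:
  assumes "causal K i t \<sigma>" "i \<in> {1..K}" "t \<le> n + 1"
  shows "(\<lambda>H. \<sigma> H s) \<in> borel_measurable (channel_space K n)"
proof -
  from assms(1) obtain F where "F \<in> borel_measurable (\<Pi>\<^sub>M x\<in>past_index K t. borel)"
    and F: "\<And>H. \<sigma> H s = F (past_local K i t H)"
    unfolding causal_def delayed_local_def by meson
  from measurable_compose[OF measurable_past_local[OF assms(2,3)] this(1)] show ?thesis
    by (simp add: F)
qed

lemma borel_measurable_noiseless:
  assumes "\<And>i a. i \<in> {1..K} \<Longrightarrow> causal K i t (X t i a)" "t \<in> {1..n}" "k \<in> {1..K}"
  shows "(\<lambda>H. noiseless K N X H u k t) \<in> borel_measurable (channel_space K n)"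
  unfolding noiseless_def symbol_value_def
proof (intro borel_measurable_sum borel_measurable_times borel_measurable_const)
  fix j a s assume "j \<in> {1..K}" "a \<in> {1..K}"
  then have "(\<lambda>H. H (t, k, j, a)) \<in> borel_measurable (channel_space K n)"
    using assms by (intro measurable_channel_component) (auto simp: channel_index_def)
  then show "(\<lambda>H. cnj (H (t, k, j, a))) \<in> borel_measurable (channel_space K n)"
    by (rule measurable_compose) (intro borel_measurable_continuous_onI continuous_intros)
  show "(\<lambda>H. X t j a H s) \<in> borel_measurable (channel_space K n)"
    using assms \<open>j \<in> {1..K}\<close> by (intro borel_measurable_causal[of K j t]) auto
qed

lemma noiseless_add_scaled:
  "noiseless K N X H (\<lambda>j s. u j s + c * v j s) k t = noiseless K N X H u k t + c * noiseless K N X H v k t"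
  by (simp add: noiseless_def symbol_value_def sum_distrib_left distrib_left sum.distrib mult_ac)

lemma noiseless_cong:
  assumes "\<And>j s. j \<in> {1..K} \<Longrightarrow> s < N \<Longrightarrow> u j s = v j s"
  shows "noiseless K N X H u k t = noiseless K N X H v k t"
  unfolding noiseless_def symbol_value_def using assms by (intro sum.cong refl arg_cong2[of _ _ _ _ "(*)"]) auto

definition gaussian_ints :: "complex set" where
  "gaussian_ints = range (\<lambda>(a, b). Complex (real_of_int a) (real_of_int b))"

lemma countable_gaussian_ints: "countable gaussian_ints"
  by (simp add: gaussian_ints_def)

lemma gaussian_ints_norm_less_1:
  assumes "z \<in> gaussian_ints" "cmod z < 1"
  shows "z = 0"
proof -
  obtain a b where z: "z = Complex (real_of_int a) (real_of_int b)"
    using assms(1) by (auto simp: gaussian_ints_def)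
  have "\<bar>real_of_int a\<bar> < 1" "\<bar>real_of_int b\<bar> < 1"
    using abs_Re_le_cmod[of z] abs_Im_le_cmod[of z] assms(2) by (auto simp: z)
  then have "a = 0" "b = 0" by linarith+
  then show ?thesis by (simp add: z complex_eq_iff)
qed

text \<open>Entries outside the index range are fixed to 0; only finitely many free entries remain,
  which makes the set countable.\<close>

definition lattice_vectors :: "nat \<Rightarrow> nat \<Rightarrow> (nat \<Rightarrow> nat \<Rightarrow> complex) set" where
  "lattice_vectors K N = (\<lambda>z k s. if k \<in> {1..K} \<and> s < N then z (k, s) else 0) `
     PiE ({1..K} \<times> {..<N}) (\<lambda>_. gaussian_ints)"

lemma countable_lattice_vectors: "countable (lattice_vectors K N)"
  unfolding lattice_vectors_def
  by (intro countable_image countable_PiE countable_gaussian_ints) auto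

lemma lattice_vectorsI:
  assumes "\<And>k s. k \<in> {1..K} \<Longrightarrow> s < N \<Longrightarrow> u k s \<in> gaussian_ints"
    and "\<And>k s. \<not> (k \<in> {1..K} \<and> s < N) \<Longrightarrow> u k s = 0"
  shows "u \<in> lattice_vectors K N"
  unfolding lattice_vectors_def
proof (rule image_eqI)
  show "u = (\<lambda>k s. if k \<in> {1..K} \<and> s < N then restrict (\<lambda>(k, s). u k s) ({1..K} \<times> {..<N}) (k, s) else 0)"
    using assms(2) by (auto simp: fun_eq_iff)
  show "restrict (\<lambda>(k, s). u k s) ({1..K} \<times> {..<N}) \<in> PiE ({1..K} \<times> {..<N}) (\<lambda>_. gaussian_ints)"
    using assms(1) by auto
qed

text \<open>Quantifying over the countably many integer vectors keeps the set measurable; it also covers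
  the differences of points of a scaled integer grid.\<close>

definition good_channels :: "nat \<Rightarrow> nat \<Rightarrow> nat \<Rightarrow> (nat \<Rightarrow> nat \<Rightarrow> nat \<Rightarrow> symbol) \<Rightarrow> real \<Rightarrow> channel set" where
  "good_channels K N T X A = {H \<in> space (channel_space K T).
     (\<forall>t\<in>{1..T}. \<forall>i\<in>{1..K}. \<forall>a\<in>{1..K}. \<forall>s\<in>{..<N}. cmod (X t i a H s) \<le> A) \<and>
     (\<forall>u\<in>lattice_vectors K N. \<forall>k\<in>{1..K}. \<forall>s\<in>{..<N}.
        cmod (u k s) \<le> A * (\<Sum>t=1..T. cmod (noiseless K N X H u k t)))}"

definition good_noise :: "nat \<Rightarrow> nat \<Rightarrow> real \<Rightarrow> noise set" where
  "good_noise K T A = {Z \<in> space (noise_space K T). \<forall>x\<in>{1..T} \<times> {1..K}. cmod (Z x) \<le> A}"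

lemma sets_good_channels:
  assumes "resolving_scheme K N T X"
  shows "good_channels K N T X A \<in> sets (channel_space K T)"
proof -
  let ?M = "channel_space K T"
  have c: "causal K i t (X t i a)" if "t \<in> {1..T}" "i \<in> {1..K}" for t i a
    using assms that by (simp add: resolving_scheme_def)
  have 1: "Measurable.pred ?M (\<lambda>H. cmod (X t i a H s) \<le> A)" if "t \<in> {1..T}" "i \<in> {1..K}" for t i a s
  proof -
    have [measurable]: "(\<lambda>H. X t i a H s) \<in> borel_measurable ?M"
      using c[OF that] that by (intro borel_measurable_causal) auto
    show ?thesis by measurable
  qed
  have 2: "Measurable.pred ?M (\<lambda>H. cmod (u k s) \<le> A * (\<Sum>t=1..T. cmod (noiseless K N X H u k t)))"
    if "k \<in> {1..K}" for u k s
  proof -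
    have "(\<lambda>H. cmod (noiseless K N X H u k t)) \<in> borel_measurable ?M" if "t \<in> {1..T}" for t
      using c[OF that] that \<open>k \<in> {1..K}\<close>
      by (rule measurable_compose[OF borel_measurable_noiseless borel_measurable_norm]) auto
    then have "(\<lambda>H. A * (\<Sum>t=1..T. cmod (noiseless K N X H u k t))) \<in> borel_measurable ?M"
      by (intro borel_measurable_times borel_measurable_const borel_measurable_sum)
    then show ?thesis unfolding pred_def by (intro borel_measurable_le borel_measurable_const)
  qed
  have "Measurable.pred ?M (\<lambda>H. \<forall>t\<in>{1..T}. \<forall>i\<in>{1..K}. \<forall>a\<in>{1..K}. \<forall>s\<in>{..<N}. cmod (X t i a H s) \<le> A)"
    by (intro pred_intros_finite 1) simp_all
  moreover have "Measurable.pred ?M (\<lambda>H. \<forall>u\<in>lattice_vectors K N. \<forall>k\<in>{1..K}. \<forall>s\<in>{..<N}.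
      cmod (u k s) \<le> A * (\<Sum>t=1..T. cmod (noiseless K N X H u k t)))"
  proof -
    \<comment> \<open>The zero vector makes the countable set nonempty, hence the range of a
      sequence.\<close>
    have "(\<lambda>_ _. 0) \<in> lattice_vectors K N"
      by (rule lattice_vectorsI) (auto simp: gaussian_ints_def image_iff complex_eq_iff intro!: exI[of _ 0])
    then have "lattice_vectors K N = range (from_nat_into (lattice_vectors K N))"
      using range_from_nat_into[OF _ countable_lattice_vectors] by blast
    then obtain f :: "nat \<Rightarrow> nat \<Rightarrow> nat \<Rightarrow> complex" where f: "lattice_vectors K N = range f" ..
    have "Measurable.pred ?M (\<lambda>H. \<forall>n. \<forall>k\<in>{1..K}. \<forall>s\<in>{..<N}.
        cmod (f n k s) \<le> A * (\<Sum>t=1..T. cmod (noiseless K N X H (f n) k t)))"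
      by (intro pred_intros_countable pred_intros_finite 2) simp_all
    then show ?thesis unfolding f by simp
  qed
  ultimately show ?thesis unfolding good_channels_def pred_def[symmetric] by (rule pred_intros_logic)
qed

lemma sets_good_noise: "good_noise K T A \<in> sets (noise_space K T)"
proof -
  have "Measurable.pred (noise_space K T) (\<lambda>Z. cmod (Z x) \<le> A)" if "x \<in> {1..T} \<times> {1..K}" for x
  proof -
    have [measurable]: "(\<lambda>Z. Z x) \<in> borel_measurable (noise_space K T)"
      using measurable_component_singleton[OF that, of "\<lambda>_. complex_gaussian"]
      by (simp add: noise_space_def cong: measurable_cong_sets)
    show ?thesis by measurable
  qed
  then have "Measurable.pred (noise_space K T) (\<lambda>Z. \<forall>x\<in>{1..T} \<times> {1..K}. cmod (Z x) \<le> A)"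
    by (intro pred_intros_finite) auto
  then show ?thesis unfolding good_noise_def by (simp only: pred_def)
qed

lemma good_channels_mono: "A \<le> A' \<Longrightarrow> good_channels K N T X A \<subseteq> good_channels K N T X A'"
proof
  fix H assume A: "A \<le> A'" and H: "H \<in> good_channels K N T X A"
  have mono: "A * (\<Sum>t=1..T. cmod (noiseless K N X H u k t)) \<le> A' * (\<Sum>t=1..T. cmod (noiseless K N X H u k t))" for u k
    by (intro mult_right_mono A sum_nonneg norm_ge_zero)
  show "H \<in> good_channels K N T X A'"
    unfolding good_channels_def
  proof (intro CollectI conjI ballI)
    fix t i a s assume "t \<in> {1..T}" "i \<in> {1..K}" "a \<in> {1..K}" "s \<in> {..<N}"
    then have "cmod (X t i a H s) \<le> A" using H by (simp add: good_channels_def)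
    then show "cmod (X t i a H s) \<le> A'" using A by (rule order_trans)
  next
    fix u k s assume "u \<in> lattice_vectors K N" "k \<in> {1..K}" "s \<in> {..<N}"
    then have "cmod (u k s) \<le> A * (\<Sum>t=1..T. cmod (noiseless K N X H u k t))"
      using H by (simp add: good_channels_def)
    then show "cmod (u k s) \<le> A' * (\<Sum>t=1..T. cmod (noiseless K N X H u k t))"
      using mono by (rule order_trans)
  qed (use H in \<open>simp add: good_channels_def\<close>)
qed

lemma good_noise_mono: "A \<le> A' \<Longrightarrow> good_noise K T A \<subseteq> good_noise K T A'"
  unfolding good_noise_def by (auto intro: order_trans)

text \<open>For generic channels, zero forcing bounds each of the finitely many symbols by a
  multiple of the received values. One integer above all these constants and above all coefficients
  of the scheme serves.\<close>

lemma ex_good_channels: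
  assumes X: "resolving_scheme K N T X" and gen: "\<forall>t\<in>{1..T}. generic_slot K t H"
    and H: "H \<in> space (channel_space K T)"
  shows "\<exists>n::nat. H \<in> good_channels K N T X (real n)"
proof -
  have "\<exists>C\<ge>0. \<forall>u. cmod (u k s) \<le> C * (\<Sum>t\<in>{1..T}. cmod (noiseless K N X H u k t))"
    if "k \<in> {1..K}" "s < N" for k s
  proof (rule linear_functional_bound)
    fix u :: "nat \<Rightarrow> nat \<Rightarrow> complex"
    assume "\<And>t. t \<in> {1..T} \<Longrightarrow> noiseless K N X H u k t = 0"
    then show "u k s = 0" using X gen that unfolding resolving_scheme_def by blast
  qed (simp_all add: noiseless_add_scaled)
  then have "\<forall>x\<in>{1..K} \<times> {..<N}. \<exists>C. \<forall>u. cmod (u (fst x) (snd x)) \<le> C * (\<Sum>t\<in>{1..T}. cmod (noiseless K N X H u (fst x) t))"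
    by (intro ballI) (metis lessThan_iff mem_Times_iff)
  from bchoice[OF this] obtain C where "\<forall>x\<in>{1..K} \<times> {..<N}. \<forall>u.
      cmod (u (fst x) (snd x)) \<le> C x * (\<Sum>t\<in>{1..T}. cmod (noiseless K N X H u (fst x) t))" ..
  note C' = bspec[OF this]
  have C: "cmod (u k s) \<le> C (k, s) * (\<Sum>t\<in>{1..T}. cmod (noiseless K N X H u k t))"
    if "k \<in> {1..K}" "s < N" for k s u
    using C'[of "(k, s)"] that by simp
  define S where "S = C ` ({1..K} \<times> {..<N}) \<union>
    (\<lambda>(t, i, a, s). cmod (X t i a H s)) ` ({1..T} \<times> {1..K} \<times> {1..K} \<times> {..<N})"
  have "finite S" by (simp add: S_def)
  then obtain B where B: "\<And>x. x \<in> S \<Longrightarrow> x \<le> B" using bdd_above_finite[of S] by (auto simp: bdd_above_def)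
  obtain n :: nat where "B \<le> real n" using real_arch_simple by blast
  then have n: "x \<le> real n" if "x \<in> S" for x using B[OF that] by simp
  have "cmod (X t i a H s) \<le> real n" if "t \<in> {1..T}" "i \<in> {1..K}" "a \<in> {1..K}" "s < N" for t i a s
    using that by (intro n) (force simp: S_def)
  moreover have "cmod (u k s) \<le> real n * (\<Sum>t=1..T. cmod (noiseless K N X H u k t))"
    if "k \<in> {1..K}" "s < N" for u k s
    using that by (intro order_trans[OF C[OF that]] mult_right_mono n sum_nonneg) (auto simp: S_def)
  ultimately have "H \<in> good_channels K N T X (real n)"
    using H unfolding good_channels_def by (intro CollectI conjI ballI) (simp_all only: lessThan_iff)
  then show ?thesis ..
qed

lemma (in prob_space) prob_complement_incseq_less:
  assumes "incseq G" "range G \<subseteq> sets M" "AE x in M. \<exists>n. x \<in> G n" "0 < (p::real)"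
  shows "\<exists>n. \<forall>m\<ge>n. prob (space M - G m) < p"
proof -
  have G: "G n \<in> sets M" for n using assms(2) by auto
  have "(\<lambda>n. prob (G n)) \<longlonglongrightarrow> prob (\<Union>n. G n)" using assms(1,2) by (intro finite_Lim_measure_incseq) auto
  also have "prob (\<Union>n. G n) = 1" using assms(2,3) by (subst prob_eq_1) auto
  finally have "(\<lambda>n. 1 - prob (G n)) \<longlonglongrightarrow> 1 - 1" by (intro tendsto_intros)
  then have "eventually (\<lambda>n. 1 - prob (G n) < p) sequentially" using assms(4) by (intro order_tendstoD) auto
  then obtain n where "\<And>m. m \<ge> n \<Longrightarrow> 1 - prob (G m) < p" by (auto simp: eventually_sequentially)
  then show ?thesis using prob_compl[OF G] by auto
qed

lemma prob_space_channel_space: "prob_space (channel_space K n)"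
  unfolding channel_space_def by (intro prob_space_PiM prob_space_complex_gaussian)

lemma prob_space_noise_space: "prob_space (noise_space K n)"
  unfolding noise_space_def by (intro prob_space_PiM prob_space_complex_gaussian)

text \<open>Continuity from below along integer thresholds. The threshold depends on the scheme and
  on \<open>p\<close>, never on the transmit power.\<close>

lemma ex_good_probability:
  assumes X: "resolving_scheme K N T X" and "0 < p"
  shows "\<exists>A>0. measure (channel_space K T) (space (channel_space K T) - good_channels K N T X A) < p \<and>
    measure (noise_space K T) (space (noise_space K T) - good_noise K T A) < p"
proof -
  interpret H: prob_space "channel_space K T" by (rule prob_space_channel_space)
  interpret Z: prob_space "noise_space K T" by (rule prob_space_noise_space)
  have "AE H in channel_space K T. \<exists>n. H \<in> good_channels K N T X (real n)"
    using AE_generic_slot AE_space by eventually_elim (rule ex_good_channels[OF X])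
  then obtain n1 where n1: "\<And>m. m \<ge> n1 \<Longrightarrow>
      H.prob (space (channel_space K T) - good_channels K N T X (real m)) < p"
    using H.prob_complement_incseq_less[of "\<lambda>n. good_channels K N T X (real n)" p] \<open>0 < p\<close>
    by (auto simp: incseq_def good_channels_mono image_subset_iff sets_good_channels[OF X])
  have "Z \<in> space (noise_space K T) \<Longrightarrow> \<exists>n. Z \<in> good_noise K T (real n)" for Z
  proof -
    assume Z: "Z \<in> space (noise_space K T)"
    obtain B where B: "\<And>x. x \<in> {1..T} \<times> {1..K} \<Longrightarrow> cmod (Z x) \<le> B"
      using bdd_above_finite[of "(\<lambda>x. cmod (Z x)) ` ({1..T} \<times> {1..K})"] by (auto simp: bdd_above_def)
    obtain n :: nat where "B \<le> real n" using real_arch_simple by blast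
    then have "Z \<in> good_noise K T (real n)" using Z B by (auto simp: good_noise_def intro: order_trans)
    then show ?thesis ..
  qed
  then have "AE Z in noise_space K T. \<exists>n. Z \<in> good_noise K T (real n)" by (intro AE_I2)
  then obtain n2 where n2: "\<And>m. m \<ge> n2 \<Longrightarrow>
      Z.prob (space (noise_space K T) - good_noise K T (real m)) < p"
    using Z.prob_complement_incseq_less[of "\<lambda>n. good_noise K T (real n)" p] \<open>0 < p\<close>
    by (auto simp: incseq_def good_noise_mono image_subset_iff sets_good_noise)
  show ?thesis using n1[of "max 1 (max n1 n2)"] n2[of "max 1 (max n1 n2)"]
    by (intro exI[of _ "real (max 1 (max n1 n2))"]) auto
qed

text \<open>Union bound over the sets of \<open>r\<close> blocks: there are at most
  \<open>2 ^ B\<close> of them, and by independence each contributes the \<open>r\<close>-th power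
  of the probability of one bad block.\<close>

lemma measure_many_bad_blocks:
  fixes \<iota> :: "nat \<Rightarrow> 'x \<Rightarrow> 'y" and \<mu> :: "'c measure"
  assumes \<mu>: "prob_space \<mu>"
    and inj: "inj_on (\<lambda>(b, x). \<iota> b x) ({..<B} \<times> I)"
    and I': "\<And>b x. b < B \<Longrightarrow> x \<in> I \<Longrightarrow> \<iota> b x \<in> I'"
    and G: "G \<in> sets (PiM I (\<lambda>_. \<mu>))" and ne: "I \<noteq> {}"
  shows "measure (PiM I' (\<lambda>_. \<mu>)) {\<omega> \<in> space (PiM I' (\<lambda>_. \<mu>)). r < card {b\<in>{..<B}. (\<lambda>x\<in>I. \<omega> (\<iota> b x)) \<notin> G}}
    \<le> 2 ^ B * measure (PiM I (\<lambda>_. \<mu>)) (space (PiM I (\<lambda>_. \<mu>)) - G) ^ r"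
proof -
  let ?M' = "PiM I' (\<lambda>_. \<mu>)" and ?M = "PiM I (\<lambda>_. \<mu>)"
  let ?blk = "\<lambda>b \<omega>. \<lambda>x\<in>I. \<omega> (\<iota> b x)"
  let ?E = "space ?M - G"
  interpret prob_space ?M' by (intro prob_space_PiM \<mu>)
  define \<S> where "\<S> = {S. S \<subseteq> {..<B} \<and> card S = r}"
  have fin: "finite \<S>" by (rule finite_subset[of _ "Pow {..<B}"]) (auto simp: \<S>_def)
  have blk: "?blk b \<in> ?M' \<rightarrow>\<^sub>M ?M" if "b < B" for b
    using that by (intro measurable_restrict measurable_component_singleton I')
  define F where "F = (\<lambda>S. {\<omega> \<in> space ?M'. \<forall>b\<in>S. ?blk b \<omega> \<in> ?E})"
  have F: "F S \<in> sets ?M'" if "S \<in> \<S>" for S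
  proof -
    have S: "S \<subseteq> {..<B}" "finite S" using that by (auto simp: \<S>_def intro: finite_subset)
    have "{\<omega> \<in> space ?M'. ?blk b \<omega> \<in> ?E} \<in> sets ?M'" if "b \<in> S" for b
      using measurable_sets[OF blk, of b ?E] G S that by (auto simp: vimage_def Int_def conj_commute)
    then have "{\<omega> \<in> space ?M'. \<forall>b\<in>S. ?blk b \<omega> \<in> ?E} \<in> sets ?M'"
      using S(2) by (intro sets.sets_Collect_finite_All) auto
    then show ?thesis by (simp add: F_def)
  qed
  have sub: "{\<omega> \<in> space ?M'. r < card {b\<in>{..<B}. ?blk b \<omega> \<notin> G}} \<subseteq> (\<Union>S\<in>\<S>. F S)"
  proof
    fix \<omega> assume \<omega>: "\<omega> \<in> {\<omega> \<in> space ?M'. r < card {b\<in>{..<B}. ?blk b \<omega> \<notin> G}}"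
    then obtain S where S: "S \<subseteq> {b\<in>{..<B}. ?blk b \<omega> \<notin> G}" "card S = r"
      using obtain_subset_with_card_n[of r "{b\<in>{..<B}. ?blk b \<omega> \<notin> G}"] by auto
    have "?blk b \<omega> \<in> ?E" if "b \<in> S" for b
      using measurable_space[OF blk, of b \<omega>] S \<omega> that by auto
    then have "\<omega> \<in> F S" using \<omega> by (simp add: F_def)
    moreover have "S \<in> \<S>" using S by (auto simp: \<S>_def)
    ultimately show "\<omega> \<in> (\<Union>S\<in>\<S>. F S)" by blast
  qed
  have "prob {\<omega> \<in> space ?M'. r < card {b\<in>{..<B}. ?blk b \<omega> \<notin> G}} \<le> prob (\<Union>S\<in>\<S>. F S)"
    using F fin by (intro finite_measure_mono sub sets.finite_UN) auto
  also have "\<dots> \<le> (\<Sum>S\<in>\<S>. prob (F S))"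
    using F by (intro finite_measure_subadditive_finite fin) auto
  also have "\<dots> = (\<Sum>S\<in>\<S>. measure ?M ?E ^ r)"
  proof (rule sum.cong[OF refl])
    fix S assume "S \<in> \<S>"
    then have S: "S \<subseteq> {..<B}" "card S = r" by (auto simp: \<S>_def)
    have "?E \<in> sets ?M" using G by auto
    from measure_blocks[OF \<mu> inj I' this S(1) ne] S(2)
    show "prob (F S) = measure ?M ?E ^ r" by (simp add: F_def)
  qed
  also have "\<dots> = real (card \<S>) * measure ?M ?E ^ r" by simp
  also have "\<dots> \<le> 2 ^ B * measure ?M ?E ^ r"
  proof (rule mult_right_mono)
    have "card \<S> \<le> card (Pow {..<B})" by (rule card_mono) (auto simp: \<S>_def)
    then have "real (card \<S>) \<le> real (card (Pow {..<B}))" by (rule of_nat_mono)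
    then show "real (card \<S>) \<le> 2 ^ B" by (simp add: card_Pow)
  qed simp
  finally show ?thesis .
qed

section \<open>Grid alphabet, division into blocks, and the block code\<close>

definition grid :: "real \<Rightarrow> nat \<Rightarrow> complex set" where
  "grid \<alpha> L = (\<lambda>(a, b). Complex (\<alpha> * real a) (\<alpha> * real b)) ` ({..<L} \<times> {..<L})"

definition grid_words :: "nat \<Rightarrow> real \<Rightarrow> nat \<Rightarrow> (nat \<Rightarrow> complex) set" where
  "grid_words N \<alpha> L = PiE {..<N} (\<lambda>_. grid \<alpha> L)"

lemma finite_grid_words: "finite (grid_words N \<alpha> L)"
  unfolding grid_words_def grid_def by (intro finite_PiE) auto

lemma card_grid_words:
  assumes "\<alpha> > 0"
  shows "card (grid_words N \<alpha> L) = L ^ (2 * N)"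
proof -
  have "inj_on (\<lambda>(a, b). Complex (\<alpha> * real a) (\<alpha> * real b)) ({..<L} \<times> {..<L})"
    using assms by (auto simp: inj_on_def)
  then have "card (grid \<alpha> L) = L ^ 2"
    unfolding grid_def by (simp add: card_image card_cartesian_product power2_eq_square)
  then show ?thesis by (simp add: grid_words_def card_PiE power_mult)
qed

lemma grid_norm:
  assumes "z \<in> grid \<alpha> L" "\<alpha> > 0"
  shows "cmod z \<le> 2 * \<alpha> * real L"
proof -
  obtain a b where z: "z = Complex (\<alpha> * real a) (\<alpha> * real b)" "a < L" "b < L"
    using assms(1) by (auto simp: grid_def)
  have "cmod z \<le> \<alpha> * real a + \<alpha> * real b"
    using cmod_le[of z] assms(2) by (simp add: z(1) abs_mult)
  also have "\<dots> \<le> \<alpha> * real L + \<alpha> * real L"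
    using z assms(2) by (intro add_mono mult_left_mono) auto
  finally show ?thesis by simp
qed

lemma grid_diff:
  assumes "z \<in> grid \<alpha> L" "z' \<in> grid \<alpha> L" "\<alpha> > 0"
  shows "(z - z') / of_real \<alpha> \<in> gaussian_ints"
proof -
  obtain a b a' b' where "z = Complex (\<alpha> * real a) (\<alpha> * real b)" "z' = Complex (\<alpha> * real a') (\<alpha> * real b')"
    using assms(1,2) by (auto simp: grid_def)
  then have "(z - z') / of_real \<alpha> = (\<lambda>(a, b). Complex (real_of_int a) (real_of_int b)) (int a - int a', int b - int b')"
    using assms(3) by (simp add: complex_eq_iff diff_divide_distrib)
  then show ?thesis unfolding gaussian_ints_def by (rule range_eqI)
qed

definition channel_block :: "nat \<Rightarrow> nat \<Rightarrow> nat \<Rightarrow> channel \<Rightarrow> channel" where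
  "channel_block K T b H = (\<lambda>x\<in>channel_index K T. H (case x of (t, x') \<Rightarrow> (b * T + t, x')))"

definition noise_block :: "nat \<Rightarrow> nat \<Rightarrow> nat \<Rightarrow> noise \<Rightarrow> noise" where
  "noise_block K T b Z = (\<lambda>x\<in>{1..T} \<times> {1..K}. Z (case x of (t, k) \<Rightarrow> (b * T + t, k)))"

lemma slot_in_blocks:
  fixes b B t T :: nat
  assumes "b < B" "t \<in> {1..T}"
  shows "b * T + t \<in> {1..B * T}"
proof -
  have "Suc b * T \<le> B * T" using assms by (intro mult_le_mono1) simp
  then show ?thesis using assms by auto
qed

lemma slot_div_mod:
  fixes b t T :: nat
  assumes "t \<in> {1..T}"
  shows "(b * T + t - 1) div T = b" "Suc ((b * T + t - 1) mod T) = t"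
proof -
  obtain t' where "t = Suc t'" "t' < T" using assms by (cases t) auto
  then show "(b * T + t - 1) div T = b" "Suc ((b * T + t - 1) mod T) = t" by simp_all
qed

lemma slot_inj:
  fixes b t T :: nat
  assumes "t \<in> {1..T}" "t' \<in> {1..T}" "b * T + t = b' * T + t'"
  shows "b = b' \<and> t = t'"
  using slot_div_mod[OF assms(1), of b] slot_div_mod[OF assms(2), of b'] assms(3) by metis

text \<open>A channel that a transmitter can assemble from its own past: the transmitter index
  \<open>j\<close> is ignored and the slots are shifted into block \<open>b\<close>. It agrees with
  the true block on everything that a causal symbol of this transmitter may look at.\<close>

definition lift_past :: "nat \<Rightarrow> nat \<Rightarrow> (nat \<times> nat \<times> nat \<Rightarrow> complex) \<Rightarrow> channel" where
  "lift_past T b g = (\<lambda>(t, k, j, a). g (b * T + t, k, a))"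

text \<open>The words of the other users are quantified existentially: the block has to be explained
  jointly, but only component \<open>k\<close> is prescribed.\<close>

definition consistent :: "nat \<Rightarrow> nat \<Rightarrow> nat \<Rightarrow> (nat \<Rightarrow> nat \<Rightarrow> nat \<Rightarrow> symbol) \<Rightarrow> real \<Rightarrow> real \<Rightarrow> nat \<Rightarrow>
    nat \<Rightarrow> nat \<Rightarrow> (nat \<Rightarrow> complex) \<Rightarrow> (nat \<Rightarrow> complex) \<Rightarrow> channel \<Rightarrow> bool" where
  "consistent K N T X A \<alpha> L k b x y H \<longleftrightarrow>
     (\<exists>v\<in>PiE {1..K} (\<lambda>_. grid_words N \<alpha> L). v k = x \<and>
        (\<forall>s\<in>{1..T}. cmod (y (b * T + s) - noiseless K N X (channel_block K T b H) v k s) \<le> A))"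

text \<open>The transmitters replace a symbol that would break the power constraint by \<open>0\<close>. The receiver
  accepts a message if all but \<open>2 r\<close> blocks could be explained by it with noise at most \<open>A\<close>.\<close>

definition block_code :: "nat \<Rightarrow> nat \<Rightarrow> nat \<Rightarrow> (nat \<Rightarrow> nat \<Rightarrow> nat \<Rightarrow> symbol) \<Rightarrow> real \<Rightarrow> real \<Rightarrow> nat \<Rightarrow>
    real \<Rightarrow> nat \<Rightarrow> nat \<Rightarrow> nat \<Rightarrow> (nat \<Rightarrow> nat \<Rightarrow> nat \<Rightarrow> complex) \<Rightarrow> ic_code" where
  "block_code K N T X A \<alpha> L P B r m cw =
     \<lparr>blocklength = B * T, num_msgs = (\<lambda>_. m),
      encode = (\<lambda>k t w g a.
        let b = (t - 1) div T; x = symbol_value N (X (Suc ((t - 1) mod T)) k a) (lift_past T b g) (cw w b)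
        in if real K * (cmod x)\<^sup>2 \<le> P then x else 0),
      decode = (\<lambda>k (y, H). LEAST w. w < m \<and>
        (\<exists>R\<in>{R. R \<subseteq> {..<B} \<and> card R \<le> 2 * r}. \<forall>b\<in>{..<B} - R.
           consistent K N T X A \<alpha> L k b (cw w b) y H))\<rparr>"

lemma sets_channel_space: "sets (channel_space K n) = sets (\<Pi>\<^sub>M i\<in>channel_index K n. borel)"
  unfolding channel_space_def by (rule sets_PiM_cong) simp_all

lemma measurable_channel_block:
  assumes "b < B"
  shows "channel_block K T b \<in> (\<Pi>\<^sub>M i\<in>channel_index K (B * T). borel) \<rightarrow>\<^sub>M channel_space K T"
proof -
  have "channel_block K T b \<in> (\<Pi>\<^sub>M i\<in>channel_index K (B * T). borel) \<rightarrow>\<^sub>M (\<Pi>\<^sub>M i\<in>channel_index K T. borel)"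
    unfolding channel_block_def
    using slot_in_blocks[OF assms, of _ T]
    by (intro measurable_restrict measurable_component_singleton) (auto simp: channel_index_def)
  then show ?thesis by (simp add: sets_channel_space cong: measurable_cong_sets)
qed

lemma past_local_lift_past:
  "past_local K k s (lift_past T b g) = (\<lambda>(u, j, a)\<in>past_index K s. g (b * T + u, j, a))"
  by (auto simp: past_local_def lift_past_def)

lemma past_local_channel_block:
  assumes "s \<le> T + 1" "k \<in> {1..K}"
  shows "past_local K k s (channel_block K T b H) = past_local K k s (lift_past T b (past_local K k (b * T + s) H))"
  unfolding past_local_lift_past
  using assms by (auto simp: past_local_def channel_block_def past_index_def channel_index_def restrict_def fun_eq_iff)

lemma causal_cong:
  assumes "causal K i t \<sigma>" "past_local K i t H = past_local K i t H'"
  shows "symbol_value N \<sigma> H u = symbol_value N \<sigma> H' u"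
proof -
  have "\<sigma> H s = \<sigma> H' s" for s
    using assms unfolding causal_def delayed_local_def by metis
  then show ?thesis by (simp add: symbol_value_def)
qed

text \<open>The constants: two explanations of one block differ by at most \<open>2 * A\<close> in
  each of \<open>T\<close> slots, so zero forcing bounds symbol differences by
  \<open>2 * T * A\<^sup>2\<close>, less than the grid spacing \<open>\<alpha>\<close>. The
  assumption \<open>power\<close> makes the truncation in the encoder inactive on good blocks. A
  distance above \<open>4 * r\<close> allows for \<open>2 * r\<close> blocks discarded by the
  receiver and \<open>2 * r\<close> bad ones.\<close>

locale block_coding =
  fixes K N T :: nat and X :: "nat \<Rightarrow> nat \<Rightarrow> nat \<Rightarrow> symbol" and A \<alpha> P :: real
    and L B r m :: nat and cw :: "nat \<Rightarrow> nat \<Rightarrow> nat \<Rightarrow> complex"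
  assumes K: "1 \<le> K" and T: "0 < T" and scheme: "resolving_scheme K N T X"
    and A: "0 < A" and \<alpha>: "2 * real T * A\<^sup>2 < \<alpha>"
    and power: "real K * (real N * (A * (2 * \<alpha> * real L)))\<^sup>2 \<le> P"
    and m: "1 \<le> m"
    and words: "\<And>w b. w < m \<Longrightarrow> b < B \<Longrightarrow> cw w b \<in> grid_words N \<alpha> L"
    and dist: "\<And>w w'. w < m \<Longrightarrow> w' < m \<Longrightarrow> w \<noteq> w' \<Longrightarrow> 4 * r < card {b\<in>{..<B}. cw w b \<noteq> cw w' b}"
begin

abbreviation "code \<equiv> block_code K N T X A \<alpha> L P B r m cw"

lemma \<alpha>_pos: "0 < \<alpha>"
  using \<alpha> by (rule le_less_trans[rotated]) simp

lemma P_nonneg: "0 \<le> P"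
  using power by (rule order_trans[rotated]) simp

lemma causal_X: "t \<in> {1..T} \<Longrightarrow> i \<in> {1..K} \<Longrightarrow> causal K i t (X t i a)"
  using scheme by (simp add: resolving_scheme_def)

lemma code_simps [simp]: "blocklength code = B * T" "num_msgs code = (\<lambda>_. m)"
  by (simp_all add: block_code_def)

lemma measurable_encode:
  assumes k: "k \<in> {1..K}" and t: "t \<in> {1..B * T}"
  shows "(\<lambda>g. encode code k t w g a) \<in> borel_measurable (\<Pi>\<^sub>M i\<in>past_index K t. borel)"
proof -
  define b s where "b = (t - 1) div T" and "s = Suc ((t - 1) mod T)"
  have s: "s \<in> {1..T}" using T by (auto simp: s_def Suc_le_eq)
  have ts: "t = b * T + s" using t by (auto simp: b_def s_def)
  have "(\<lambda>g. X s k a (lift_past T b g) i) \<in> borel_measurable (\<Pi>\<^sub>M i\<in>past_index K t. borel)" for i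
  proof -
    obtain F where F: "F \<in> borel_measurable (\<Pi>\<^sub>M x\<in>past_index K s. borel)"
      "\<And>H. X s k a H i = F (past_local K k s H)"
      using causal_X[OF s k] unfolding causal_def delayed_local_def by meson
    have "(\<lambda>g. past_local K k s (lift_past T b g)) \<in> (\<Pi>\<^sub>M i\<in>past_index K t. borel) \<rightarrow>\<^sub>M (\<Pi>\<^sub>M x\<in>past_index K s. borel)"
      unfolding past_local_lift_past
    proof (rule measurable_restrict, clarify)
      fix u j c assume "(u, j, c) \<in> past_index K s"
      then have "(b * T + u, j, c) \<in> past_index K t" by (auto simp: past_index_def ts)
      then show "(\<lambda>g. g (b * T + u, j, c)) \<in> borel_measurable (\<Pi>\<^sub>M i\<in>past_index K t. borel)"
        by (rule measurable_component_singleton)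
    qed
    from measurable_compose[OF this F(1)] show ?thesis by (simp add: F(2))
  qed
  then have "(\<lambda>g. symbol_value N (X s k a) (lift_past T b g) (cw w b)) \<in> borel_measurable (\<Pi>\<^sub>M i\<in>past_index K t. borel)"
    unfolding symbol_value_def by (intro borel_measurable_sum borel_measurable_times borel_measurable_const)
  then have "(\<lambda>g. if real K * (cmod (symbol_value N (X s k a) (lift_past T b g) (cw w b)))\<^sup>2 \<le> P
      then symbol_value N (X s k a) (lift_past T b g) (cw w b) else 0) \<in> borel_measurable (\<Pi>\<^sub>M i\<in>past_index K t. borel)"
    by measurable
  then show ?thesis unfolding block_code_def ic_code.simps Let_def b_def[symmetric] s_def[symmetric] .
qed

text \<open>Candidate words, competing tuples and discarded sets of blocks are finite in number, so
  the decoder tests a finite Boolean combination of measurable inequalities.\<close>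

lemma measurable_decode:
  assumes k: "k \<in> {1..K}"
  shows "decode code k \<in> (\<Pi>\<^sub>M t\<in>{1..B * T}. borel) \<Otimes>\<^sub>M (\<Pi>\<^sub>M i\<in>channel_index K (B * T). borel) \<rightarrow>\<^sub>M count_space UNIV"
proof -
  let ?M = "(\<Pi>\<^sub>M t\<in>{1..B * T}. borel :: complex measure) \<Otimes>\<^sub>M (\<Pi>\<^sub>M i\<in>channel_index K (B * T). borel :: complex measure)"
  have pred: "Measurable.pred ?M (\<lambda>z. consistent K N T X A \<alpha> L k b x (fst z) (snd z))" if b: "b < B" for b x
  proof -
    have "Measurable.pred ?M (\<lambda>z. cmod (fst z (b * T + s) - noiseless K N X (channel_block K T b (snd z)) v k s) \<le> A)"
      if s: "s \<in> {1..T}" for s v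
    proof -
      have "(\<lambda>y. y (b * T + s)) \<in> borel_measurable (\<Pi>\<^sub>M t\<in>{1..B * T}. borel :: complex measure)"
        using slot_in_blocks[OF b s] by (rule measurable_component_singleton)
      then have y: "(\<lambda>z. fst z (b * T + s)) \<in> borel_measurable ?M"
        by (rule measurable_compose[OF measurable_fst])
      have "(\<lambda>H. noiseless K N X H v k s) \<in> borel_measurable (channel_space K T)"
        using s k causal_X by (intro borel_measurable_noiseless) auto
      from measurable_compose[OF measurable_snd measurable_compose[OF measurable_channel_block[OF b] this]]
      have "(\<lambda>z. noiseless K N X (channel_block K T b (snd z)) v k s) \<in> borel_measurable ?M" .
      from measurable_compose[OF borel_measurable_diff[OF y this] borel_measurable_norm]
      show ?thesis unfolding pred_def by (intro borel_measurable_le borel_measurable_const)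
    qed
    moreover have "finite (PiE {1..K} (\<lambda>_. grid_words N \<alpha> L))"
      by (intro finite_PiE finite_grid_words) auto
    ultimately show ?thesis unfolding consistent_def
      by (intro pred_intros_finite pred_intros_logic measurable_const) auto
  qed
  have "finite {R. R \<subseteq> {..<B} \<and> card R \<le> 2 * r}" by (rule finite_subset[of _ "Pow {..<B}"]) auto
  then have "Measurable.pred ?M (\<lambda>z. w < m \<and>
        (\<exists>R\<in>{R. R \<subseteq> {..<B} \<and> card R \<le> 2 * r}. \<forall>b\<in>{..<B} - R.
           consistent K N T X A \<alpha> L k b (cw w b) (fst z) (snd z)))" for w
    by (intro pred_intros_finite pred_intros_logic measurable_const pred) auto
  then have "(\<lambda>z. LEAST w. w < m \<and>
        (\<exists>R\<in>{R. R \<subseteq> {..<B} \<and> card R \<le> 2 * r}. \<forall>b\<in>{..<B} - R.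
           consistent K N T X A \<alpha> L k b (cw w b) (fst z) (snd z))) \<in> ?M \<rightarrow>\<^sub>M count_space UNIV"
    by (rule measurable_Least)
  moreover have "decode code k = (\<lambda>z. LEAST w. w < m \<and>
        (\<exists>R\<in>{R. R \<subseteq> {..<B} \<and> card R \<le> 2 * r}. \<forall>b\<in>{..<B} - R.
           consistent K N T X A \<alpha> L k b (cw w b) (fst z) (snd z)))"
    by (simp only: block_code_def ic_code.simps case_prod_beta')
  ultimately show ?thesis by (simp only:)
qed

lemma measurable_code: "measurable_code K code"
  unfolding measurable_code_def using m measurable_encode measurable_decode by simp

text \<open>The truncation bounds the squared modulus on every antenna by \<open>P / K\<close> for
  every realization, so the expectation needs no estimate.\<close>

lemma power_constraint: "power_constraint K P code"
  unfolding power_constraint_def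
proof (intro ballI)
  fix k t assume "k \<in> {1..K}" "t \<in> {1..blocklength code}"
  interpret prob_space "code_space K code" by (rule prob_space_code_space[OF measurable_code])
  have "(\<Sum>a=1..K. (cmod (transmitted K code W H k t a))\<^sup>2) \<le> P" for W H
  proof -
    have "(cmod (transmitted K code W H k t a))\<^sup>2 \<le> P / real K" for a
      using K P_nonneg by (auto simp: transmitted_def block_code_def Let_def field_simps)
    then have "(\<Sum>a=1..K. (cmod (transmitted K code W H k t a))\<^sup>2) \<le> (\<Sum>a=1..K. P / real K)"
      by (rule sum_mono)
    also have "\<dots> = P" using K by simp
    finally show ?thesis .
  qed
  then have "(\<integral>\<^sup>+(W, H, Z). ennreal (\<Sum>a=1..K. (cmod (transmitted K code W H k t a))\<^sup>2) \<partial>code_space K code)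
      \<le> (\<integral>\<^sup>+_. ennreal P \<partial>code_space K code)"
    by (intro nn_integral_mono) (auto intro!: ennreal_leI split: prod.splits)
  also have "\<dots> = ennreal P" using emeasure_space_1 by simp
  finally show "(\<integral>\<^sup>+(W, H, Z). ennreal (\<Sum>a=1..K. (cmod (transmitted K code W H k t a))\<^sup>2) \<partial>code_space K code)
      \<le> ennreal P" .
qed

lemma transmitted_block:
  assumes k: "k \<in> {1..K}" and a: "a \<in> {1..K}" and b: "b < B" and s: "s \<in> {1..T}" and w: "W k < m"
    and good: "channel_block K T b H \<in> good_channels K N T X A"
  shows "transmitted K code W H k (b * T + s) a = symbol_value N (X s k a) (channel_block K T b H) (cw (W k) b)"
proof -
  let ?H = "channel_block K T b H"
  let ?x = "symbol_value N (X s k a) ?H (cw (W k) b)"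
  note * = slot_div_mod[OF s, of b]
  \<comment> \<open>In slot \<open>s\<close> of block \<open>b\<close> the local past contains the
    earlier slots of the block, and these determine a symbol that is causal at
    \<open>s\<close>.\<close>
  have eq: "symbol_value N (X s k a) (lift_past T b (past_local K k (b * T + s) H)) (cw (W k) b) = ?x"
    using causal_cong[OF causal_X[OF s k] past_local_channel_block[OF _ k]] s by simp
  have "cmod ?x \<le> (\<Sum>i<N. A * (2 * \<alpha> * real L))"
    unfolding symbol_value_def
  proof (rule order_trans[OF norm_sum], rule sum_mono)
    fix i assume i: "i \<in> {..<N}"
    have "cmod (X s k a ?H i) \<le> A" using good s k a i by (simp add: good_channels_def)
    moreover have "cmod (cw (W k) b i) \<le> 2 * \<alpha> * real L"
      using words[OF w b] i \<alpha>_pos by (intro grid_norm) (auto simp: grid_words_def)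
    ultimately show "cmod (X s k a ?H i * cw (W k) b i) \<le> A * (2 * \<alpha> * real L)"
      unfolding norm_mult using A by (intro mult_mono) auto
  qed
  then have "(cmod ?x)\<^sup>2 \<le> (real N * (A * (2 * \<alpha> * real L)))\<^sup>2" by (intro power_mono) auto
  then have "real K * (cmod ?x)\<^sup>2 \<le> P" by (intro order_trans[OF _ power] mult_left_mono) auto
  then show ?thesis unfolding transmitted_def block_code_def ic_code.simps Let_def * eq by simp
qed

lemma received_block:
  assumes k: "k \<in> {1..K}" and b: "b < B" and s: "s \<in> {1..T}" and w: "\<And>j. j \<in> {1..K} \<Longrightarrow> W j < m"
    and good: "channel_block K T b H \<in> good_channels K N T X A"
  shows "received K code W H Z k (b * T + s) =
    noiseless K N X (channel_block K T b H) (\<lambda>j. cw (W j) b) k s + Z (b * T + s, k)"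
proof -
  have "cnj (H (b * T + s, k, j, a)) * transmitted K code W H j (b * T + s) a =
      cnj (channel_block K T b H (s, k, j, a)) * symbol_value N (X s j a) (channel_block K T b H) (cw (W j) b)"
    if j: "j \<in> {1..K}" and a: "a \<in> {1..K}" for j a
  proof -
    have "channel_block K T b H (s, k, j, a) = H (b * T + s, k, j, a)"
      using j a s k by (auto simp: channel_block_def channel_index_def)
    moreover have "transmitted K code W H j (b * T + s) a = symbol_value N (X s j a) (channel_block K T b H) (cw (W j) b)"
      by (rule transmitted_block) (fact j a b s w[OF j] good)+
    ultimately show ?thesis by (simp only:)
  qed
  then show ?thesis
    unfolding received_def noiseless_def by (intro arg_cong2[of _ _ _ _ "(+)"] sum.cong refl)
qed

lemma consistent_sent:
  assumes k: "k \<in> {1..K}" and b: "b < B" and w: "\<And>j. j \<in> {1..K} \<Longrightarrow> W j < m"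
    and H: "channel_block K T b H \<in> good_channels K N T X A"
    and Z: "noise_block K T b Z \<in> good_noise K T A"
  shows "consistent K N T X A \<alpha> L k b (cw (W k) b) (\<lambda>t\<in>{1..B * T}. received K code W H Z k t) H"
  unfolding consistent_def
proof (intro bexI conjI ballI)
  let ?v = "\<lambda>j\<in>{1..K}. cw (W j) b"
  show "?v k = cw (W k) b" using k by simp
  show "?v \<in> PiE {1..K} (\<lambda>_. grid_words N \<alpha> L)" using words[OF w b] by simp
  fix s assume s: "s \<in> {1..T}"
  have "noiseless K N X (channel_block K T b H) ?v k s = noiseless K N X (channel_block K T b H) (\<lambda>j. cw (W j) b) k s"
    by (rule noiseless_cong) simp
  moreover have "cmod (noise_block K T b Z (s, k)) \<le> A" using Z s k by (simp add: good_noise_def)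
  then have "cmod (Z (b * T + s, k)) \<le> A" using s k by (simp add: noise_block_def)
  ultimately show "cmod ((\<lambda>t\<in>{1..B * T}. received K code W H Z k t) (b * T + s) -
      noiseless K N X (channel_block K T b H) ?v k s) \<le> A"
    using slot_in_blocks[OF b s] by (simp only: restrict_apply' received_block[OF k b s w H] add_diff_cancel_left')
qed

text \<open>The difference of two explanations, in units of \<open>\<alpha>\<close>, is a vector of
  Gaussian integers, to which the zero forcing bound of a good channel applies. Its entries for user
  \<open>k\<close> have modulus below 1, hence vanish.\<close>

lemma consistent_unique:
  assumes k: "k \<in> {1..K}"
    and H: "channel_block K T b H \<in> good_channels K N T X A"
    and c: "consistent K N T X A \<alpha> L k b x y H" "consistent K N T X A \<alpha> L k b x' y H"
  shows "x = x'"
proof -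
  let ?H = "channel_block K T b H"
  obtain v where v: "v \<in> PiE {1..K} (\<lambda>_. grid_words N \<alpha> L)" "v k = x"
    "\<And>s. s \<in> {1..T} \<Longrightarrow> cmod (y (b * T + s) - noiseless K N X ?H v k s) \<le> A"
    using c(1) unfolding consistent_def by blast
  obtain v' where v': "v' \<in> PiE {1..K} (\<lambda>_. grid_words N \<alpha> L)" "v' k = x'"
    "\<And>s. s \<in> {1..T} \<Longrightarrow> cmod (y (b * T + s) - noiseless K N X ?H v' k s) \<le> A"
    using c(2) unfolding consistent_def by blast
  define u where "u = (\<lambda>j s. if j \<in> {1..K} \<and> s < N then (v j s - v' j s) / of_real \<alpha> else 0)"
  have gridv: "v j s \<in> grid \<alpha> L" "v' j s \<in> grid \<alpha> L" if "j \<in> {1..K}" "s < N" for j s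
    using PiE_mem[OF v(1) that(1)] PiE_mem[OF v'(1) that(1)] that(2) by (auto simp: grid_words_def)
  have u: "u \<in> lattice_vectors K N"
    by (rule lattice_vectorsI) (auto simp: u_def intro!: grid_diff[OF gridv \<alpha>_pos])
  have diff: "noiseless K N X ?H v k t = noiseless K N X ?H v' k t + of_real \<alpha> * noiseless K N X ?H u k t" for t
    unfolding noiseless_add_scaled[symmetric] using \<alpha>_pos by (intro noiseless_cong) (auto simp: u_def)
  have small: "\<alpha> * cmod (noiseless K N X ?H u k t) \<le> 2 * A" if "t \<in> {1..T}" for t
  proof -
    have "\<alpha> * cmod (noiseless K N X ?H u k t) = cmod (of_real \<alpha> * noiseless K N X ?H u k t)"
      using \<alpha>_pos by (simp add: norm_mult)
    also have "of_real \<alpha> * noiseless K N X ?H u k t =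
        (y (b * T + t) - noiseless K N X ?H v' k t) - (y (b * T + t) - noiseless K N X ?H v k t)"
      by (simp add: diff)
    also have "cmod \<dots> \<le> A + A"
      by (rule order_trans[OF norm_triangle_ineq4]) (intro add_mono v v' that)
    finally show ?thesis by simp
  qed
  have "u k s = 0" if s: "s < N" for s
  proof (rule gaussian_ints_norm_less_1)
    show "u k s \<in> gaussian_ints" unfolding u_def using grid_diff[OF gridv \<alpha>_pos] k s by simp
    have "\<alpha> * cmod (u k s) \<le> \<alpha> * (A * (\<Sum>t=1..T. cmod (noiseless K N X ?H u k t)))"
      using H u k s \<alpha>_pos by (intro mult_left_mono) (simp_all add: good_channels_def)
    also have "\<dots> = A * (\<Sum>t=1..T. \<alpha> * cmod (noiseless K N X ?H u k t))"
      by (simp add: sum_distrib_left mult_ac)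
    also have "\<dots> \<le> A * (\<Sum>t=1..T. 2 * A)" using A small by (intro mult_left_mono sum_mono) auto
    also have "\<dots> = 2 * real T * A\<^sup>2" by (simp add: power2_eq_square)
    also have "\<dots> < \<alpha> * 1" using \<alpha> by simp
    finally show "cmod (u k s) < 1" using \<alpha>_pos by (simp only: mult_less_cancel_left_pos)
  qed
  then have "v k s = v' k s" if "s < N" for s using that k \<alpha>_pos by (simp add: u_def)
  moreover note PiE_mem[OF v(1) k] PiE_mem[OF v'(1) k]
  ultimately have "v k = v' k" unfolding grid_words_def by (intro PiE_ext[of "v k" "{..<N}"]) auto
  then show ?thesis using v v' by simp
qed

text \<open>Off the at most \<open>2 * r\<close> bad blocks the sent words are consistent. A second
  accepted message would agree with the sent one outside these blocks and the at most
  \<open>2 * r\<close> blocks discarded for it, contradicting the distance.\<close>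

lemma decode_correct:
  assumes k: "k \<in> {1..K}" and w: "\<And>j. j \<in> {1..K} \<Longrightarrow> W j < m"
    and H: "card {b\<in>{..<B}. channel_block K T b H \<notin> good_channels K N T X A} \<le> r"
    and Z: "card {b\<in>{..<B}. noise_block K T b Z \<notin> good_noise K T A} \<le> r"
  shows "decode code k (\<lambda>t\<in>{1..B * T}. received K code W H Z k t, H) = W k"
proof -
  let ?y = "\<lambda>t\<in>{1..B * T}. received K code W H Z k t"
  define D where "D = {b\<in>{..<B}. channel_block K T b H \<notin> good_channels K N T X A} \<union>
    {b\<in>{..<B}. noise_block K T b Z \<notin> good_noise K T A}"
  have D: "D \<subseteq> {..<B}" "card D \<le> 2 * r"
    unfolding D_def using card_Un_le[of "{b\<in>{..<B}. channel_block K T b H \<notin> good_channels K N T X A}"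
      "{b\<in>{..<B}. noise_block K T b Z \<notin> good_noise K T A}"] H Z by auto
  let ?ok = "\<lambda>w. w < m \<and> (\<exists>R\<in>{R. R \<subseteq> {..<B} \<and> card R \<le> 2 * r}. \<forall>b\<in>{..<B} - R.
    consistent K N T X A \<alpha> L k b (cw w b) ?y H)"
  have sent: "consistent K N T X A \<alpha> L k b (cw (W k) b) ?y H" if "b \<in> {..<B} - D" for b
    using that by (intro consistent_sent[OF k _ w]) (auto simp: D_def)
  have ok_sent: "?ok (W k)" using w[OF k] D sent by blast
  have unique: "w' = W k" if ok: "?ok w'" for w'
  proof (rule ccontr)
    assume ne: "w' \<noteq> W k"
    obtain R where R: "R \<subseteq> {..<B}" "card R \<le> 2 * r"
      "\<And>b. b \<in> {..<B} - R \<Longrightarrow> consistent K N T X A \<alpha> L k b (cw w' b) ?y H" using ok by auto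
    have "cw w' b = cw (W k) b" if "b \<in> {..<B}" "b \<notin> R \<union> D" for b
      using that by (intro consistent_unique[OF k _ R(3) sent]) (auto simp: D_def)
    then have "{b\<in>{..<B}. cw w' b \<noteq> cw (W k) b} \<subseteq> R \<union> D" by blast
    moreover have "finite (R \<union> D)" using R(1) D(1) by (auto intro: finite_subset)
    ultimately have "card {b\<in>{..<B}. cw w' b \<noteq> cw (W k) b} \<le> card (R \<union> D)" by (rule card_mono[rotated])
    also have "\<dots> \<le> 4 * r" using card_Un_le[of R D] R(2) D(2) by simp
    finally show False using dist[OF _ w[OF k] ne] ok by simp
  qed
  have "(LEAST w. ?ok w) = W k"
  proof (rule Least_equality)
    show "?ok (W k)" by (rule ok_sent)
  next
    fix w' assume "?ok w'"
    then have "w' = W k" by (rule unique)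
    then show "W k \<le> w'" by simp
  qed
  then show ?thesis by (simp add: block_code_def)
qed

end

section \<open>Error probability and rates\<close>

text \<open>Rewriting the count as the existence of a large subset gives a finite union of finite
  intersections.\<close>

lemma sets_card_greater:
  assumes "finite I" "\<And>i. i \<in> I \<Longrightarrow> {\<omega> \<in> space M. Q i \<omega>} \<in> sets M"
  shows "{\<omega> \<in> space M. r < card {i\<in>I. Q i \<omega>}} \<in> sets M"
proof -
  have "{\<omega> \<in> space M. r < card {i\<in>I. Q i \<omega>}} = {\<omega> \<in> space M. \<exists>S\<in>{S. S \<subseteq> I \<and> r < card S}. \<forall>i\<in>S. Q i \<omega>}"
  proof (intro Collect_cong conj_cong refl iffI)
    fix \<omega> assume "r < card {i\<in>I. Q i \<omega>}"
    then show "\<exists>S\<in>{S. S \<subseteq> I \<and> r < card S}. \<forall>i\<in>S. Q i \<omega>"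
      by (intro bexI[of _ "{i\<in>I. Q i \<omega>}"]) auto
  next
    fix \<omega> assume "\<exists>S\<in>{S. S \<subseteq> I \<and> r < card S}. \<forall>i\<in>S. Q i \<omega>"
    then obtain S where S: "S \<subseteq> I" "r < card S" "\<forall>i\<in>S. Q i \<omega>" by blast
    then have "card S \<le> card {i\<in>I. Q i \<omega>}" using assms(1) by (intro card_mono) auto
    then show "r < card {i\<in>I. Q i \<omega>}" using S(2) by simp
  qed
  also have "\<dots> \<in> sets M"
  proof (intro sets.sets_Collect_finite_Ex)
    show "finite {S. S \<subseteq> I \<and> r < card S}" by (rule finite_subset[of _ "Pow I"]) (auto simp: assms(1))
    fix S assume "S \<in> {S. S \<subseteq> I \<and> r < card S}"
    then show "{\<omega> \<in> space M. \<forall>i\<in>S. Q i \<omega>} \<in> sets M"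
      using assms by (intro sets.sets_Collect_finite_All) (auto intro: finite_subset)
  qed
  finally show ?thesis .
qed

lemma measurable_noise_block:
  assumes "b < B"
  shows "noise_block K T b \<in> noise_space K (B * T) \<rightarrow>\<^sub>M noise_space K T"
  unfolding noise_block_def noise_space_def
  using slot_in_blocks[OF assms, of _ T]
  by (intro measurable_restrict measurable_component_singleton) auto

context block_coding
begin

definition bad_channels :: "channel set" where
  "bad_channels = {H \<in> space (channel_space K (B * T)).
     r < card {b\<in>{..<B}. channel_block K T b H \<notin> good_channels K N T X A}}"

definition bad_noise :: "noise set" where
  "bad_noise = {Z \<in> space (noise_space K (B * T)).
     r < card {b\<in>{..<B}. noise_block K T b Z \<notin> good_noise K T A}}"

lemma sets_bad_channels: "bad_channels \<in> sets (channel_space K (B * T))"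
  unfolding bad_channels_def
proof (rule sets_card_greater)
  fix b assume "b \<in> {..<B}"
  then have "channel_block K T b \<in> channel_space K (B * T) \<rightarrow>\<^sub>M channel_space K T"
    using measurable_channel_block[of b B K T] by (simp add: sets_channel_space cong: measurable_cong_sets)
  from measurable_sets[OF this sets.compl_sets[OF sets_good_channels[OF scheme, of A]]] measurable_space[OF this]
  show "{H \<in> space (channel_space K (B * T)). channel_block K T b H \<notin> good_channels K N T X A} \<in> sets (channel_space K (B * T))"
    by (simp add: vimage_def Int_def conj_commute cong: conj_cong)
qed simp

lemma sets_bad_noise: "bad_noise \<in> sets (noise_space K (B * T))"
  unfolding bad_noise_def
proof (rule sets_card_greater)
  fix b assume "b \<in> {..<B}"
  then have "noise_block K T b \<in> noise_space K (B * T) \<rightarrow>\<^sub>M noise_space K T"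
    using measurable_noise_block by simp
  from measurable_sets[OF this sets.compl_sets[OF sets_good_noise[of K T A]]] measurable_space[OF this]
  show "{Z \<in> space (noise_space K (B * T)). noise_block K T b Z \<notin> good_noise K T A} \<in> sets (noise_space K (B * T))"
    by (simp add: vimage_def Int_def conj_commute cong: conj_cong)
qed simp

lemma measure_bad_channels:
  "measure (channel_space K (B * T)) bad_channels
    \<le> 2 ^ B * measure (channel_space K T) (space (channel_space K T) - good_channels K N T X A) ^ r"
  unfolding bad_channels_def channel_space_def channel_block_def
proof (rule measure_many_bad_blocks[OF prob_space_complex_gaussian])
  show "inj_on (\<lambda>(b, x). case x of (t, x') \<Rightarrow> (b * T + t, x')) ({..<B} \<times> channel_index K T)"
  proof (rule inj_onI, clarsimp simp: channel_index_def)
    fix b t b' t' assume "Suc 0 \<le> t" "t \<le> T" "Suc 0 \<le> t'" "t' \<le> T" "b * T + t = b' * T + t'"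
    then show "b = b' \<and> t = t'" by (intro slot_inj) auto
  qed
  show "(case x of (t, x') \<Rightarrow> (b * T + t, x')) \<in> channel_index K (B * T)"
    if "b < B" "x \<in> channel_index K T" for b x
    using that slot_in_blocks[OF that(1), of "fst x" T] by (auto simp: channel_index_def)
  show "good_channels K N T X A \<in> sets (\<Pi>\<^sub>M i\<in>channel_index K T. complex_gaussian)"
    using sets_good_channels[OF scheme, of A] unfolding channel_space_def .
  show "channel_index K T \<noteq> {}" using K T by (auto simp: channel_index_def)
qed

lemma measure_bad_noise:
  "measure (noise_space K (B * T)) bad_noise
    \<le> 2 ^ B * measure (noise_space K T) (space (noise_space K T) - good_noise K T A) ^ r"
  unfolding bad_noise_def noise_space_def noise_block_def
proof (rule measure_many_bad_blocks[OF prob_space_complex_gaussian])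
  show "inj_on (\<lambda>(b, x). case x of (t, k) \<Rightarrow> (b * T + t, k)) ({..<B} \<times> ({1..T} \<times> {1..K}))"
  proof (rule inj_onI, clarsimp)
    fix b t b' t' assume "Suc 0 \<le> t" "t \<le> T" "Suc 0 \<le> t'" "t' \<le> T" "b * T + t = b' * T + t'"
    then show "b = b' \<and> t = t'" by (intro slot_inj) auto
  qed
  show "(case x of (t, k) \<Rightarrow> (b * T + t, k)) \<in> {1..B * T} \<times> {1..K}"
    if "b < B" "x \<in> {1..T} \<times> {1..K}" for b x
    using that slot_in_blocks[OF that(1), of "fst x" T] by auto
  show "good_noise K T A \<in> sets (\<Pi>\<^sub>M i\<in>{1..T} \<times> {1..K}. complex_gaussian)"
    using sets_good_noise[of K T A] unfolding noise_space_def .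
  show "{1..T} \<times> {1..K} \<noteq> {}" using K T by auto
qed

text \<open>By \<open>decode_correct\<close> an error forces too many bad channel blocks or too many
  bad noise blocks, and each of these events is a cylinder over one factor of the space.\<close>

lemma error_prob_le:
  assumes k: "k \<in> {1..K}"
  shows "error_prob K code k \<le> measure (channel_space K (B * T)) bad_channels + measure (noise_space K (B * T)) bad_noise"
proof -
  let ?W = "message_space K (\<lambda>_. m)" and ?H = "channel_space K (B * T)" and ?Z = "noise_space K (B * T)"
  let ?S = "code_space K code"
  have S: "?S = ?W \<Otimes>\<^sub>M (?H \<Otimes>\<^sub>M ?Z)" by (simp add: code_space_def)
  interpret S: prob_space ?S by (rule prob_space_code_space[OF measurable_code])
  interpret W: prob_space ?W unfolding message_space_def
    using m by (intro prob_space_PiM prob_space_uniform_count_measure) (auto simp: lessThan_empty_iff)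
  interpret H: prob_space ?H by (rule prob_space_channel_space)
  interpret Z: prob_space ?Z by (rule prob_space_noise_space)
  interpret HZ: prob_space "?H \<Otimes>\<^sub>M ?Z" by (intro prob_space_pair prob_space_channel_space prob_space_noise_space)
  let ?EH = "space ?W \<times> (bad_channels \<times> space ?Z)" and ?EZ = "space ?W \<times> (space ?H \<times> bad_noise)"
  have EH: "?EH \<in> sets ?S" "?EZ \<in> sets ?S"
    unfolding S using sets_bad_channels sets_bad_noise by auto
  have "S.prob ?EH = H.prob bad_channels"
    unfolding S measure_def using sets_bad_channels
    by (simp add: HZ.emeasure_pair_measure_Times Z.emeasure_pair_measure_Times W.emeasure_space_1 Z.emeasure_space_1)
  moreover have "S.prob ?EZ = Z.prob bad_noise"
    unfolding S measure_def using sets_bad_noise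
    by (simp add: HZ.emeasure_pair_measure_Times Z.emeasure_pair_measure_Times W.emeasure_space_1 H.emeasure_space_1)
  moreover have "error_event K code k \<subseteq> ?EH \<union> ?EZ"
  proof
    fix \<omega> assume \<omega>: "\<omega> \<in> error_event K code k"
    obtain W H Z where \<omega>_eq: "\<omega> = (W, H, Z)" by (cases \<omega>)
    have sp: "W \<in> space ?W" "H \<in> space ?H" "Z \<in> space ?Z"
      using \<omega> by (auto simp: error_event_def \<omega>_eq S space_pair_measure)
    have w: "W j < m" if "j \<in> {1..K}" for j
      using PiE_mem[OF sp(1)[unfolded message_space_def space_PiM] that] by (simp add: space_uniform_count_measure)
    show "\<omega> \<in> ?EH \<union> ?EZ"
    proof (rule ccontr)
      assume "\<omega> \<notin> ?EH \<union> ?EZ"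
      then have "card {b\<in>{..<B}. channel_block K T b H \<notin> good_channels K N T X A} \<le> r"
        "card {b\<in>{..<B}. noise_block K T b Z \<notin> good_noise K T A} \<le> r"
        using sp by (auto simp: \<omega>_eq bad_channels_def bad_noise_def)
      from decode_correct[OF k w this] show False
        using \<omega> by (simp add: error_event_def \<omega>_eq)
    qed
  qed
  then have "S.prob (error_event K code k) \<le> S.prob (?EH \<union> ?EZ)"
    using EH by (intro S.finite_measure_mono) auto
  moreover have "S.prob (?EH \<union> ?EZ) \<le> S.prob ?EH + S.prob ?EZ"
    using EH by (intro measure_Un_le)
  ultimately show ?thesis by (simp add: error_prob_def)
qed

end

text \<open>Instance with \<open>j * i\<close> blocks and \<open>r = i\<close>, so a fraction
  \<open>1 / j\<close> of bad blocks is tolerated for channel and noise each. Gilbert--Varshamov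
  yields at least \<open>q ^ i\<close> words: the distance costs \<open>Q ^ (4 * i)\<close> and the
  choice of positions \<open>2 ^ (j * i)\<close>. The union bound multiplies
  \<open>2 ^ (j * i)\<close> with the \<open>i\<close>-th power of \<open>(1/2) ^ Suc j\<close>,
  which leaves \<open>(1/2) ^ i\<close>.\<close>

lemma ex_block_code:
  assumes K: "1 \<le> K" and T: "0 < T" and X: "resolving_scheme K N T X"
    and A: "0 < A" and \<alpha>: "2 * real T * A\<^sup>2 < \<alpha>"
    and power: "real K * (real N * (A * (2 * \<alpha> * real L)))\<^sup>2 \<le> P"
    and p: "measure (channel_space K T) (space (channel_space K T) - good_channels K N T X A) \<le> (1/2) ^ Suc j"
      "measure (noise_space K T) (space (noise_space K T) - good_noise K T A) \<le> (1/2) ^ Suc j"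
    and j: "4 \<le> j" and q: "q = L ^ (2 * N * (j - 4)) div 2 ^ j" "1 \<le> q"
  shows "\<exists>C. measurable_code K C \<and> power_constraint K P C \<and> blocklength C = j * i * T \<and>
    (\<forall>k\<in>{1..K}. num_msgs C k = q ^ i \<and> error_prob K C k \<le> 2 * (1/2) ^ i)"
proof -
  have \<alpha>_pos: "0 < \<alpha>" using \<alpha> by (rule le_less_trans[rotated]) simp
  define Q where "Q = card (grid_words N \<alpha> L)"
  have Q: "Q = L ^ (2 * N)" using card_grid_words[OF \<alpha>_pos] by (simp add: Q_def)
  have qQ: "q * 2 ^ j \<le> Q ^ (j - 4)"
    unfolding q(1) Q by (simp add: power_mult)
  have "Q > 0"
  proof (rule ccontr)
    assume "\<not> Q > 0"
    \<comment> \<open>For \<open>j = 4\<close> the power is \<open>0 ^ 0 = 1\<close>, which is still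
      below \<open>q * 2 ^ j\<close>.\<close>
    then have "Q ^ (j - 4) \<le> 1" by (cases "j - 4") auto
    moreover have "(2::nat) \<le> 2 ^ j" using power_increasing[of 1 j "2::nat"] j by simp
    moreover have "2 ^ j \<le> q * 2 ^ j" using q(2) by simp
    ultimately show False using qQ by linarith
  qed
  then have ne: "grid_words N \<alpha> L \<noteq> {}" unfolding Q_def by (metis card.empty less_numeral_extra(3))
  obtain \<C> where \<C>: "\<C> \<subseteq> PiE {..<j * i} (\<lambda>_. grid_words N \<alpha> L)" "finite \<C>"
    "\<forall>x\<in>\<C>. \<forall>y\<in>\<C>. x \<noteq> y \<longrightarrow> 4 * i < card {b \<in> {..<j * i}. x b \<noteq> y b}"
    "Q ^ (j * i) \<le> card \<C> * (2 ^ (j * i) * Q ^ (4 * i))"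
    by (rule ex_large_distance_code[OF finite_grid_words ne, where B = "j * i" and r = "4 * i", folded Q_def])
  have "q ^ i * (2 ^ (j * i) * Q ^ (4 * i)) = (q * 2 ^ j) ^ i * Q ^ (4 * i)"
    by (simp add: power_mult power_mult_distrib)
  also have "\<dots> \<le> (Q ^ (j - 4)) ^ i * Q ^ (4 * i)" using qQ by (intro mult_right_mono power_mono) auto
  also have "\<dots> = Q ^ ((j - 4) * i + 4 * i)" by (simp only: power_mult power_add)
  also have "(j - 4) * i + 4 * i = j * i" using j by (simp flip: distrib_right)
  also note \<C>(4)
  finally have qi: "q ^ i \<le> card \<C>" using \<open>Q > 0\<close> by simp
  obtain cw where cw: "bij_betw cw {0..<card \<C>} \<C>" using ex_bij_betw_nat_finite[OF \<C>(2)] by blast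
  have in\<C>: "cw w \<in> \<C>" if "w < q ^ i" for w using bij_betwE[OF cw] that qi by auto
  interpret block_coding K N T X A \<alpha> P L "j * i" i "q ^ i" cw
  proof
    show "1 \<le> q ^ i" using q(2) by simp
    show "cw w b \<in> grid_words N \<alpha> L" if "w < q ^ i" "b < j * i" for w b
      using subsetD[OF \<C>(1) in\<C>[OF that(1)]] that(2) by auto
    show "4 * i < card {b \<in> {..<j * i}. cw w b \<noteq> cw w' b}" if "w < q ^ i" "w' < q ^ i" "w \<noteq> w'" for w w'
    proof (rule \<C>(3)[rule_format])
      show "cw w \<noteq> cw w'" using inj_onD[OF bij_betw_imp_inj_on[OF cw], of w w'] that qi by auto
    qed (intro in\<C> that)+
  qed fact+
  have tail: "2 ^ (j * i) * x ^ i \<le> (1/2) ^ i" if "0 \<le> x" "x \<le> (1/2) ^ Suc j" for x :: real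
  proof -
    have "2 ^ (j * i) * x ^ i = (2 ^ j * x) ^ i" by (simp add: power_mult power_mult_distrib)
    also have "\<dots> \<le> (2 ^ j * (1/2) ^ Suc j) ^ i" using that by (intro power_mono mult_left_mono) auto
    also have "2 ^ j * (1/2) ^ Suc j = (1/2 :: real)" by (simp add: power_divide)
    finally show ?thesis .
  qed
  have "error_prob K code k \<le> 2 * (1/2) ^ i" if "k \<in> {1..K}" for k
    using error_prob_le[OF that] measure_bad_channels measure_bad_noise
      tail[OF measure_nonneg p(1)] tail[OF measure_nonneg p(2)] by linarith
  then show ?thesis
    using measurable_code power_constraint by (intro exI[of _ code]) simp
qed

text \<open>Scheme, threshold \<open>A\<close>, spacing and the constant \<open>c\<close> are chosen
  before \<open>P\<close>; only the number of grid points per real dimension grows, like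
  \<open>sqrt P\<close>.\<close>

lemma rate_achievable_block_codes:
  assumes K: "1 \<le> K" and T: "0 < T" and X: "resolving_scheme K N T X" and j: "4 \<le> j"
  shows "\<exists>c>0. \<forall>P>0. \<forall>q. q = nat \<lfloor>c * sqrt P\<rfloor> ^ (2 * N * (j - 4)) div 2 ^ j \<longrightarrow> 1 \<le> q \<longrightarrow>
    rate_achievable K P (\<lambda>_. ln (real q) / real (j * T))"
proof -
  obtain A where A: "A > 0" 
    "measure (channel_space K T) (space (channel_space K T) - good_channels K N T X A) < (1/2) ^ Suc j"
    "measure (noise_space K T) (space (noise_space K T) - good_noise K T A) < (1/2) ^ Suc j"
    using ex_good_probability[OF X, of "(1/2) ^ Suc j"] by auto
  define \<alpha> where "\<alpha> = 2 * real T * A\<^sup>2 + 1"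
  have \<alpha>: "2 * real T * A\<^sup>2 < \<alpha>" "0 < \<alpha>" by (auto simp: \<alpha>_def add_nonneg_pos)
  define D where "D = real N * (A * (2 * \<alpha>))"
  have D: "0 \<le> D" using A \<alpha> by (simp add: D_def)
  \<comment> \<open>With this constant \<open>D * L\<close> is at most \<open>sqrt P / K\<close>,
    hence \<open>K * (D * L)^2 \<le> P / K \<le> P\<close>.\<close>
  define c where "c = 1 / (real K * (1 + D))"
  have c: "c > 0" using K D by (simp add: c_def)
  have "rate_achievable K P (\<lambda>_. ln (real q) / real (j * T))"
    if P: "0 < P" and q: "q = nat \<lfloor>c * sqrt P\<rfloor> ^ (2 * N * (j - 4)) div 2 ^ j" "1 \<le> q" for P q
  proof -
    define L where "L = nat \<lfloor>c * sqrt P\<rfloor>"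
    have "real L \<le> c * sqrt P" using c P by (simp add: L_def)
    then have "D * real L \<le> D * (c * sqrt P)" using D by (intro mult_left_mono)
    also have "\<dots> \<le> 1 / real K * sqrt P"
    proof -
      have "D * c = D / (1 + D) / real K" by (simp add: c_def)
      also have "\<dots> \<le> 1 / real K" using D by (intro divide_right_mono) simp_all
      finally have "D * c * sqrt P \<le> 1 / real K * sqrt P" by (rule mult_right_mono) (use P in simp)
      then show ?thesis by (simp only: mult.assoc)
    qed
    finally have "(D * real L)\<^sup>2 \<le> (1 / real K * sqrt P)\<^sup>2" using D by (intro power_mono) auto
    also have "\<dots> = P / (real K * real K)" using P by (simp add: power_mult_distrib power_divide power2_eq_square)
    finally have "real K * (D * real L)\<^sup>2 \<le> real K * (P / (real K * real K))" by (intro mult_left_mono) auto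
    also have "\<dots> \<le> P" using K P by (simp add: field_simps)
    finally have power: "real K * (real N * (A * (2 * \<alpha> * real L)))\<^sup>2 \<le> P" by (simp add: D_def mult_ac)
    have "\<forall>i. \<exists>C. measurable_code K C \<and> power_constraint K P C \<and> blocklength C = j * i * T \<and>
      (\<forall>k\<in>{1..K}. num_msgs C k = q ^ i \<and> error_prob K C k \<le> 2 * (1/2) ^ i)"
      using ex_block_code[OF K T X A(1) \<alpha>(1) power _ _ j q(1)[folded L_def] q(2)] A(2,3) by simp
    from choice[OF this] obtain C where C: "\<And>i. measurable_code K (C i)" "\<And>i. power_constraint K P (C i)"
      "\<And>i. blocklength (C i) = j * i * T" "\<And>i k. k \<in> {1..K} \<Longrightarrow> num_msgs (C i) k = q ^ i"
      "\<And>i k. k \<in> {1..K} \<Longrightarrow> error_prob K (C i) k \<le> 2 * (1/2) ^ i" by blast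
    show ?thesis unfolding rate_achievable_def
    proof (intro exI[of _ C] conjI allI ballI C)
      have "filterlim (\<lambda>i. i * (j * T)) at_top sequentially"
        using j T by (intro filterlim_subseq) (auto simp: strict_mono_def)
      then show "filterlim (\<lambda>i. blocklength (C i)) at_top sequentially" by (simp add: C(3) mult_ac)
      fix k assume k: "k \<in> {1..K}"
      have "eventually (\<lambda>i. ln (real (num_msgs (C i) k)) / real (blocklength (C i)) = ln (real q) / real (j * T)) sequentially"
        using eventually_gt_at_top[of 0]
      proof eventually_elim
        case (elim i)
        then show ?case using q(2) j T by (simp add: C(3) C(4)[OF k] ln_realpow)
      qed
      then show "(\<lambda>i. ln (real (num_msgs (C i) k)) / real (blocklength (C i))) \<longlonglongrightarrow> ln (real q) / real (j * T)"
        by (rule tendsto_eventually)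
      have "(\<lambda>i. 2 * (1/2) ^ i :: real) \<longlonglongrightarrow> 2 * 0" by (intro tendsto_intros) auto
      then have "(\<lambda>i. 2 * (1/2) ^ i :: real) \<longlonglongrightarrow> 0" by simp
      then show "(\<lambda>i. error_prob K (C i) k) \<longlonglongrightarrow> 0"
        by (rule tendsto_sandwich[OF _ _ tendsto_const, rotated 2])
          (auto simp: error_prob_def intro!: always_eventually C(5)[OF k, unfolded error_prob_def])
    qed
  qed
  then show ?thesis using c by blast
qed

section \<open>Degrees of freedom as a limit of rates\<close>

lemma rate_achievable_zero: "rate_achievable K P (\<lambda>_. 0)"
proof -
  define C where "C = (\<lambda>i::nat. \<lparr>blocklength = i, num_msgs = (\<lambda>_. 1), encode = (\<lambda>_ _ _ _ _. 0), decode = (\<lambda>_ _. 0)\<rparr>)"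
  have "error_event K (C i) k = {}" if "k \<in> {1..K}" for i k
  proof -
    have "W k = 0" if "W \<in> space (message_space K (\<lambda>_. 1))" for W
      using PiE_mem[OF that[unfolded message_space_def space_PiM] \<open>k \<in> {1..K}\<close>]
      by (simp add: space_uniform_count_measure)
    then show ?thesis by (auto simp: error_event_def C_def code_space_def space_pair_measure)
  qed
  then have "error_prob K (C i) k = 0" if "k \<in> {1..K}" for i k using that by (simp add: error_prob_def)
  moreover have "measurable_code K (C i)" for i by (simp add: C_def measurable_code_def)
  moreover have "power_constraint K P (C i)" for i
    by (simp add: C_def power_constraint_def transmitted_def case_prod_beta')
  ultimately show ?thesis unfolding rate_achievable_def
    by (intro exI[of _ C] conjI allI ballI) (auto simp: C_def filterlim_ident)
qed

text \<open>Rates that are optimal up to \<open>1 / P\<close> among the achievable ones do at least as well as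
  each of the approximating families.\<close>

lemma dof_achievableI:
  assumes "\<And>e. e > 0 \<Longrightarrow> eventually (\<lambda>P. \<exists>R. rate_achievable K P R \<and> \<bar>(\<Sum>k=1..K. R k) / ln P - d\<bar> < e) at_top"
  shows "dof_achievable K d"
proof -
  define f where "f = (\<lambda>P R. \<bar>(\<Sum>k=1..K. R k) / ln P - d\<bar>)"
  have "\<exists>R. rate_achievable K P R \<and> (\<forall>R'. rate_achievable K P R' \<longrightarrow> f P R < f P R' + 1 / P)" if "P > 0" for P
  proof -
    let ?V = "f P ` Collect (rate_achievable K P)"
    have ne: "?V \<noteq> {}" using rate_achievable_zero by blast
    have bdd: "bdd_below ?V" by (rule bdd_belowI[of _ 0]) (auto simp: f_def)
    have "Inf ?V < Inf ?V + 1 / P" using that by simp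
    then obtain R where R: "rate_achievable K P R" "f P R < Inf ?V + 1 / P"
      using cInf_lessD[OF ne] by blast
    have "f P R < f P R' + 1 / P" if "rate_achievable K P R'" for R'
      using R(2) cInf_lower[OF _ bdd, of "f P R'"] that by fastforce
    then show ?thesis using R(1) by blast
  qed
  then have "\<forall>P. \<exists>R. P > 0 \<longrightarrow> rate_achievable K P R \<and> (\<forall>R'. rate_achievable K P R' \<longrightarrow> f P R < f P R' + 1 / P)"
    by blast
  from choice[OF this] obtain R where R: "\<And>P. P > 0 \<Longrightarrow> rate_achievable K P (R P)"
    "\<And>P R'. P > 0 \<Longrightarrow> rate_achievable K P R' \<Longrightarrow> f P (R P) < f P R' + 1 / P" by blast
  have "((\<lambda>P. (\<Sum>k=1..K. R P k) / ln P) \<longlongrightarrow> d) at_top"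
  proof (rule tendstoI)
    fix e :: real assume "0 < e"
    then have "eventually (\<lambda>P. \<exists>R. rate_achievable K P R \<and> \<bar>(\<Sum>k=1..K. R k) / ln P - d\<bar> < e / 2) at_top"
      by (intro assms) simp
    moreover have "eventually (\<lambda>P. P > max 1 (2 / e)) at_top" by (rule eventually_gt_at_top)
    ultimately show "eventually (\<lambda>P. dist ((\<Sum>k=1..K. R P k) / ln P) d < e) at_top"
    proof eventually_elim
      case (elim P)
      then obtain R' where R': "rate_achievable K P R'" "f P R' < e / 2" by (auto simp: f_def)
      have "P > 0" "1 / P < e / 2" using elim \<open>0 < e\<close> by (auto simp: field_simps)
      then have "f P (R P) < e" using R(2)[OF \<open>P > 0\<close> R'(1)] R'(2) by simp
      then show ?case by (simp add: f_def dist_real_def)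
    qed
  qed
  then show ?thesis unfolding dof_achievable_def using R(1) by blast
qed

text \<open>The two roundings cost only constant factors, which disappear when logarithms are
  divided: the quantity lies between constant multiples of the \<open>e\<close>-th power of
  \<open>sqrt P\<close>.\<close>

lemma ln_quantized_power_asymptotics:
  assumes "c > 0" "1 \<le> e"
  shows "eventually (\<lambda>P. 1 \<le> nat \<lfloor>c * sqrt P\<rfloor> ^ e div 2 ^ j) at_top"
    and "((\<lambda>P. ln (real (nat \<lfloor>c * sqrt P\<rfloor> ^ e div 2 ^ j)) / ln P) \<longlongrightarrow> real e / 2) at_top"
proof -
  define q where "q = (\<lambda>P. nat \<lfloor>c * sqrt P\<rfloor> ^ e div 2 ^ j)"
  \<comment> \<open>Large enough that the rounded \<open>L\<close> is at least
    \<open>2 ^ (j + 1)\<close>. Then \<open>L ^ e / 2 ^ j\<close> is at least 2, and the 1 lost in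
    the integer division is at most half of it.\<close>
  have "eventually (\<lambda>P. c * sqrt P > 2 ^ (j + 3)) at_top"
    using assms(1) by real_asymp
  then have bounds: "eventually (\<lambda>P. 1 \<le> q P \<and> (c * sqrt P / 2) ^ e / 2 ^ (j + 1) \<le> real (q P) \<and>
      real (q P) \<le> (c * sqrt P) ^ e \<and> 2 < c * sqrt P) at_top"
  proof eventually_elim
    case (elim P)
    define x where "x = c * sqrt P"
    define L where "L = nat \<lfloor>x\<rfloor>"
    have x8: "x > 2 ^ (j + 3)" using elim by (simp add: x_def)
    have "(2::real) ^ (j + 3) \<ge> 2 ^ 3" by (intro power_increasing) auto
    then have x2: "x > 2" using x8 by simp
    have L: "real L \<le> x" "x / 2 \<le> real L"
      using x2 by (simp add: L_def, unfold L_def, linarith)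
    have "2 ^ (j + 1) \<le> real L" using L(2) x8 by (simp add: power_add)
    also have "\<dots> \<le> real L ^ e" using assms(2) L(2) x2 by (intro self_le_power) auto
    finally have Le: "2 ^ (j + 1) \<le> real L ^ e" .
    have qr: "real L ^ e / 2 ^ j - 1 \<le> real (q P)" "real (q P) \<le> real L ^ e / 2 ^ j"
    proof -
      have "real (q P) = real_of_int \<lfloor>real (L ^ e) / real (2 ^ j)\<rfloor>"
        unfolding q_def L_def x_def by (simp only: floor_divide_of_nat_eq of_int_of_nat_eq)
      then show "real L ^ e / 2 ^ j - 1 \<le> real (q P)" "real (q P) \<le> real L ^ e / 2 ^ j" by simp_all
    qed
    have "(x / 2) ^ e / 2 ^ (j + 1) \<le> real L ^ e / 2 ^ (j + 1)"
      using L(2) x2 by (intro divide_right_mono power_mono) auto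
    also have "\<dots> \<le> real L ^ e / 2 ^ j - 1" using Le by (simp add: field_simps)
    finally have low: "(x / 2) ^ e / 2 ^ (j + 1) \<le> real (q P)" using qr(1) by linarith
    have "1 \<le> real L ^ e / 2 ^ j - 1" using Le by (simp add: field_simps)
    then have "1 \<le> q P" using qr(1) by linarith
    moreover have "real L ^ e / 2 ^ j \<le> real L ^ e / 1" by (intro divide_left_mono) simp_all
    then have "real (q P) \<le> x ^ e" using qr(2) power_mono[OF L(1), of e] by linarith
    ultimately show ?case using low x2 by (simp add: x_def)
  qed
  then show "eventually (\<lambda>P. 1 \<le> nat \<lfloor>c * sqrt P\<rfloor> ^ e div 2 ^ j) at_top"
    by (auto simp: q_def elim: eventually_mono)
  have P1: "eventually (\<lambda>P::real. P > 1) at_top" by (rule eventually_gt_at_top)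
  have "((\<lambda>P. ln (real (q P)) / ln P) \<longlongrightarrow> real e / 2) at_top"
  proof (rule tendsto_sandwich)
    show "eventually (\<lambda>P. (real e * ln (c * sqrt P / 2) - real (j + 1) * ln 2) / ln P \<le> ln (real (q P)) / ln P) at_top"
      using bounds P1
    proof eventually_elim
      case (elim P)
      have "real e * ln (c * sqrt P / 2) - real (j + 1) * ln 2 = ln ((c * sqrt P / 2) ^ e / 2 ^ (j + 1))"
      proof -
        have "0 < (c * sqrt P / 2) ^ e" using elim by (intro zero_less_power) simp
        then have "ln ((c * sqrt P / 2) ^ e / 2 ^ (j + 1)) = ln ((c * sqrt P / 2) ^ e) - ln (2 ^ (j + 1))"
          by (intro ln_divide_pos) simp_all
        then show ?thesis by (simp only: ln_realpow)
      qed
      also have "\<dots> \<le> ln (real (q P))" using elim by (intro ln_mono) auto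
      finally show ?case using elim by (intro divide_right_mono) auto
    qed
    show "eventually (\<lambda>P. ln (real (q P)) / ln P \<le> (real e * ln (c * sqrt P)) / ln P) at_top"
      using bounds P1
    proof eventually_elim
      case (elim P)
      have "ln (real (q P)) \<le> ln ((c * sqrt P) ^ e)" using elim by (intro ln_mono) auto
      also have "\<dots> = real e * ln (c * sqrt P)" by (rule ln_realpow)
      finally show ?case using elim by (intro divide_right_mono) auto
    qed
    show "((\<lambda>P. (real e * ln (c * sqrt P / 2) - real (j + 1) * ln 2) / ln P) \<longlongrightarrow> real e / 2) at_top"
      using assms(1) by real_asymp
    show "((\<lambda>P. (real e * ln (c * sqrt P)) / ln P) \<longlongrightarrow> real e / 2) at_top"
      using assms(1) by real_asymp
  qed
  then show "((\<lambda>P. ln (real (nat \<lfloor>c * sqrt P\<rfloor> ^ e div 2 ^ j)) / ln P) \<longlongrightarrow> real e / 2) at_top"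
    by (simp add: q_def)
qed

text \<open>The codes with parameter \<open>j\<close> reach \<open>d - 4 * d / j\<close>, where the
  second term is the price of the minimum distance; it tends to 0 as \<open>j\<close> grows.\<close>

lemma dof_achievable_resolving_scheme:
  assumes K: "1 \<le> K" and T: "0 < T" and X: "resolving_scheme K N T X" and N: "1 \<le> N"
  shows "dof_achievable K (real K * real N / real T)"
proof (rule dof_achievableI)
  fix e :: real assume e: "0 < e"
  define d where "d = real K * real N / real T"
  have d: "d > 0" using K T N by (simp add: d_def)
  obtain j0 :: nat where j0: "8 * d / e < real j0" using reals_Archimedean2 by blast
  \<comment> \<open>At least 5, so that the exponent \<open>2 * N * (j - 4)\<close> is positive, and
    above \<open>8 * d / e\<close>, so that the loss is below \<open>e / 2\<close>.\<close>
  define j where "j = max 5 j0"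
  have j: "5 \<le> j" "4 * d / real j < e / 2"
  proof -
    show "5 \<le> j" by (simp add: j_def)
    have "8 * d / e < real j" using j0 by (simp add: j_def)
    then show "4 * d / real j < e / 2" using e \<open>5 \<le> j\<close> by (simp add: field_simps)
  qed
  obtain c where c: "c > 0" "\<And>P q. 0 < P \<Longrightarrow> q = nat \<lfloor>c * sqrt P\<rfloor> ^ (2 * N * (j - 4)) div 2 ^ j \<Longrightarrow> 1 \<le> q \<Longrightarrow>
      rate_achievable K P (\<lambda>_. ln (real q) / real (j * T))"
    using rate_achievable_block_codes[OF K T X, of j] j by auto
  define q where "q = (\<lambda>P. nat \<lfloor>c * sqrt P\<rfloor> ^ (2 * N * (j - 4)) div 2 ^ j)"
  have ex: "1 \<le> 2 * N * (j - 4)" using N j by simp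
  have asym: "eventually (\<lambda>P. 1 \<le> q P) at_top"
    "((\<lambda>P. ln (real (q P)) / ln P) \<longlongrightarrow> real (2 * N * (j - 4)) / 2) at_top"
    unfolding q_def by (rule ln_quantized_power_asymptotics[OF c(1) ex])+
  have "((\<lambda>P. real K / real (j * T) * (ln (real (q P)) / ln P)) \<longlongrightarrow> real K / real (j * T) * (real (2 * N * (j - 4)) / 2)) at_top"
    by (rule tendsto_mult[OF tendsto_const asym(2)])
  also have "real K / real (j * T) * (real (2 * N * (j - 4)) / 2) = d - 4 * d / real j"
    using j T by (simp add: d_def of_nat_diff field_simps)
  also have "(\<lambda>P. real K / real (j * T) * (ln (real (q P)) / ln P)) = (\<lambda>P. (\<Sum>k=1..K. ln (real (q P)) / real (j * T)) / ln P)"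
    by (simp add: fun_eq_iff)
  finally have lim: "((\<lambda>P. (\<Sum>k=1..K. ln (real (q P)) / real (j * T)) / ln P) \<longlongrightarrow> d - 4 * d / real j) at_top" .
  have "0 < e / 2" using e by simp
  from tendstoD[OF lim this]
  have "eventually (\<lambda>P. \<bar>(\<Sum>k=1..K. ln (real (q P)) / real (j * T)) / ln P - (d - 4 * d / real j)\<bar> < e / 2) at_top"
    by (simp only: dist_real_def)
  then show "eventually (\<lambda>P. \<exists>R. rate_achievable K P R \<and> \<bar>(\<Sum>k=1..K. R k) / ln P - real K * real N / real T\<bar> < e) at_top"
    using asym(1) eventually_gt_at_top[of 0]
  proof eventually_elim
    case (elim P)
    have "rate_achievable K P (\<lambda>_. ln (real (q P)) / real (j * T))"
      using elim by (intro c(2)) (auto simp: q_def)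
    moreover have "0 \<le> 4 * d / real j" using d by simp
    then have "\<bar>(\<Sum>k=1..K. ln (real (q P)) / real (j * T)) / ln P - d\<bar> < e"
      using elim(1) j(2) by linarith
    ultimately show ?case unfolding d_def by blast
  qed
qed

theorem theorem1:
  fixes K :: nat
  assumes "K \<ge> 2"
  shows "dof_achievable K (sum_dof K)"
proof -
  let ?f = "\<lambda>m::int. (real_of_int m)\<^sup>2 / (1 + real_of_int m * (real_of_int m - 1) / order_param K)"
  have ach: "dof_achievable K (?f m)" if m: "2 \<le> m" "m \<le> int K" for m
  proof -
    define q where "q = nat m"
    have q: "2 \<le> q" "q \<le> K" "real_of_int m = real q" using m by (auto simp: q_def)
    obtain N T X where X: "resolving_scheme K N T X" "0 < T"
      and rate: "real K * real N / real T = ?f m"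
      using ex_resolving_scheme_rate[OF q(1,2)] unfolding q(3) by blast
    have "0 < ?f m"
      using order_param_bounds(1)[OF assms] m by (intro divide_pos_pos add_pos_nonneg divide_nonneg_nonneg) auto
    have "N \<noteq> 0"
    proof
      assume "N = 0"
      then have "real K * real N / real T = 0" by simp
      then have "?f m = 0" by (rule trans[OF rate[symmetric]])
      then show False using \<open>0 < ?f m\<close> by (simp only: less_irrefl)
    qed
    then show ?thesis using dof_achievable_resolving_scheme[OF _ X(2,1)] assms rate by simp
  qed
  \<comment> \<open>Since \<open>order_param K\<close> is at least 1 and
    \<open>2 * order_param K\<close> at most \<open>K\<close>, both roundings give a group size that
    the linear scheme admits.\<close>
  have "2 \<le> \<lfloor>2 * order_param K\<rfloor>" using order_param_bounds(1)[OF assms] by (simp add: le_floor_iff)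
  moreover have "\<lceil>2 * order_param K\<rceil> \<le> int K"
    using order_param_bounds(2)[OF assms] by (auto simp: ceiling_le_iff)
  moreover have "\<lfloor>2 * order_param K\<rfloor> \<le> \<lceil>2 * order_param K\<rceil>" by (rule floor_le_ceiling)
  ultimately have "dof_achievable K (?f \<lfloor>2 * order_param K\<rfloor>)" "dof_achievable K (?f \<lceil>2 * order_param K\<rceil>)"
    by (intro ach; linarith)+
  then show ?thesis unfolding sum_dof_def Let_def by (simp add: max_def)
qed

end
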